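(* Let $n\geq 2$. For $k\geq 1$ let $\Delta_n^k$ denote the degree $n$ term of $e_k[Lie_{\geq 2}^{(2)}]$. Define $\Delta_n=\sum_{k\geq 1} \Delta_n^k$ for $n\geq 2$, $\Delta_1=0$ and $\Delta_0=1$. Then, for $n\ge 2$: (1) $\displaystyle\Delta_n=\sum_{k=0}^n (-1)^k p_1^{n-k} h_k=p_1\Delta_{n-1}+(-1)^n h_n$; and hence (2) $\Delta_n$ coincides with the Frobenius characteristic of the homology representation of $S_n$ on the complex of injective words in the alphabet $\{1,2,\ldots,n\}$.
   Context: $h_n,e_n,p_n$ are the complete homogeneous, elementary and power-sum symmetric functions and $f[g]$ is plethysm. Let $C_n\subset S_n$ be the cyclic group generated by an $n$-cycle and let $2^{k_n}$ be the largest power of $2$ dividing $n$. $Lie_n^{(2)}$ is the Frobenius characteristic of the $S_n$-module induced from the linear character of $C_n$ sending the generator to $\exp(\frac{2\pi i}{n}\cdot 2^{k_n})$; $Lie^{(2)}_{\ge2}=\sum_{n\ge2}Lie_n^{(2)}$. The complex of injective words in the alphabet $\{1,\dots,n\}$ has one cell of dimension $m-1$ for every word $w_1w_2\cdots w_m$ of length $m\ge1$ with distinct letters in $\{1,\dots,n\}$, the faces of a word being its subwords, with boundary $\partial(w_1\cdots w_m)=\sum_{i=1}^m(-1)^{i-1}w_1\cdots\widehat{w_i}\cdots w_m$; $S_n$ acts by permuting letters. Its reduced rational homology is concentrated in the top degree $n-1$, and the homology representation is the $S_n$-module afforded by this top homology. *)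

theory Defs
  imports
    Complex_Main
    "HOL-Library.Multiset"
    "HOL-Library.Function_Algebras"
    "HOL-Combinatorics.Cycles"
    "HOL-Combinatorics.Orbits"
    "HOL-Computational_Algebra.Primes"
begin

section \<open>Formal power series in countably many variables\<close>

text \<open>
  Complex power series in \<open>x\<^sub>0, x\<^sub>1, x\<^sub>2, \<dots>\<close>, possibly of unbounded degree.
  The monomial \<open>\<Prod>i. x\<^sub>i ^ m\<^sub>i\<close> is the multiset in which \<open>i\<close> has multiplicity \<open>m\<^sub>i\<close>, so that
  monomials multiply by \<open>+\<close> and have degree \<open>size\<close>.  Symmetric functions, and formal
  sums of symmetric functions of increasing degree, are elements of this ring.
\<close>

typedef mseries = "UNIV :: (nat multiset \<Rightarrow> complex) set"
  morphisms mcoeff Mseries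
  by simp

lemma mcoeff_Mseries [simp]: "mcoeff (Mseries f) = f"
  by (simp add: Mseries_inverse)

lemma mseries_eq_iff: "f = g \<longleftrightarrow> (\<forall>M. mcoeff f M = mcoeff g M)"
  by (metis ext mcoeff_inject)

lemma finite_msubsets [simp]: "finite {A. A \<subseteq># (M :: 'a multiset)}"
proof (induction M)
  case empty
  then show ?case by simp
next
  case (add x M)
  have "{A. A \<subseteq># add_mset x M} \<subseteq> {A. A \<subseteq># M} \<union> add_mset x ` {A. A \<subseteq># M}"
  proof
    fix A assume "A \<in> {A. A \<subseteq># add_mset x M}"
    then have A: "A \<subseteq># add_mset x M" by simp
    show "A \<in> {A. A \<subseteq># M} \<union> add_mset x ` {A. A \<subseteq># M}"
    proof (cases "x \<in># A")
      case True
      then obtain B where "A = add_mset x B" by (meson mset_add)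
      with A show ?thesis by auto
    next
      case False
      then have "A \<subseteq># M"
        using A by (metis diff_single_trivial subset_eq_diff_conv union_mset_add_mset_right
            add.right_neutral)
      then show ?thesis by simp
    qed
  qed
  then show ?case
    by (rule finite_subset) (use add.IH in auto)
qed

definition msplits :: "'a multiset \<Rightarrow> ('a multiset \<times> 'a multiset) set" where
  "msplits M = {(A, B). A + B = M}"

lemma finite_msplits [simp]: "finite (msplits (M :: 'a multiset))"
proof (rule finite_subset)
  show "msplits M \<subseteq> {A. A \<subseteq># M} \<times> {A. A \<subseteq># M}"
    by (auto simp: msplits_def)
qed simp

instantiation mseries :: comm_ring_1
begin

definition zero_mseries :: mseries where "0 = Mseries (\<lambda>M. 0)"
definition one_mseries :: mseries where "1 = Mseries (\<lambda>M. if M = {#} then 1 else 0)"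
definition plus_mseries :: "mseries \<Rightarrow> mseries \<Rightarrow> mseries" where
  "f + g = Mseries (\<lambda>M. mcoeff f M + mcoeff g M)"
definition minus_mseries :: "mseries \<Rightarrow> mseries \<Rightarrow> mseries" where
  "f - g = Mseries (\<lambda>M. mcoeff f M - mcoeff g M)"
definition uminus_mseries :: "mseries \<Rightarrow> mseries" where
  "- f = Mseries (\<lambda>M. - mcoeff f M)"
definition times_mseries :: "mseries \<Rightarrow> mseries \<Rightarrow> mseries" where
  "f * g = Mseries (\<lambda>M. \<Sum>(A, B)\<in>msplits M. mcoeff f A * mcoeff g B)"

instance
proof
  fix f g h :: mseries
  show "f + g + h = f + (g + h)" "f + g = g + f" "0 + f = f" "- f + f = 0" "f - g = f + - g"
    by (simp_all add: mseries_eq_iff plus_mseries_def zero_mseries_def uminus_mseries_def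
        minus_mseries_def)
  show "(0 :: mseries) \<noteq> 1"
    by (auto simp: mseries_eq_iff zero_mseries_def one_mseries_def)
  show "f * g = g * f"
    unfolding mseries_eq_iff times_mseries_def mcoeff_Mseries
    by (intro allI sum.reindex_bij_witness[of _ "\<lambda>(a, b). (b, a)" "\<lambda>(a, b). (b, a)"])
       (auto simp: msplits_def add.commute mult.commute)
  show "(f + g) * h = f * h + g * h"
    by (simp add: mseries_eq_iff times_mseries_def plus_mseries_def case_prod_unfold
        ring_distribs sum.distrib)
  show "1 * f = f"
    unfolding mseries_eq_iff
  proof
    fix M
    have "mcoeff (1 * f) M = (\<Sum>(A, B)\<in>{({#}, M)}. mcoeff 1 A * mcoeff f B)"
      unfolding times_mseries_def mcoeff_Mseries
    proof (rule sum.mono_neutral_right)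
      show "finite (msplits M)"
        by (rule finite_msplits)
      show "{({#}, M)} \<subseteq> msplits M"
        by (simp add: msplits_def)
      show "\<forall>p\<in>msplits M - {({#}, M)}. (case p of (A, B) \<Rightarrow> mcoeff 1 A * mcoeff f B) = 0"
        by (auto simp: msplits_def one_mseries_def split: if_splits)
    qed
    then show "mcoeff (1 * f) M = mcoeff f M"
      by (simp add: one_mseries_def)
  qed
  show "f * g * h = f * (g * h)"
    unfolding mseries_eq_iff
  proof
    fix M
    have "mcoeff (f * g * h) M =
        (\<Sum>p\<in>msplits M. \<Sum>q\<in>msplits (fst p). mcoeff f (fst q) * mcoeff g (snd q) * mcoeff h (snd p))"
      by (simp add: times_mseries_def case_prod_unfold sum_distrib_right)
    also have "\<dots> = (\<Sum>p\<in>msplits M. \<Sum>q\<in>msplits (snd p).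
        mcoeff f (fst p) * (mcoeff g (fst q) * mcoeff h (snd q)))"
      unfolding sum.Sigma[OF finite_msplits ballI[OF finite_msplits]]
      by (rule sum.reindex_bij_witness
          [of _ "\<lambda>(p, q). ((fst p + fst q, snd q), (fst p, fst q))"
                "\<lambda>(p, q). ((fst q, snd q + snd p), (snd q, snd p))"])
         (auto simp: msplits_def algebra_simps)
    also have "\<dots> = mcoeff (f * (g * h)) M"
      by (simp add: times_mseries_def case_prod_unfold sum_distrib_left)
    finally show "mcoeff (f * g * h) M = mcoeff (f * (g * h)) M" .
  qed
qed

end

definition mscale :: "complex \<Rightarrow> mseries \<Rightarrow> mseries" where
  "mscale c f = Mseries (\<lambda>M. c * mcoeff f M)"

definition degree_part :: "nat \<Rightarrow> mseries \<Rightarrow> mseries" where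
  "degree_part n f = Mseries (\<lambda>M. if size M = n then mcoeff f M else 0)"

text \<open>
  The sum of a locally finite family: each monomial has a nonzero coefficient in only
  finitely many of the \<open>F i\<close>.
\<close>

definition formal_sum :: "nat set \<Rightarrow> (nat \<Rightarrow> mseries) \<Rightarrow> mseries" where
  "formal_sum I F = Mseries (\<lambda>M. \<Sum>i | i \<in> I \<and> mcoeff (F i) M \<noteq> 0. mcoeff (F i) M)"


section \<open>Symmetric functions and plethysm\<close>

definition hsym :: "nat \<Rightarrow> mseries" where
  "hsym n = Mseries (\<lambda>M. if size M = n then 1 else 0)"

definition esym :: "nat \<Rightarrow> mseries" where
  "esym n = Mseries (\<lambda>M. if size M = n \<and> (\<forall>i. count M i \<le> 1) then 1 else 0)"

text \<open>Only used for \<open>n \<ge> 1\<close>.\<close>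

definition psym :: "nat \<Rightarrow> mseries" where
  "psym n = Mseries (\<lambda>M. if \<exists>i. M = replicate_mset n i then 1 else 0)"

text \<open>
  The plethysm \<open>p\<^sub>k[g] = g(x\<^sub>0\<^sup>k, x\<^sub>1\<^sup>k, \<dots>)\<close> for \<open>k \<ge> 1\<close>.  The sum has at most one term,
  since \<open>N\<close> is determined by \<open>M\<close>.
\<close>

definition psym_plethysm :: "nat \<Rightarrow> mseries \<Rightarrow> mseries" where
  "psym_plethysm k g = Mseries (\<lambda>M. \<Sum>N | repeat_mset k N = M. mcoeff g N)"

text \<open>
  For fixed \<open>g\<close>, the map \<open>f \<mapsto> f[g]\<close> is the algebra homomorphism on symmetric functions
  that sends \<open>p\<^sub>k\<close> to \<open>p\<^sub>k[g]\<close>.  Every symmetric function \<open>f\<close> (of bounded degree) is a linear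
  combination of the products \<open>\<Prod>k\<in>#\<mu>. p\<^sub>k\<close>, with \<open>\<mu>\<close> ranging over the finite multisets of
  positive integers, and the coefficients are unique because the power sums are
  algebraically independent.
\<close>

definition plethysm :: "mseries \<Rightarrow> mseries \<Rightarrow> mseries" where
  "plethysm f g = (THE r. \<exists>P a. finite P \<and> (\<forall>\<mu>\<in>P. 0 \<notin># \<mu>) \<and>
     f = (\<Sum>\<mu>\<in>P. mscale (a \<mu>) (\<Prod>k\<in>#\<mu>. psym k)) \<and>
     r = (\<Sum>\<mu>\<in>P. mscale (a \<mu>) (\<Prod>k\<in>#\<mu>. psym_plethysm k g)))"


section \<open>Traces and the Frobenius characteristic\<close>

text \<open>
  Representation spaces are realized as spaces of functions on a set of basis elements,
  with pointwise operations.
\<close>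

definition fscale :: "'k::field \<Rightarrow> ('a \<Rightarrow> 'k) \<Rightarrow> 'a \<Rightarrow> 'k" where
  "fscale c f = (\<lambda>x. c * f x)"

interpretation fun_vs: vector_space "fscale :: 'k::field \<Rightarrow> ('a \<Rightarrow> 'k) \<Rightarrow> 'a \<Rightarrow> 'k"
  by standard (simp_all add: fscale_def fun_eq_iff algebra_simps)

text \<open>
  The trace of the map induced by \<open>T\<close> on the quotient \<open>V / W\<close>, for finite-dimensional
  \<open>T\<close>-invariant spaces \<open>W \<subseteq> V\<close>.  If \<open>A\<close> is a basis of \<open>W\<close> and \<open>B \<supseteq> A\<close> a basis of \<open>V\<close>, then the
  classes of \<open>B - A\<close> form a basis of \<open>V / W\<close>, and the diagonal entries of the induced map in
  it are those of \<open>T\<close> at \<open>B - A\<close>.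
\<close>

definition quotient_trace ::
    "('a \<Rightarrow> 'k::field) set \<Rightarrow> ('a \<Rightarrow> 'k) set \<Rightarrow> (('a \<Rightarrow> 'k) \<Rightarrow> ('a \<Rightarrow> 'k)) \<Rightarrow> 'k" where
  "quotient_trace V W T = (THE t. \<exists>A B. A \<subseteq> B \<and> fun_vs.independent B \<and>
     fun_vs.span A = W \<and> fun_vs.span B = V \<and>
     t = (\<Sum>b\<in>B - A. fun_vs.representation B (T b) b))"

definition subspace_trace ::
    "('a \<Rightarrow> 'k::field) set \<Rightarrow> (('a \<Rightarrow> 'k) \<Rightarrow> ('a \<Rightarrow> 'k)) \<Rightarrow> 'k" where
  "subspace_trace V T = quotient_trace V {0} T"

text \<open>
  \<open>frobenius_char n \<chi> = 1/n! \<Sum>\<sigma>\<in>S\<^sub>n. \<chi>(\<sigma>) p\<^bsub>cyc(\<sigma>)\<^esub>\<close>; the cycles of \<open>\<sigma>\<close> are its orbits on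
  \<open>{1..n}\<close>, fixed points included.
\<close>

definition frobenius_char :: "nat \<Rightarrow> ((nat \<Rightarrow> nat) \<Rightarrow> complex) \<Rightarrow> mseries" where
  "frobenius_char n \<chi> = mscale (1 / fact n)
     (\<Sum>\<sigma> | \<sigma> permutes {1..n}. mscale (\<chi> \<sigma>) (\<Prod>C\<in>orbit \<sigma> ` {1..n}. psym (card C)))"


section \<open>The symmetric functions \<open>Lie\<^sub>n\<^sup>(\<^sup>2\<^sup>)\<close>\<close>

definition long_cycle :: "nat \<Rightarrow> nat \<Rightarrow> nat" where
  "long_cycle n = cycle_of_list [1..<Suc n]"

text \<open>
  The module induced to \<open>S\<^sub>n\<close> from the linear character \<open>c ^ j \<mapsto> z ^ j\<close> of the cyclic group
  generated by \<open>c\<close>, as the functions on \<open>S\<^sub>n\<close> (extended by 0) that satisfy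
  \<open>f(\<sigma> h) = \<omega>(h)\<inverse> f(\<sigma>)\<close> for \<open>h\<close> in the subgroup and \<open>\<omega>\<close> the character, with \<open>S\<^sub>n\<close> acting by
  left translation.
\<close>

definition induced_module ::
    "nat \<Rightarrow> (nat \<Rightarrow> nat) \<Rightarrow> complex \<Rightarrow> ((nat \<Rightarrow> nat) \<Rightarrow> complex) set" where
  "induced_module n c z = {f. (\<forall>\<sigma>. \<not> \<sigma> permutes {1..n} \<longrightarrow> f \<sigma> = 0) \<and>
     (\<forall>\<sigma> j. \<sigma> permutes {1..n} \<longrightarrow> f (\<sigma> \<circ> (c ^^ j)) = inverse (z ^ j) * f \<sigma>)}"

definition translate ::
    "(nat \<Rightarrow> nat) \<Rightarrow> ((nat \<Rightarrow> nat) \<Rightarrow> complex) \<Rightarrow> ((nat \<Rightarrow> nat) \<Rightarrow> complex)" where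
  "translate \<sigma> f = (\<lambda>\<tau>. f (inv \<sigma> \<circ> \<tau>))"

definition induced_char :: "nat \<Rightarrow> (nat \<Rightarrow> nat) \<Rightarrow> complex \<Rightarrow> (nat \<Rightarrow> nat) \<Rightarrow> complex" where
  "induced_char n c z \<sigma> = subspace_trace (induced_module n c z) (translate \<sigma>)"

definition Lie2 :: "nat \<Rightarrow> mseries" where
  "Lie2 n = frobenius_char n (induced_char n (long_cycle n)
     (exp (2 * complex_of_real pi * \<i> / of_nat n * 2 ^ multiplicity 2 n)))"

definition Lie2_ge2 :: mseries where
  "Lie2_ge2 = formal_sum {2..} Lie2"

definition Delta_part :: "nat \<Rightarrow> nat \<Rightarrow> mseries" where
  "Delta_part n k = degree_part n (plethysm (esym k) Lie2_ge2)"

definition Delta :: "nat \<Rightarrow> mseries" where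
  "Delta n = (if n = 0 then 1 else if n = 1 then 0 else formal_sum {1..} (Delta_part n))"


section \<open>The complex of injective words\<close>

definition injective_words :: "nat \<Rightarrow> nat list set" where
  "injective_words n = {w. distinct w \<and> set w \<subseteq> {1..n}}"

text \<open>
  Rational chains are indexed by word length \<open>m\<close>; words of length \<open>m\<close> are the cells of
  dimension \<open>m - 1\<close>.  The empty word in dimension \<open>-1\<close> gives the augmentation, so this is the
  complex that computes reduced homology.
\<close>

definition word_chains :: "nat \<Rightarrow> nat \<Rightarrow> (nat list \<Rightarrow> rat) set" where
  "word_chains n m = {f. \<forall>w. f w \<noteq> 0 \<longrightarrow> w \<in> injective_words n \<and> length w = m}"

text \<open>Positions in a list start at 0, so the sign \<open>(-1)\<^sup>i\<^sup>-\<^sup>1\<close> becomes \<open>(-1)\<^sup>i\<close>.\<close>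

definition word_boundary :: "nat list \<Rightarrow> nat list \<Rightarrow> rat" where
  "word_boundary w = (\<lambda>v. \<Sum>i<length w. if v = take i w @ drop (Suc i) w then (-1) ^ i else 0)"

definition chain_boundary :: "nat \<Rightarrow> (nat list \<Rightarrow> rat) \<Rightarrow> (nat list \<Rightarrow> rat)" where
  "chain_boundary n f = (\<Sum>w\<in>injective_words n. fscale (f w) (word_boundary w))"

definition word_cycles :: "nat \<Rightarrow> nat \<Rightarrow> (nat list \<Rightarrow> rat) set" where
  "word_cycles n m = {f \<in> word_chains n m. chain_boundary n f = 0}"

definition word_boundaries :: "nat \<Rightarrow> nat \<Rightarrow> (nat list \<Rightarrow> rat) set" where
  "word_boundaries n m = chain_boundary n ` word_chains n (Suc m)"

text \<open>A permutation sends the basis word \<open>w\<close> to \<open>map \<sigma> w\<close>.\<close>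

definition permute_chain :: "(nat \<Rightarrow> nat) \<Rightarrow> (nat list \<Rightarrow> rat) \<Rightarrow> (nat list \<Rightarrow> rat)" where
  "permute_chain \<sigma> f = (\<lambda>w. f (map (inv \<sigma>) w))"

text \<open>The character of \<open>S\<^sub>n\<close> on the reduced rational homology in dimension \<open>m - 1\<close>.\<close>

definition word_homology_char :: "nat \<Rightarrow> nat \<Rightarrow> (nat \<Rightarrow> nat) \<Rightarrow> complex" where
  "word_homology_char n m \<sigma> =
     of_rat (quotient_trace (word_cycles n m) (word_boundaries n m) (permute_chain \<sigma>))"

end

(*
  Lie_n^(2) = (1/n) sum_{d | n} psi(d) p_d^(n/d), where psi is determined by
  sum_{d | N} psi(d) = N if N is a power of 2, and 0 otherwise; in particular psi does not depend
  on n.  Hence sum_{i d = K} (-1)^(i-1) psi(d) = [K = 1], which makes the logarithmic derivative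
  of sum_k e_k[Lie_{>=2}^(2)], with respect to the degree, collapse to
  sum_{j>=1} (p_1^j + (-1)^j p_j).  By Newton's identity for h_k this is also the logarithmic
  derivative of (sum_m p_1^m) (sum_k (-1)^k h_k).

  The complex of injective words is exact below the top degree, so the Hopf trace formula expresses
  the homology character as the alternating sum of the numbers of fixed words of length k, and by
  Burnside's lemma the permutation representation on these words has characteristic
  p_1^k h_(n-k).
*)
theory Submission
  imports
    Defs
    "HOL-Computational_Algebra.Formal_Power_Series"
    "HOL-Number_Theory.Cong"
begin

section \<open>Traces on subspaces and quotients\<close>

text \<open>The exponent \<open>2^k_n\<close> makes the Sylow 2-subgroup of \<open>C_n\<close> the
  kernel of the inducing character. Summing the character over the subgroup of order
  \<open>N\<close> therefore gives \<open>w(N)\<close>, equal to \<open>N\<close> for powers of 2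
  and to 0 otherwise. This does not depend on \<open>n\<close>, and by inversion over divisors
  neither does \<open>psi\<close>. Writing \<open>(-1)^(i-1) = 1 - 2 [i even]\<close> turns the
  alternating sum over \<open>i d = K\<close> into \<open>w(K) - 2 w(K/2)\<close>, the second term
  being present only for even \<open>K\<close>; as \<open>w(2M) = 2 w(M)\<close>, only
  \<open>K = 1\<close> survives. With \<open>Lie_1 = p_1\<close> included the logarithmic derivative
  would be the sum of the \<open>p_1^j\<close>; leaving it out subtracts the logarithmic derivative
  of \<open>sum_k e_k\<close>, which is where the terms \<open>(-1)^j p_j\<close> come from. Two
  obstacles shape the rest. Traces and plethysm are definite descriptions, so they can be evaluated
  only after basis independence of traces and linear independence of the power sum products are
  known. The induced module has no convenient basis, so its trace is moved to the space of all
  functions on \<open>S_n\<close> by an averaging projection.\<close>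

locale trace_space = vector_space scale for scale :: "'a::field \<Rightarrow> 'b::ab_group_add \<Rightarrow> 'b"
begin

lemma representation_lincomb:
  assumes "independent B" "\<And>i. i \<in> I \<Longrightarrow> v i \<in> span B"
  shows "representation B (\<Sum>i\<in>I. scale (c i) (v i)) b = (\<Sum>i\<in>I. c i * representation B (v i) b)"
  using assms by (subst representation_sum) (auto simp: representation_scale span_scale intro!: sum.cong)

definition basis_trace :: "'b set \<Rightarrow> ('b \<Rightarrow> 'b) \<Rightarrow> 'a" where
  "basis_trace B T = (\<Sum>b\<in>B. representation B (T b) b)"

text \<open>\<open>expand\<close> writes the matrix of \<open>T\<close> in \<open>B\<close> as a
  product of a change of basis, the matrix in \<open>C\<close>, and the change back. Summing over
  the diagonal brings the two changes of basis together, and \<open>collapse\<close> cancels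
  them.\<close>

lemma basis_trace_unique:
  assumes B: "independent B" "finite B" and C: "independent C" "finite C"
    and span: "span B = span C"
    and T: "module_hom scale scale T" and inv: "\<And>v. v \<in> span B \<Longrightarrow> T v \<in> span B"
  shows "basis_trace B T = basis_trace C T"
proof -
  let ?B = "representation B" and ?C = "representation C"
  have BC: "b \<in> span C" if "b \<in> B" for b
    using that span span_base by blast
  have CB: "c \<in> span B" if "c \<in> C" for c
    using that span span_base by blast
  have expand: "?B (T b) b' = (\<Sum>c\<in>C. \<Sum>d\<in>C. ?C b c * ?C (T c) d * ?B d b')" if b: "b \<in> B" for b b'
  proof -
    have Tc: "T c = (\<Sum>d\<in>C. scale (?C (T c) d) d)" if "c \<in> C" for c
      using sum_representation_eq[OF C(1) _ C(2) order_refl, of "T c"] inv CB[OF that] span by simp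
    have "T b = T (\<Sum>c\<in>C. scale (?C b c) c)"
      using sum_representation_eq[OF C(1) BC[OF b] C(2) order_refl] by simp
    also have "\<dots> = (\<Sum>c\<in>C. scale (?C b c) (T c))"
      using T by (simp add: module_hom.sum module_hom.scale)
    also have "\<dots> = (\<Sum>c\<in>C. \<Sum>d\<in>C. scale (?C b c * ?C (T c) d) d)"
      by (rule sum.cong[OF refl], subst Tc) (auto simp: scale_sum_right)
    finally have "?B (T b) = ?B (\<Sum>c\<in>C. \<Sum>d\<in>C. scale (?C b c * ?C (T c) d) d)"
      by simp
    also have "\<dots> = (\<lambda>b'. \<Sum>c\<in>C. \<Sum>d\<in>C. ?C b c * ?C (T c) d * ?B d b')"
      using B(1) CB by (simp add: representation_sum representation_scale span_sum span_scale)
    finally show ?thesis by simp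
  qed
  have collapse: "(\<Sum>b\<in>B. ?B d b * ?C b c) = (if d = c then 1 else 0)" if "c \<in> C" "d \<in> C" for c d
  proof -
    have "d = (\<Sum>b\<in>B. scale (?B d b) b)"
      using sum_representation_eq[OF B(1) CB[OF \<open>d \<in> C\<close>] B(2) order_refl] by simp
    then have "?C d = ?C (\<Sum>b\<in>B. scale (?B d b) b)"
      by simp
    also have "\<dots> = (\<lambda>c. \<Sum>b\<in>B. ?B d b * ?C b c)"
      using C(1) BC by (simp add: representation_sum representation_scale span_scale)
    finally have "?C d c = (\<Sum>b\<in>B. ?B d b * ?C b c)"
      by (rule fun_cong)
    then show ?thesis
      using representation_basis[OF C(1) \<open>d \<in> C\<close>] by auto
  qed
  have "basis_trace B T = (\<Sum>b\<in>B. \<Sum>c\<in>C. \<Sum>d\<in>C. ?C b c * ?C (T c) d * ?B d b)"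
    unfolding basis_trace_def by (intro sum.cong refl expand)
  also have "\<dots> = (\<Sum>c\<in>C. \<Sum>b\<in>B. \<Sum>d\<in>C. ?C b c * ?C (T c) d * ?B d b)"
    by (rule sum.swap)
  also have "\<dots> = (\<Sum>c\<in>C. \<Sum>d\<in>C. \<Sum>b\<in>B. ?C b c * ?C (T c) d * ?B d b)"
    by (rule sum.cong[OF refl]) (rule sum.swap)
  also have "\<dots> = (\<Sum>c\<in>C. \<Sum>d\<in>C. ?C (T c) d * (\<Sum>b\<in>B. ?B d b * ?C b c))"
    by (simp add: sum_distrib_left mult_ac)
  also have "\<dots> = (\<Sum>c\<in>C. \<Sum>d\<in>C. if d = c then ?C (T c) d else 0)"
    by (intro sum.cong refl) (simp add: collapse)
  also have "\<dots> = basis_trace C T"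
    using C(2) by (simp add: basis_trace_def)
  finally show ?thesis .
qed

lemma finite_independent_in_span:
  assumes "finite S" "independent B" "B \<subseteq> span S"
  shows "finite B"
  using independent_span_bound assms by blast

text \<open>Since \<open>span A\<close> is invariant, the matrix in the basis \<open>B\<close> is
  block triangular, and its first block is the matrix in the basis \<open>A\<close>.\<close>

lemma basis_trace_split:
  assumes "A \<subseteq> B" "independent B" "finite B"
    and inv: "\<And>v. v \<in> span A \<Longrightarrow> T v \<in> span A"
  shows "basis_trace B T = basis_trace A T + (\<Sum>b\<in>B - A. representation B (T b) b)"
proof -
  have "representation B (T a) a = representation A (T a) a" if "a \<in> A" for a
    using representation_extend[OF assms(2) _ assms(1), of "T a"] inv[OF span_base[OF that]] by simp
  then show ?thesis
    using sum.subset_diff[OF assms(1) assms(3), of "\<lambda>b. representation B (T b) b"]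
    by (simp add: basis_trace_def add.commute)
qed

text \<open>Attaching the trace to the space rather than to a basis lets the quotient and
  rank-nullity formulas be plain sums and differences. The chosen basis is immaterial by
  \<open>space_trace_eq\<close>.\<close>

definition space_trace :: "'b set \<Rightarrow> ('b \<Rightarrow> 'b) \<Rightarrow> 'a" where
  "space_trace V T = basis_trace (SOME B. independent B \<and> span B = V) T"

lemma space_trace_eq:
  assumes "independent B" "finite B" "span B = V" "module_hom scale scale T"
    and "\<And>v. v \<in> V \<Longrightarrow> T v \<in> V"
  shows "space_trace V T = basis_trace B T"
proof -
  define C where "C = (SOME B. independent B \<and> span B = V)"
  have C: "independent C \<and> span C = V"
    unfolding C_def by (rule someI[of _ B]) (use assms in auto)
  then have "C \<subseteq> span B"
    using span_superset assms(3) by blast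
  then have "finite C"
    using finite_independent_in_span[OF assms(2)] C by blast
  then show ?thesis
    unfolding space_trace_def C_def[symmetric]
    by (intro basis_trace_unique) (use assms C in auto)
qed

lemma extend_basis_in:
  assumes "subspace V" "V \<subseteq> span S" "finite S" "A \<subseteq> V" "independent A"
  obtains B where "A \<subseteq> B" "independent B" "finite B" "span B = V"
proof -
  obtain B where B: "A \<subseteq> B" "B \<subseteq> V" "independent B" "V \<subseteq> span B"
    using maximal_independent_subset_extend[OF assms(4,5)] by metis
  moreover have "span B = V"
    using B span_minimal[OF B(2) assms(1)] by auto
  moreover have "finite B"
    using finite_independent_in_span[OF assms(3) B(3)] B(2) assms(2) by auto
  ultimately show ?thesis using that by blast
qed

lemma quotient_basis_trace:
  assumes "A \<subseteq> B" "independent B" "finite B"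
    and T: "module_hom scale scale T"
    and "\<And>v. v \<in> span A \<Longrightarrow> T v \<in> span A" "\<And>v. v \<in> span B \<Longrightarrow> T v \<in> span B"
  shows "(\<Sum>b\<in>B - A. representation B (T b) b) = space_trace (span B) T - space_trace (span A) T"
proof -
  have "independent A" "finite A"
    using assms(1-3) independent_mono finite_subset by auto
  then show ?thesis
    using basis_trace_split[OF assms(1-3,5)] space_trace_eq[of B] space_trace_eq[of A] assms by simp
qed

text \<open>In a basis of \<open>U\<close> that extends a basis of \<open>V\<close>, the map
  \<open>T o P\<close> has image in \<open>V\<close>, so the new diagonal entries vanish, while on
  \<open>V\<close> it agrees with \<open>T\<close>. This serves spaces \<open>V\<close> without a
  convenient basis.\<close>

lemma space_trace_projection:
  assumes "subspace V" "subspace U" "V \<subseteq> U" "U \<subseteq> span S" "finite S"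
    and T: "module_hom scale scale T" and P: "module_hom scale scale P"
    and TV: "\<And>v. v \<in> V \<Longrightarrow> T v \<in> V" and PU: "\<And>v. v \<in> U \<Longrightarrow> P v \<in> V"
    and PV: "\<And>v. v \<in> V \<Longrightarrow> P v = v"
  shows "space_trace V T = space_trace U (\<lambda>v. T (P v))"
proof -
  obtain A where A: "{} \<subseteq> A" "independent A" "finite A" "span A = V"
    by (rule extend_basis_in[of V S "{}"]) (use assms in \<open>auto simp: independent_empty\<close>)
  have "A \<subseteq> U"
    using A(4) span_superset[of A] \<open>V \<subseteq> U\<close> by blast
  then obtain B where B: "A \<subseteq> B" "independent B" "finite B" "span B = U"
    by (rule extend_basis_in[OF assms(2,4,5) _ A(2)])
  have TP: "module_hom scale scale (\<lambda>v. T (P v))"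
    using module_hom_compose[OF P T] by (simp add: o_def)
  have zero: "representation B (T (P b)) b = 0" if "b \<in> B - A" for b
  proof -
    have "T (P b) \<in> span A"
      using that B A PU TV span_base by blast
    then have "representation B (T (P b)) b = representation A (T (P b)) b"
      using representation_extend[OF B(2) _ B(1)] by simp
    then show ?thesis
      using representation_ne_zero[of A "T (P b)" b] that by auto
  qed
  have "space_trace U (\<lambda>v. T (P v)) = basis_trace B (\<lambda>v. T (P v))"
    by (rule space_trace_eq) (use B TP PU TV \<open>V \<subseteq> U\<close> in auto)
  also have "\<dots> = basis_trace A (\<lambda>v. T (P v))"
    by (subst basis_trace_split[OF B(1-3)]) (use A PV TV zero in auto)
  also have "\<dots> = basis_trace A T"
    unfolding basis_trace_def by (rule sum.cong) (use A PV span_base in auto)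
  also have "\<dots> = space_trace V T"
    by (rule space_trace_eq[symmetric]) (use A T TV in auto)
  finally show ?thesis by simp
qed

text \<open>Extend a basis \<open>A\<close> of the kernel to a basis \<open>B\<close> of
  \<open>V\<close>. Then \<open>d\<close> maps \<open>B - A\<close> bijectively onto a basis of the
  image and, because it commutes with \<open>T\<close>, preserves the diagonal entries.\<close>

lemma space_trace_rank_nullity:
  assumes V: "subspace V" "V \<subseteq> span S" "finite S"
    and T: "module_hom scale scale T" and d: "module_hom scale scale d"
    and TV: "\<And>v. v \<in> V \<Longrightarrow> T v \<in> V" and comm: "\<And>v. v \<in> V \<Longrightarrow> d (T v) = T (d v)"
  shows "space_trace V T = space_trace {v \<in> V. d v = 0} T + space_trace (d ` V) T"
proof -
  interpret d: module_hom scale scale d by (rule d)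
  interpret T: module_hom scale scale T by (rule T)
  let ?K = "{v \<in> V. d v = 0}"
  have K: "subspace ?K"
    using V(1) by (auto simp: subspace_def d.add d.scale)
  obtain A where A: "{} \<subseteq> A" "independent A" "finite A" "span A = ?K"
    by (rule extend_basis_in[OF K, of S "{}"]) (use V in \<open>auto simp: independent_empty\<close>)
  have "A \<subseteq> V"
    using A(4) span_superset[of A] by blast
  then obtain B where B: "A \<subseteq> B" "independent B" "finite B" "span B = V"
    by (rule extend_basis_in[OF V _ A(2)])
  have TK: "T v \<in> ?K" if "v \<in> ?K" for v
    using that TV comm by auto
  have kernel: "x \<in> span A" if "x \<in> span (B - A)" "d x = 0" for x
    using that A(4) B(4) span_mono[of "B - A" B] by auto
  have indep_meet: "x = 0" if x: "x \<in> span (B - A)" "d x = 0" for x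
  proof -
    have ind: "independent (B - A)"
      using independent_mono[OF B(2)] by auto
    \<comment> \<open>By \<open>kernel\<close>, \<open>x\<close> lies in \<open>span A\<close> as
      well as in \<open>span (B - A)\<close>, so its coordinates in \<open>B\<close> are supported
      on two disjoint sets.\<close>
    have "representation B x = representation A x"
      using representation_extend[OF B(2) kernel[OF x] B(1)] .
    moreover have "representation B x = representation (B - A) x"
      using representation_extend[OF B(2) x(1)] by auto
    ultimately have "representation (B - A) x b = 0" for b
      by (metis DiffD2 representation_ne_zero)
    then show ?thesis
      using sum_representation_eq[OF ind x(1) _ order_refl] B(3) by simp
  qed
  have inj: "inj_on d (span (B - A))"
    using indep_meet d.inj_on_iff_eq_0[OF subspace_span] by auto
  then have inj': "inj_on d (B - A)"
    using inj_on_subset span_superset by blast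
  have fin: "finite (B - A)"
    using B(3) by simp
  have ind: "independent (d ` (B - A))"
  proof (rule independent_if_scalars_zero)
    show "finite (d ` (B - A))"
      using fin by simp
    fix u x
    assume z: "(\<Sum>x\<in>d ` (B - A). scale (u x) x) = 0" and x: "x \<in> d ` (B - A)"
    have "d (\<Sum>b\<in>B - A. scale (u (d b)) b) = (\<Sum>b\<in>B - A. scale (u (d b)) (d b))"
      by (simp only: d.sum d.scale)
    also have "\<dots> = 0"
      using z unfolding sum.reindex[OF inj'] o_def .
    finally have "(\<Sum>b\<in>B - A. scale (u (d b)) b) = 0"
      by (rule indep_meet[rotated]) (intro span_sum span_scale span_base)
    moreover have "independent (B - A)"
      using independent_mono[OF B(2)] by auto
    ultimately have "\<forall>b\<in>B - A. u (d b) = 0"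
      using independentD[OF _ fin order_refl, of "\<lambda>b. u (d b)"] by blast
    then show "u x = 0"
      using x by auto
  qed
  have span_d: "span (d ` (B - A)) = d ` V"
  proof -
    have "d ` V = span (d ` B)"
      using B(4) d.span_image by auto
    also have "\<dots> = span (d ` (B - A))"
    proof
      show "span (d ` B) \<subseteq> span (d ` (B - A))"
      proof (rule span_minimal)
        show "d ` B \<subseteq> span (d ` (B - A))"
        proof
          fix x assume "x \<in> d ` B"
          then obtain b where b: "b \<in> B" "x = d b" by auto
          show "x \<in> span (d ` (B - A))"
          proof (cases "b \<in> A")
            case True
            then have "b \<in> ?K" using A(4) span_base by blast
            then show ?thesis using b by (simp add: span_zero)
          next
            case False
            then show ?thesis using b by (auto intro: span_base)
          qed
        qed
      qed simp
    qed (intro span_mono image_mono Diff_subset)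
    finally show ?thesis by simp
  qed
  have diag: "representation B (T b) b = representation (d ` (B - A)) (T (d b)) (d b)"
    if b: "b \<in> B - A" for b
  proof -
    have bV: "b \<in> V" using b B(4) span_base by blast
    have "T b = (\<Sum>c\<in>B. scale (representation B (T b) c) c)"
      using sum_representation_eq[OF B(2) _ B(3) order_refl] TV[OF bV] B(4) by simp
    then have "d (T b) = d (\<Sum>c\<in>B. scale (representation B (T b) c) c)"
      by simp
    also have "\<dots> = (\<Sum>c\<in>B. scale (representation B (T b) c) (d c))"
      by (simp add: d.sum d.scale)
    \<comment> \<open>The vectors of \<open>A\<close> span the kernel of \<open>d\<close>, so their
      terms drop out and an expansion in the basis of the image remains.\<close>
    also have "\<dots> = (\<Sum>c\<in>B - A. scale (representation B (T b) c) (d c))"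
      using A(4) B(3) by (intro sum.mono_neutral_right) (auto dest: span_base)
    finally have "T (d b) = (\<Sum>c\<in>B - A. scale (representation B (T b) c) (d c))"
      using comm[OF bV] by simp
    then have "representation (d ` (B - A)) (T (d b)) (d b)
        = (\<Sum>c\<in>B - A. representation B (T b) c * representation (d ` (B - A)) (d c) (d b))"
      using representation_lincomb[OF ind, of "B - A" d] span_base by auto
    also have "\<dots> = (\<Sum>c\<in>B - A. representation B (T b) c * (if d b = d c then 1 else 0))"
      using ind by (intro sum.cong) (auto simp: representation_basis)
    also have "\<dots> = (\<Sum>c\<in>B - A. if b = c then representation B (T b) c else 0)"
      using b inj' by (intro sum.cong) (auto dest: inj_onD)
    also have "\<dots> = representation B (T b) b"
      using b B(3) by (simp add: sum.delta)
    finally show ?thesis by simp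
  qed
  have "space_trace V T = basis_trace B T"
    by (rule space_trace_eq) (use B TV T in auto)
  also have "\<dots> = basis_trace A T + (\<Sum>b\<in>B - A. representation B (T b) b)"
    by (rule basis_trace_split[OF B(1-3)]) (use A(4) TK in auto)
  also have "(\<Sum>b\<in>B - A. representation B (T b) b) = basis_trace (d ` (B - A)) T"
    unfolding basis_trace_def sum.reindex[OF inj'] o_def by (rule sum.cong[OF refl diag])
  also have "\<dots> = space_trace (d ` V) T"
    by (rule space_trace_eq[symmetric]) (use ind B(3) span_d T TV comm in \<open>auto simp flip: comm\<close>)
  also have "basis_trace A T = space_trace ?K T"
    by (rule space_trace_eq[symmetric]) (use A T TK in auto)
  finally show ?thesis .
qed

end

interpretation fun_tr: trace_space "fscale :: 'k::field \<Rightarrow> ('a \<Rightarrow> 'k) \<Rightarrow> 'a \<Rightarrow> 'k" ..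

text \<open>Resolves the definite description: every admissible pair of bases gives the same number,
  by block triangularity. That an arbitrary witness \<open>B\<close> is finite follows because
  \<open>V\<close> lies in the span of a finite set.\<close>

lemma quotient_trace_eq:
  fixes V W :: "('a \<Rightarrow> 'k::field) set"
  assumes "fun_vs.subspace V" "fun_vs.subspace W" "W \<subseteq> V" "V \<subseteq> fun_vs.span S" "finite S"
    and T: "module_hom fscale fscale T"
    and TV: "\<And>v. v \<in> V \<Longrightarrow> T v \<in> V" and TW: "\<And>v. v \<in> W \<Longrightarrow> T v \<in> W"
  shows "quotient_trace V W T = fun_tr.space_trace V T - fun_tr.space_trace W T"
  unfolding quotient_trace_def
proof (rule the_equality)
  obtain A where A: "{} \<subseteq> A" "fun_vs.independent A" "finite A" "fun_vs.span A = W"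
    by (rule fun_tr.extend_basis_in[of W S "{}"]) (use assms in \<open>auto simp: fun_vs.independent_empty\<close>)
  have "A \<subseteq> V"
    using A(4) fun_vs.span_superset[of A] \<open>W \<subseteq> V\<close> by blast
  then obtain B where B: "A \<subseteq> B" "fun_vs.independent B" "finite B" "fun_vs.span B = V"
    by (rule fun_tr.extend_basis_in[OF assms(1,4,5) _ A(2)])
  have "(\<Sum>b\<in>B - A. fun_vs.representation B (T b) b) = fun_tr.space_trace V T - fun_tr.space_trace W T"
    using fun_tr.quotient_basis_trace[OF B(1-3) T] A(4) B(4) TV TW by simp
  then show "\<exists>A B. A \<subseteq> B \<and> fun_vs.independent B \<and> fun_vs.span A = W \<and> fun_vs.span B = V \<and>
     fun_tr.space_trace V T - fun_tr.space_trace W T = (\<Sum>b\<in>B - A. fun_vs.representation B (T b) b)"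
    using A(4) B by (intro exI[of _ A] exI[of _ B] conjI) simp_all
next
  fix t
  assume "\<exists>A B. A \<subseteq> B \<and> fun_vs.independent B \<and> fun_vs.span A = W \<and> fun_vs.span B = V \<and>
     t = (\<Sum>b\<in>B - A. fun_vs.representation B (T b) b)"
  then obtain A B where B: "A \<subseteq> B" "fun_vs.independent B" "fun_vs.span A = W" "fun_vs.span B = V"
    "t = (\<Sum>b\<in>B - A. fun_vs.representation B (T b) b)" by blast
  have "B \<subseteq> fun_vs.span S"
    using B(4) assms(4) fun_vs.span_superset by blast
  then have "finite B"
    using fun_tr.finite_independent_in_span[OF assms(5) B(2)] by blast
  then show "t = fun_tr.space_trace V T - fun_tr.space_trace W T"
    using fun_tr.quotient_basis_trace[OF B(1,2) _ T] B TV TW by auto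
qed

section \<open>Functions supported on a finite set and their basis of unit functions\<close>

definition supported_on :: "'a set \<Rightarrow> ('a \<Rightarrow> 'k::field) set" where
  "supported_on X = {f. \<forall>x. f x \<noteq> 0 \<longrightarrow> x \<in> X}"

definition unit_fun :: "'a \<Rightarrow> 'a \<Rightarrow> 'k::field" where
  "unit_fun x = (\<lambda>y. if y = x then 1 else 0)"

lemma inj_unit_fun: "inj (unit_fun :: 'a \<Rightarrow> 'a \<Rightarrow> 'k::field)"
  by (rule injI) (metis unit_fun_def zero_neq_one)

lemma sum_fun_apply: "(\<Sum>x\<in>X. F x) y = (\<Sum>x\<in>X. F x y)"
  by (induction X rule: infinite_finite_induct) simp_all

lemma unit_fun_expand:
  assumes "finite X" "f \<in> supported_on X"
  shows "(\<Sum>x\<in>X. fscale (f x) (unit_fun x)) = f"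
proof
  fix y
  have "(\<Sum>x\<in>X. fscale (f x) (unit_fun x)) y = (\<Sum>x\<in>X. f x * (if y = x then 1 else 0))"
    by (simp add: fscale_def unit_fun_def sum_fun_apply)
  also have "\<dots> = (\<Sum>x\<in>X. if y = x then f x else 0)"
    by (intro sum.cong) auto
  also have "\<dots> = f y"
    using assms by (auto simp: supported_on_def)
  finally show "(\<Sum>x\<in>X. fscale (f x) (unit_fun x)) y = f y" .
qed

lemma supported_on_iff: "f \<in> supported_on X \<longleftrightarrow> (\<forall>x. x \<notin> X \<longrightarrow> f x = 0)"
  by (auto simp: supported_on_def)

lemma subspace_supported_on: "fun_vs.subspace (supported_on X)"
  by (auto simp: fun_vs.subspace_def supported_on_iff fscale_def)

lemma span_unit_fun:
  assumes "finite X"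
  shows "fun_vs.span (unit_fun ` X) = (supported_on X :: ('a \<Rightarrow> 'k::field) set)"
proof
  show "fun_vs.span (unit_fun ` X) \<subseteq> (supported_on X :: ('a \<Rightarrow> 'k) set)"
    by (rule fun_vs.span_minimal[OF _ subspace_supported_on])
       (auto simp: supported_on_def unit_fun_def split: if_splits)
  show "(supported_on X :: ('a \<Rightarrow> 'k) set) \<subseteq> fun_vs.span (unit_fun ` X)"
  proof
    fix f :: "'a \<Rightarrow> 'k" assume f: "f \<in> supported_on X"
    have "(\<Sum>x\<in>X. fscale (f x) (unit_fun x)) \<in> fun_vs.span (unit_fun ` X)"
      by (intro fun_vs.span_sum fun_vs.span_scale fun_vs.span_base imageI)
    then show "f \<in> fun_vs.span (unit_fun ` X)"
      by (simp only: unit_fun_expand[OF assms f])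
  qed
qed

lemma independent_unit_fun:
  assumes "finite X"
  shows "fun_vs.independent (unit_fun ` X :: ('a \<Rightarrow> 'k::field) set)"
proof (rule fun_vs.independent_if_scalars_zero)
  show "finite (unit_fun ` X)" using assms by simp
  fix u :: "('a \<Rightarrow> 'k) \<Rightarrow> 'k" and e :: "'a \<Rightarrow> 'k"
  assume z: "(\<Sum>x\<in>unit_fun ` X. fscale (u x) x) = 0" and "e \<in> unit_fun ` X"
  then obtain y where y: "y \<in> X" "e = unit_fun y" by auto
  have "(\<Sum>x\<in>unit_fun ` X. fscale (u x) x) = (\<Sum>x\<in>X. fscale (u (unit_fun x)) (unit_fun x))"
    by (rule sum.reindex_cong[OF inj_on_subset[OF inj_unit_fun]]) auto
  then have "0 = (\<Sum>x\<in>X. fscale (u (unit_fun x)) (unit_fun x)) y"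
    using z by simp
  also have "\<dots> = (\<Sum>x\<in>X. if y = x then u (unit_fun x) else 0)"
    unfolding sum_fun_apply by (intro sum.cong) (auto simp: fscale_def unit_fun_def)
  also have "\<dots> = u e"
    using assms y by simp
  finally show "u e = 0" ..
qed

text \<open>The coordinate of \<open>f\<close> at the basis vector \<open>unit_fun x\<close> is the
  value \<open>f x\<close>, so the summands are the diagonal entries.\<close>

lemma space_trace_supported_on:
  fixes T :: "('a \<Rightarrow> 'k::field) \<Rightarrow> 'a \<Rightarrow> 'k"
  assumes X: "finite X" and T: "module_hom fscale fscale T"
    and inv: "\<And>f. f \<in> supported_on X \<Longrightarrow> T f \<in> supported_on X"
  shows "fun_tr.space_trace (supported_on X) T = (\<Sum>x\<in>X. T (unit_fun x) x)"
proof -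
  have rep: "fun_vs.representation (unit_fun ` X) f (unit_fun x) = f x"
    if f: "f \<in> supported_on X" and "x \<in> X" for f :: "'a \<Rightarrow> 'k" and x
  proof -
    have "unit_fun y \<in> fun_vs.span (unit_fun ` X)" if "y \<in> X" for y
      using that by (intro fun_vs.span_base) simp
    from fun_tr.representation_lincomb[OF independent_unit_fun[OF X], of X unit_fun f "unit_fun x", OF this]
    have "fun_vs.representation (unit_fun ` X) f (unit_fun x)
       = (\<Sum>y\<in>X. f y * fun_vs.representation (unit_fun ` X) (unit_fun y) (unit_fun x))"
      by (simp only: unit_fun_expand[OF X f])
    also have "\<dots> = (\<Sum>y\<in>X. if x = y then f y else 0)"
      using independent_unit_fun[OF X]
      by (intro sum.cong refl, subst fun_vs.representation_basis)
         (auto dest: injD[OF inj_unit_fun])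
    also have "\<dots> = f x"
      using X that(2) by simp
    finally show ?thesis .
  qed
  have unit: "unit_fun x \<in> supported_on X" if "x \<in> X" for x
    using that by (auto simp: supported_on_def unit_fun_def)
  have "fun_tr.space_trace (supported_on X) T = fun_tr.basis_trace (unit_fun ` X) T"
    by (rule fun_tr.space_trace_eq) (use X T inv independent_unit_fun span_unit_fun in auto)
  also have "\<dots> = (\<Sum>x\<in>X. fun_vs.representation (unit_fun ` X) (T (unit_fun x)) (unit_fun x))"
    unfolding fun_tr.basis_trace_def
    by (rule sum.reindex_cong[OF inj_on_subset[OF inj_unit_fun]]) auto
  also have "\<dots> = (\<Sum>x\<in>X. T (unit_fun x) x)"
    using rep unit inv by (intro sum.cong) auto
  finally show ?thesis .
qed

lemma space_trace_zero:
  assumes "module_hom fscale fscale T"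
  shows "fun_tr.space_trace {0} T = 0"
  using fun_tr.space_trace_eq[of "{}" "{0}" T] assms
  by (simp add: fun_vs.independent_empty fun_tr.basis_trace_def module_hom.zero)


section \<open>The ring of series\<close>

lemma mcoeff_0 [simp]: "mcoeff 0 M = 0"
  and mcoeff_1: "mcoeff 1 M = (if M = {#} then 1 else 0)"
  and mcoeff_add [simp]: "mcoeff (f + g) M = mcoeff f M + mcoeff g M"
  and mcoeff_diff [simp]: "mcoeff (f - g) M = mcoeff f M - mcoeff g M"
  and mcoeff_uminus [simp]: "mcoeff (- f) M = - mcoeff f M"
  and mcoeff_mscale [simp]: "mcoeff (mscale c f) M = c * mcoeff f M"
  and mcoeff_degree_part: "mcoeff (degree_part n f) M = (if size M = n then mcoeff f M else 0)"
  and mcoeff_times: "mcoeff (f * g) M = (\<Sum>(A, B)\<in>msplits M. mcoeff f A * mcoeff g B)"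
  and mcoeff_hsym: "mcoeff (hsym n) M = (if size M = n then 1 else 0)"
  and mcoeff_esym: "mcoeff (esym n) M = (if size M = n \<and> (\<forall>i. count M i \<le> 1) then 1 else 0)"
  and mcoeff_psym: "mcoeff (psym n) M = (if \<exists>i. M = replicate_mset n i then 1 else 0)"
  by (simp_all add: zero_mseries_def one_mseries_def plus_mseries_def minus_mseries_def
      uminus_mseries_def mscale_def degree_part_def times_mseries_def hsym_def esym_def psym_def)

lemma mseries_eqI: "(\<And>M. mcoeff f M = mcoeff g M) \<Longrightarrow> f = g"
  by (simp add: mseries_eq_iff)

lemma mcoeff_sum [simp]: "mcoeff (\<Sum>x\<in>X. F x) M = (\<Sum>x\<in>X. mcoeff (F x) M)"
  by (induction X rule: infinite_finite_induct) auto

lemma mscale_add_right: "mscale c (f + g) = mscale c f + mscale c g"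
  and mscale_add_left: "mscale (c + d) f = mscale c f + mscale d f"
  and mscale_diff_right: "mscale c (f - g) = mscale c f - mscale c g"
  and mscale_mscale [simp]: "mscale c (mscale d f) = mscale (c * d) f"
  and mscale_1 [simp]: "mscale 1 f = f"
  and mscale_0 [simp]: "mscale 0 f = 0"
  and mscale_0_right [simp]: "mscale c 0 = 0"
  and mscale_minus_left: "mscale (- c) f = - mscale c f"
  by (auto intro!: mseries_eqI simp: algebra_simps)

lemma mscale_sum_right: "mscale c (\<Sum>x\<in>X. F x) = (\<Sum>x\<in>X. mscale c (F x))"
  by (rule mseries_eqI) (simp add: sum_distrib_left)

lemma mscale_sum_left: "mscale (\<Sum>x\<in>X. c x) f = (\<Sum>x\<in>X. mscale (c x) f)"
  by (rule mseries_eqI) (simp add: sum_distrib_right)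

lemma mult_mscale_left [simp]: "mscale c f * g = mscale c (f * g)"
  by (rule mseries_eqI) (simp add: mcoeff_times sum_distrib_left case_prod_unfold mult.assoc)

lemma mult_mscale_right [simp]: "f * mscale c g = mscale c (f * g)"
  by (metis mult_mscale_left mult.commute)

lemma of_nat_mult_mseries: "of_nat n * f = mscale (of_nat n) f"
  by (induction n) (simp_all add: ring_distribs mscale_add_left)

lemma minus_one_power_mult_mseries: "(-1) ^ n * f = mscale ((-1) ^ n) f"
  by (induction n) (simp_all add: mscale_minus_left)

lemma mscale_cancel: "c \<noteq> 0 \<Longrightarrow> mscale c f = mscale c g \<Longrightarrow> f = g"
  by (simp add: mseries_eq_iff)

lemma degree_part_mscale: "degree_part n (mscale c f) = mscale c (degree_part n f)"
  by (rule mseries_eqI) (simp add: mcoeff_degree_part)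

lemma degree_part_sum: "degree_part n (\<Sum>x\<in>X. F x) = (\<Sum>x\<in>X. degree_part n (F x))"
  by (rule mseries_eqI) (simp add: mcoeff_degree_part)

lemma degree_part_mult:
  "degree_part n (f * g) = (\<Sum>j=0..n. degree_part j f * degree_part (n - j) g)"
proof (rule mseries_eqI)
  fix M
  have "mcoeff (\<Sum>j=0..n. degree_part j f * degree_part (n - j) g) M
      = (\<Sum>(A, B)\<in>msplits M. \<Sum>j=0..n. mcoeff (degree_part j f) A * mcoeff (degree_part (n - j) g) B)"
    by (simp add: mcoeff_times case_prod_unfold) (rule sum.swap)
  also have "\<dots> = (\<Sum>(A, B)\<in>msplits M. if size M = n then mcoeff f A * mcoeff g B else 0)"
  proof (intro sum.cong refl, clarsimp simp only: split_beta fst_conv snd_conv)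
    fix A B :: "nat multiset" assume "(A, B) \<in> msplits M"
    then have M: "size M = size A + size B"
      by (auto simp: msplits_def)
    have "(\<Sum>j=0..n. mcoeff (degree_part j f) A * mcoeff (degree_part (n - j) g) B)
        = (\<Sum>j=0..n. if j = size A then mcoeff f A * mcoeff (degree_part (n - j) g) B else 0)"
      by (intro sum.cong) (auto simp: mcoeff_degree_part)
    also have "\<dots> = (if size M = n then mcoeff f A * mcoeff g B else 0)"
      by (auto simp: mcoeff_degree_part M)
    finally show "(\<Sum>j=0..n. mcoeff (degree_part j f) A * mcoeff (degree_part (n - j) g) B)
        = (if size M = n then mcoeff f A * mcoeff g B else 0)" .
  qed
  also have "\<dots> = mcoeff (degree_part n (f * g)) M"
    by (simp add: mcoeff_degree_part mcoeff_times)
  finally show "mcoeff (degree_part n (f * g)) M =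
      mcoeff (\<Sum>j=0..n. degree_part j f * degree_part (n - j) g) M" ..
qed

text \<open>The Euler operator \<open>sum_i x_i d/dx_i\<close>. It is a derivation
  (\<open>euler_mult\<close>) and serves as the derivative with respect to the degree.\<close>

definition euler :: "mseries \<Rightarrow> mseries" where
  "euler f = Mseries (\<lambda>M. of_nat (size M) * mcoeff f M)"

lemma mcoeff_euler: "mcoeff (euler f) M = of_nat (size M) * mcoeff f M"
  by (simp add: euler_def)

lemma euler_mscale: "euler (mscale c f) = mscale c (euler f)"
  by (rule mseries_eqI) (simp add: mcoeff_euler)

lemma euler_sum: "euler (\<Sum>x\<in>X. F x) = (\<Sum>x\<in>X. euler (F x))"
  by (rule mseries_eqI) (simp add: mcoeff_euler sum_distrib_left)

lemma euler_mult: "euler (f * g) = euler f * g + f * euler g"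
proof (rule mseries_eqI)
  fix M
  have "mcoeff (euler (f * g)) M = (\<Sum>(A, B)\<in>msplits M. of_nat (size M) * (mcoeff f A * mcoeff g B))"
    by (simp add: mcoeff_euler mcoeff_times sum_distrib_left case_prod_unfold)
  also have "\<dots> = (\<Sum>(A, B)\<in>msplits M. of_nat (size A) * mcoeff f A * mcoeff g B
      + mcoeff f A * (of_nat (size B) * mcoeff g B))"
    by (rule sum.cong) (auto simp: msplits_def algebra_simps)
  also have "\<dots> = mcoeff (euler f * g + f * euler g) M"
    by (simp add: mcoeff_euler mcoeff_times sum.distrib case_prod_unfold)
  finally show "mcoeff (euler (f * g)) M = mcoeff (euler f * g + f * euler g) M" .
qed

lemma degree_part_euler: "degree_part n (euler f) = mscale (of_nat n) (degree_part n f)"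
  by (rule mseries_eqI) (simp add: mcoeff_degree_part mcoeff_euler)

text \<open>A lower bound for the order of a series. It makes the infinite sum of the
  \<open>e_k[g]\<close> finite in every degree.\<close>

definition vanishes_below :: "nat \<Rightarrow> mseries \<Rightarrow> bool" where
  "vanishes_below k f \<longleftrightarrow> (\<forall>M. size M < k \<longrightarrow> mcoeff f M = 0)"

lemma vanishes_below_mult:
  assumes "vanishes_below a f" "vanishes_below b g"
  shows "vanishes_below (a + b) (f * g)"
  unfolding vanishes_below_def mcoeff_times
proof (intro allI impI sum.neutral ballI, clarify)
  fix M A B :: "nat multiset" assume "size M < a + b" "(A, B) \<in> msplits M"
  then have "size A < a \<or> size B < b"
    by (auto simp: msplits_def)
  then show "mcoeff f A * mcoeff g B = 0"
    using assms by (auto simp: vanishes_below_def)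
qed

lemma degree_part_vanishes: "vanishes_below k f \<Longrightarrow> n < k \<Longrightarrow> degree_part n f = 0"
  by (rule mseries_eqI) (simp add: mcoeff_degree_part vanishes_below_def)


section \<open>Power sums and Newton's identities\<close>

text \<open>A splitting of \<open>M\<close> whose first part is a monomial of \<open>p_k\<close>
  amounts to the choice of a variable \<open>i\<close>, and \<open>k > 0\<close> makes distinct
  variables give distinct splittings. Most coefficient computations with power sums go through this
  formula.\<close>

lemma mcoeff_psym_mult:
  assumes "k > 0"
  shows "mcoeff (psym k * f) M =
    (\<Sum>i\<in>set_mset M. if k \<le> count M i then mcoeff f (M - replicate_mset k i) else 0)"
proof -
  let ?I = "{i \<in> set_mset M. k \<le> count M i}"
  let ?h = "\<lambda>i. (replicate_mset k i, M - replicate_mset k i)"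
  have sub: "replicate_mset k i \<subseteq># M" if "k \<le> count M i" for i
    using that by (simp add: subseteq_mset_def)
  have inj: "inj_on ?h ?I"
    using assms by (auto simp: inj_on_def multiset_eq_iff split: if_splits)
  have "mcoeff (psym k * f) M = (\<Sum>p\<in>?h ` ?I. case p of (A, B) \<Rightarrow> mcoeff (psym k) A * mcoeff f B)"
    unfolding mcoeff_times
  proof (rule sum.mono_neutral_right)
    show "?h ` ?I \<subseteq> msplits M"
      using sub by (auto simp: msplits_def)
    show "\<forall>p\<in>msplits M - ?h ` ?I. (case p of (A, B) \<Rightarrow> mcoeff (psym k) A * mcoeff f B) = 0"
    proof (clarify, rule ccontr)
      fix A B assume AB: "(A, B) \<in> msplits M" "(A, B) \<notin> ?h ` ?I"
        and "mcoeff (psym k) A * mcoeff f B \<noteq> 0"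
      then obtain i where i: "A = replicate_mset k i"
        by (auto simp: mcoeff_psym split: if_splits)
      then have "M = replicate_mset k i + B"
        using AB(1) by (auto simp: msplits_def)
      then have "k \<le> count M i" "i \<in># M" "B = M - A"
        using i assms by auto
      then show False
        using AB(2) i by auto
    qed
  qed simp
  also have "\<dots> = (\<Sum>i\<in>?I. mcoeff f (M - replicate_mset k i))"
    unfolding sum.reindex[OF inj] by (intro sum.cong) (auto simp: mcoeff_psym)
  also have "\<dots> = (\<Sum>i\<in>set_mset M. if k \<le> count M i then mcoeff f (M - replicate_mset k i) else 0)"
    by (rule sum.inter_filter) simp
  finally show ?thesis .
qed

lemma hsym_0 [simp]: "hsym 0 = 1" and esym_0 [simp]: "esym 0 = 1"
  by (rule mseries_eqI; auto simp: mcoeff_hsym mcoeff_esym mcoeff_1)+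

text \<open>At a monomial \<open>M\<close> of degree \<open>k\<close>, the variable \<open>j\<close>
  contributes 1 for each \<open>i\<close> from 1 to its multiplicity; the multiplicities add up to
  \<open>k\<close>.\<close>

lemma newton_hsym: "of_nat k * hsym k = (\<Sum>i=1..k. psym i * hsym (k - i))"
proof (rule mseries_eqI)
  fix M
  have "mcoeff (\<Sum>i=1..k. psym i * hsym (k - i)) M =
      (\<Sum>i=1..k. \<Sum>j\<in>set_mset M. if i \<le> count M j \<and> size M = k then 1 else 0)"
    unfolding mcoeff_sum
  proof (intro sum.cong refl)
    fix i assume i: "i \<in> {1..k}"
    have "(size M - i = k - i) = (size M = k)" if "i \<le> count M j" for j
      using i that count_le_size[of M j] by auto
    then show "mcoeff (psym i * hsym (k - i)) M =
        (\<Sum>j\<in>set_mset M. if i \<le> count M j \<and> size M = k then 1 else 0)"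
      using i by (subst mcoeff_psym_mult)
        (auto intro!: sum.cong simp: mcoeff_hsym size_Diff_submset subseteq_mset_def)
  qed
  also have "\<dots> = (\<Sum>j\<in>set_mset M. \<Sum>i=1..k. if i \<le> count M j \<and> size M = k then 1 else 0)"
    by (rule sum.swap)
  also have "\<dots> = (\<Sum>j\<in>set_mset M. if size M = k then of_nat (count M j) else 0)"
  proof (intro sum.cong refl)
    fix j
    show "(\<Sum>i=1..k. if i \<le> count M j \<and> size M = k then 1 else 0) =
       (if size M = k then of_nat (count M j) else (0::complex))"
    proof (cases "size M = k")
      case True
      then have "count M j \<le> k"
        using count_le_size[of M j] by simp
      then have "{i \<in> {1..k}. i \<le> count M j} = {1..count M j}"
        by auto
      then show ?thesis
        using True by (simp flip: sum.inter_filter)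
    qed simp
  qed
  also have "\<dots> = mcoeff (of_nat k * hsym k) M"
    by (auto simp: of_nat_mult_mseries mcoeff_hsym size_multiset_overloaded_eq)
  finally show "mcoeff (of_nat k * hsym k) M = mcoeff (\<Sum>i=1..k. psym i * hsym (k - i)) M" ..
qed

text \<open>Removing \<open>i\<close> copies of a variable of multiplicity \<open>c\<close> leaves a
  squarefree monomial only if \<open>i\<close> is \<open>c\<close> or \<open>c - 1\<close> and all
  other multiplicities are at most 1. The two signs cancel unless \<open>c = 1\<close>, where
  \<open>i = 0\<close> lies outside the range of summation.\<close>

lemma newton_esym: "of_nat k * esym k = (\<Sum>i=1..k. mscale ((-1) ^ (i - 1)) (psym i * esym (k - i)))"
proof (rule mseries_eqI)
  fix M
  let ?sf = "\<lambda>M. \<forall>l. count M l \<le> 1"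
  have "mcoeff (\<Sum>i=1..k. mscale ((-1) ^ (i - 1)) (psym i * esym (k - i))) M =
      (\<Sum>i=1..k. \<Sum>j\<in>set_mset M. if i \<le> count M j \<and> size M = k \<and> ?sf (M - replicate_mset i j)
         then (-1) ^ (i - 1) else 0)"
    unfolding mcoeff_sum
  proof (intro sum.cong refl)
    fix i assume i: "i \<in> {1..k}"
    have "(size M - i = k - i) = (size M = k)" if "i \<le> count M j" for j
      using i that count_le_size[of M j] by auto
    then show "mcoeff (mscale ((-1) ^ (i - 1)) (psym i * esym (k - i))) M =
        (\<Sum>j\<in>set_mset M. if i \<le> count M j \<and> size M = k \<and> ?sf (M - replicate_mset i j)
         then (-1) ^ (i - 1) else 0)"
      using i unfolding mcoeff_mscale by (subst mcoeff_psym_mult)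
        (auto intro!: sum.cong simp: mcoeff_esym size_Diff_submset subseteq_mset_def sum_distrib_left)
  qed
  also have "\<dots> = (\<Sum>j\<in>set_mset M. \<Sum>i=1..k.
      if i \<le> count M j \<and> size M = k \<and> ?sf (M - replicate_mset i j) then (-1) ^ (i - 1) else 0)"
    by (rule sum.swap)
  also have "\<dots> = (\<Sum>j\<in>set_mset M. if size M = k \<and> ?sf M then 1 else 0)"
  proof (intro sum.cong refl)
    fix j assume j: "j \<in> set_mset M"
    let ?S = "\<Sum>i=1..k. if i \<le> count M j \<and> size M = k \<and> ?sf (M - replicate_mset i j)
      then (-1) ^ (i - 1) else (0::complex)"
    show "?S = (if size M = k \<and> ?sf M then 1 else 0)"
    proof (cases "size M = k \<and> (\<forall>l. l \<noteq> j \<longrightarrow> count M l \<le> 1)")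
      case True
      define c where "c = count M j"
      have c: "c \<ge> 1" "c \<le> k"
        using j True count_le_size[of M j] by (auto simp: c_def Suc_le_eq)
      have sf: "?sf (M - replicate_mset i j) \<longleftrightarrow> c - i \<le> 1" for i
        using True by (auto simp: c_def)
      have "?S = (\<Sum>i=1..k. if i \<in> {c - 1, c} \<inter> {1..k} then (-1) ^ (i - 1) else 0)"
        unfolding sf c_def[symmetric] using True c by (intro sum.cong) auto
      also have "\<dots> = (\<Sum>i\<in>{c - 1, c} \<inter> {1..k}. (-1) ^ (i - 1))"
        by (subst sum.inter_restrict[symmetric]) (auto intro!: sum.cong)
      also have "\<dots> = (if c = 1 then 1 else 0)"
      proof (cases "c = 1")
        case False
        then obtain d where "c = Suc (Suc d)"
          using c(1) by (metis One_nat_def Suc_le_D old.nat.exhaust)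
        then show ?thesis using c by simp
      qed (use c in auto)
      also have "(c = 1) = (size M = k \<and> ?sf M)"
        using True c(1) unfolding c_def by (metis le_antisym order_refl)
      finally show ?thesis .
    next
      case False
      have "\<not> (size M = k \<and> ?sf (M - replicate_mset i j))" for i
        using False by (auto dest: spec)
      then have "?S = 0"
        by (intro sum.neutral) auto
      then show ?thesis using False by auto
    qed
  qed
  also have "\<dots> = mcoeff (of_nat k * esym k) M"
  proof (cases "size M = k \<and> ?sf M")
    case True
    then have "count M j = 1" if "j \<in># M" for j
      using that by (metis One_nat_def Suc_leI count_greater_zero_iff le_antisym)
    then have "size M = card (set_mset M)"
      by (simp add: size_multiset_overloaded_eq)
    then show ?thesis
      using True by (simp add: of_nat_mult_mseries mcoeff_esym)
  qed (auto simp: of_nat_mult_mseries mcoeff_esym)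
  finally show "mcoeff (of_nat k * esym k) M =
      mcoeff (\<Sum>i=1..k. mscale ((-1) ^ (i - 1)) (psym i * esym (k - i))) M" ..
qed


section \<open>Plethysm\<close>

lemma mcoeff_psym_plethysm_repeat:
  assumes "k > 0"
  shows "mcoeff (psym_plethysm k g) (repeat_mset k N) = mcoeff g N"
  using assms by (simp add: psym_plethysm_def repeat_mset_cancel1)

lemma mcoeff_psym_plethysm_0:
  assumes "M \<notin> range (repeat_mset k)"
  shows "mcoeff (psym_plethysm k g) M = 0"
proof -
  have "{N. repeat_mset k N = M} = {}"
    using assms by auto
  then show ?thesis
    unfolding psym_plethysm_def mcoeff_Mseries by (simp only: sum.empty)
qed

lemma psym_plethysm_eqI:
  assumes "k > 0" "\<And>N. mcoeff f (repeat_mset k N) = mcoeff g N"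
    and "\<And>M. M \<notin> range (repeat_mset k) \<Longrightarrow> mcoeff f M = 0"
  shows "psym_plethysm k g = f"
proof (rule mseries_eqI)
  fix M
  show "mcoeff (psym_plethysm k g) M = mcoeff f M"
    using assms mcoeff_psym_plethysm_repeat[OF assms(1)] mcoeff_psym_plethysm_0[of M k g]
    by (cases "M \<in> range (repeat_mset k)") auto
qed

lemma psym_plethysm_diff:
  "k > 0 \<Longrightarrow> psym_plethysm k (f - g) = psym_plethysm k f - psym_plethysm k g"
  and psym_plethysm_mscale: "k > 0 \<Longrightarrow> psym_plethysm k (mscale c f) = mscale c (psym_plethysm k f)"
  by (rule psym_plethysm_eqI; simp add: mcoeff_psym_plethysm_repeat mcoeff_psym_plethysm_0)+

lemma psym_plethysm_sum:
  "k > 0 \<Longrightarrow> psym_plethysm k (\<Sum>x\<in>X. F x) = (\<Sum>x\<in>X. psym_plethysm k (F x))"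
  by (rule psym_plethysm_eqI) (simp_all add: mcoeff_psym_plethysm_repeat mcoeff_psym_plethysm_0)

lemma psym_plethysm_1: "k > 0 \<Longrightarrow> psym_plethysm k 1 = 1"
  by (rule psym_plethysm_eqI) (auto simp: mcoeff_1 repeat_mset_eq_empty_iff intro: range_eqI[of _ _ "{#}"])

text \<open>Both factors on the right are supported on \<open>k\<close>-th powers of monomials, and
  the splittings of \<open>repeat_mset k N\<close> into two such monomials are exactly the images of
  the splittings of \<open>N\<close>.\<close>

lemma psym_plethysm_mult:
  assumes k: "k > 0"
  shows "psym_plethysm k (f * g) = psym_plethysm k f * psym_plethysm k g"
proof (rule psym_plethysm_eqI[OF k])
  let ?h = "map_prod (repeat_mset k) (repeat_mset k) :: nat multiset \<times> nat multiset \<Rightarrow> _"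
  let ?F = "\<lambda>(A, B). mcoeff (psym_plethysm k f) A * mcoeff (psym_plethysm k g) B"
  have zero: "?F (A, B) = 0"
    if "A \<notin> range (repeat_mset k) \<or> B \<notin> range (repeat_mset k)" for A B
    using that by (auto simp: mcoeff_psym_plethysm_0)
  have "inj (repeat_mset k :: nat multiset \<Rightarrow> nat multiset)"
    using k by (simp add: inj_def repeat_mset_cancel1)
  then have inj: "inj_on ?h S" for S
    by (meson prod.inj_map inj_on_subset subset_UNIV)
  show "mcoeff (psym_plethysm k f * psym_plethysm k g) (repeat_mset k N) = mcoeff (f * g) N" for N
  proof -
    have "mcoeff (psym_plethysm k f * psym_plethysm k g) (repeat_mset k N) = sum ?F (?h ` msplits N)"
      unfolding mcoeff_times
    proof (rule sum.mono_neutral_right)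
      show "?h ` msplits N \<subseteq> msplits (repeat_mset k N)"
        by (auto simp: msplits_def simp del: repeat_mset_distrib2 simp flip: repeat_mset_distrib2)
      show "\<forall>p\<in>msplits (repeat_mset k N) - ?h ` msplits N. ?F p = 0"
      proof (clarify, rule ccontr)
        fix A B assume AB: "(A, B) \<in> msplits (repeat_mset k N)" "(A, B) \<notin> ?h ` msplits N"
          and "mcoeff (psym_plethysm k f) A * mcoeff (psym_plethysm k g) B \<noteq> 0"
        then obtain A' B' where A': "A = repeat_mset k A'" "B = repeat_mset k B'"
          using zero by fastforce
        then have "repeat_mset k (A' + B') = repeat_mset k N"
          using AB(1) by (simp add: msplits_def)
        then have "(A', B') \<in> msplits N"
          using k unfolding repeat_mset_cancel1 msplits_def by simp
        then show False
          using AB(2) A' by force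
      qed
    qed simp
    also have "\<dots> = mcoeff (f * g) N"
      unfolding sum.reindex[OF inj] mcoeff_times
      by (intro sum.cong) (auto simp: mcoeff_psym_plethysm_repeat[OF k])
    finally show ?thesis .
  qed
  show "mcoeff (psym_plethysm k f * psym_plethysm k g) M = 0" if M: "M \<notin> range (repeat_mset k)" for M
    unfolding mcoeff_times
  proof (rule sum.neutral, clarify, rule ccontr)
    fix A B assume AB: "(A, B) \<in> msplits M"
      and "mcoeff (psym_plethysm k f) A * mcoeff (psym_plethysm k g) B \<noteq> 0"
    then obtain A' B' where "A = repeat_mset k A'" "B = repeat_mset k B'"
      using zero by fastforce
    then have "M = repeat_mset k (A' + B')"
      using AB by (auto simp: msplits_def)
    then show False using M by blast
  qed
qed

lemma psym_plethysm_power: "k > 0 \<Longrightarrow> psym_plethysm k (f ^ n) = psym_plethysm k f ^ n"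
  by (induction n) (simp_all add: psym_plethysm_1 psym_plethysm_mult)

lemma psym_plethysm_psym:
  assumes "k > 0"
  shows "psym_plethysm k (psym d) = psym (k * d)"
proof (rule psym_plethysm_eqI[OF assms])
  have rep: "repeat_mset k (replicate_mset d i) = replicate_mset (k * d) i" for i :: nat
    by (auto simp: multiset_eq_iff)
  show "mcoeff (psym (k * d)) (repeat_mset k N) = mcoeff (psym d) N" for N
    using assms by (simp add: mcoeff_psym repeat_mset_cancel1 flip: rep)
  show "mcoeff (psym (k * d)) M = 0" if "M \<notin> range (repeat_mset k)" for M
    using that by (auto simp: mcoeff_psym simp flip: rep)
qed

lemma degree_part_psym_plethysm:
  assumes "k > 0"
  shows "degree_part n (psym_plethysm k g) =
    (if k dvd n then psym_plethysm k (degree_part (n div k) g) else 0)"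
proof (rule mseries_eqI)
  fix M
  show "mcoeff (degree_part n (psym_plethysm k g)) M =
      mcoeff (if k dvd n then psym_plethysm k (degree_part (n div k) g) else 0) M"
    using assms
    by (cases "M \<in> range (repeat_mset k)")
       (auto simp: mcoeff_degree_part mcoeff_psym_plethysm_repeat mcoeff_psym_plethysm_0)
qed

lemma vanishes_below_psym_plethysm:
  assumes "k > 0" "vanishes_below 1 g"
  shows "vanishes_below k (psym_plethysm k g)"
  unfolding vanishes_below_def
proof (intro allI impI)
  fix M :: "nat multiset" assume M: "size M < k"
  show "mcoeff (psym_plethysm k g) M = 0"
  proof (cases "M \<in> range (repeat_mset k)")
    case True
    then obtain N where N: "M = repeat_mset k N" by auto
    then have "size N < 1"
      using M by auto
    then show ?thesis
      using N assms mcoeff_psym_plethysm_repeat[of k g N] by (simp add: vanishes_below_def)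
  qed (rule mcoeff_psym_plethysm_0)
qed

section \<open>Linear independence of the power sum products\<close>

definition psym_prod :: "nat multiset \<Rightarrow> mseries" where
  "psym_prod \<mu> = (\<Prod>k\<in>#\<mu>. psym k)"

lemma psym_prod_empty [simp]: "psym_prod {#} = 1"
  and psym_prod_add_mset [simp]: "psym_prod (add_mset k \<mu>) = psym k * psym_prod \<mu>"
  by (simp_all add: psym_prod_def)

text \<open>Rules out cancellation: in \<open>psym_prod_coeff_exists\<close> one nonzero
  contribution then suffices for a nonzero coefficient.\<close>

lemma psym_prod_coeff_nat: "0 \<notin># \<mu> \<Longrightarrow> \<exists>m :: nat. mcoeff (psym_prod \<mu>) M = of_nat m"
proof (induction \<mu> arbitrary: M)
  case empty
  have "mcoeff (psym_prod {#}) M = of_nat (if M = {#} then 1 else 0)"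
    by (simp add: mcoeff_1)
  then show ?case by blast
next
  case (add k \<mu>)
  then obtain m where "\<And>M. mcoeff (psym_prod \<mu>) M = of_nat (m M)"
    by simp metis
  then have "mcoeff (psym_prod (add_mset k \<mu>)) M
      = of_nat (\<Sum>i\<in>set_mset M. if k \<le> count M i then m (M - replicate_mset k i) else 0)"
    using add.prems by (simp add: mcoeff_psym_mult) (auto intro!: sum.cong)
  then show ?case by blast
qed

text \<open>The partition formed by the exponents of a monomial.\<close>

definition mset_shape :: "nat multiset \<Rightarrow> nat multiset" where
  "mset_shape M = image_mset (count M) (mset_set (set_mset M))"

text \<open>Each factor \<open>p_k\<close> brings in at most one new variable. If every factor
  brings in a new one, no exponents merge and they are exactly the parts of the multiset.\<close>

lemma psym_prod_coeff_shape:
  assumes "0 \<notin># \<mu>" "mcoeff (psym_prod \<mu>) M \<noteq> 0"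
  shows "card (set_mset M) \<le> size \<mu> \<and> (card (set_mset M) = size \<mu> \<longrightarrow> mset_shape M = \<mu>)"
  using assms
proof (induction \<mu> arbitrary: M)
  case empty
  then show ?case by (auto simp: mcoeff_1 mset_shape_def split: if_splits)
next
  case (add k \<mu>)
  then have "k > 0" by auto
  then have "(\<Sum>i\<in>set_mset M. if k \<le> count M i then mcoeff (psym_prod \<mu>) (M - replicate_mset k i) else 0) \<noteq> 0"
    using add.prems by (simp add: mcoeff_psym_mult)
  then obtain i where i: "i \<in># M" "k \<le> count M i" "mcoeff (psym_prod \<mu>) (M - replicate_mset k i) \<noteq> 0"
    by (rule sum.not_neutral_contains_not_neutral) (auto split: if_splits)
  define N where "N = M - replicate_mset k i"
  have M: "M = N + replicate_mset k i"
    using i(2) by (auto simp: N_def multiset_eq_iff)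
  have N: "card (set_mset N) \<le> size \<mu>" "card (set_mset N) = size \<mu> \<Longrightarrow> mset_shape N = \<mu>"
    using add.IH[of N] add.prems i(3) by (auto simp: N_def)
  have set: "set_mset M = insert i (set_mset N)"
    using \<open>k > 0\<close> by (auto simp: M)
  show ?case
  proof (cases "i \<in># N")
    case True
    then show ?thesis using N(1) set by (auto simp: insert_absorb)
  next
    case False
    then have "count N i = 0"
      by (simp add: not_in_iff)
    with False have "mset_shape M = add_mset k (mset_shape N)"
      unfolding mset_shape_def set by (auto simp: M intro!: image_mset_cong)
    then show ?thesis using False N set by auto
  qed
qed

lemma psym_prod_coeff_exists:
  assumes "0 \<notin># \<mu>"
  shows "\<exists>M. mcoeff (psym_prod \<mu>) M \<noteq> 0 \<and> card (set_mset M) = size \<mu>"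
  using assms
proof (induction \<mu>)
  case empty
  then show ?case by (auto simp: mcoeff_1)
next
  case (add k \<mu>)
  then have k: "k > 0" and "0 \<notin># \<mu>" by auto
  with add.IH obtain N where N: "mcoeff (psym_prod \<mu>) N \<noteq> 0" "card (set_mset N) = size \<mu>"
    by auto
  \<comment> \<open>Giving the new part a fresh variable raises the number of variables by exactly
    one.\<close>
  obtain i where i: "i \<notin># N"
    using ex_new_if_finite[OF infinite_UNIV_nat] finite_set_mset by blast
  define M where "M = N + replicate_mset k i"
  obtain m where m: "\<And>M. mcoeff (psym_prod \<mu>) M = of_nat (m M)"
    using psym_prod_coeff_nat[OF \<open>0 \<notin># \<mu>\<close>] by metis
  have "mcoeff (psym_prod (add_mset k \<mu>)) M
      = of_nat (\<Sum>j\<in>set_mset M. if k \<le> count M j then m (M - replicate_mset k j) else 0)"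
    using k m by (simp add: mcoeff_psym_mult) (auto intro!: sum.cong)
  moreover have "(\<Sum>j\<in>set_mset M. if k \<le> count M j then m (M - replicate_mset k j) else 0) \<noteq> 0"
  proof
    assume "(\<Sum>j\<in>set_mset M. if k \<le> count M j then m (M - replicate_mset k j) else 0) = 0"
    then have "\<forall>j\<in>set_mset M. (if k \<le> count M j then m (M - replicate_mset k j) else 0) = 0"
      by simp
    moreover have "i \<in># M" "k \<le> count M i" "M - replicate_mset k i = N"
      using k by (auto simp: M_def)
    ultimately have "m N = 0" by metis
    then show False using N(1) m by simp
  qed
  moreover have "card (set_mset M) = size (add_mset k \<mu>)"
    using i k N(2) by (simp add: M_def)
  ultimately show ?case by (metis of_nat_eq_0_iff)
qed

text \<open>
  Triangularity: among the \<open>\<mu>\<close> of a linear relation take one with the most parts; a monomial with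
  exponents \<open>\<mu>\<close> occurs in none of the other power sum products of the relation.
\<close>

lemma psym_prod_independent:
  assumes P: "finite P" "\<And>\<mu>. \<mu> \<in> P \<Longrightarrow> 0 \<notin># \<mu>"
    and rel: "(\<Sum>\<mu>\<in>P. mscale (a \<mu>) (psym_prod \<mu>)) = 0"
    and "\<mu> \<in> P"
  shows "a \<mu> = 0"
proof (rule ccontr)
  let ?S = "{\<mu> \<in> P. a \<mu> \<noteq> 0}"
  assume "a \<mu> \<noteq> 0"
  then have "?S \<noteq> {}" "finite ?S"
    using assms by auto
  then have "Max (size ` ?S) \<in> size ` ?S"
    by (intro Max_in) auto
  then obtain \<nu> where "\<nu> \<in> ?S" "size \<nu> = Max (size ` ?S)"
    by auto
  then have \<nu>: "\<nu> \<in> ?S" "\<And>\<rho>. \<rho> \<in> ?S \<Longrightarrow> size \<rho> \<le> size \<nu>"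
    using \<open>finite ?S\<close> by auto
  obtain M where M: "mcoeff (psym_prod \<nu>) M \<noteq> 0" "card (set_mset M) = size \<nu>"
    using psym_prod_coeff_exists P(2) \<nu>(1) by blast
  have "a \<rho> * mcoeff (psym_prod \<rho>) M = 0" if "\<rho> \<in> P - {\<nu>}" for \<rho>
  proof (rule ccontr)
    assume nz: "a \<rho> * mcoeff (psym_prod \<rho>) M \<noteq> 0"
    then have "size \<rho> \<le> size \<nu>"
      using that \<nu>(2) by auto
    moreover have "card (set_mset M) \<le> size \<rho>" "card (set_mset M) = size \<rho> \<longrightarrow> mset_shape M = \<rho>"
      using psym_prod_coeff_shape[of \<rho> M] P(2) that nz by auto
    ultimately have "mset_shape M = \<rho>"
      using M(2) by auto
    moreover have "mset_shape M = \<nu>"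
      using psym_prod_coeff_shape[of \<nu> M] P(2) \<nu>(1) M by auto
    ultimately show False using that by auto
  qed
  then have "(\<Sum>\<rho>\<in>P - {\<nu>}. a \<rho> * mcoeff (psym_prod \<rho>) M) = 0"
    by (intro sum.neutral ballI)
  then have "(\<Sum>\<rho>\<in>P. a \<rho> * mcoeff (psym_prod \<rho>) M) = a \<nu> * mcoeff (psym_prod \<nu>) M"
    using sum.remove[OF P(1), of \<nu> "\<lambda>\<rho>. a \<rho> * mcoeff (psym_prod \<rho>) M"] \<nu>(1) by simp
  moreover have "(\<Sum>\<rho>\<in>P. a \<rho> * mcoeff (psym_prod \<rho>) M) = 0"
    using arg_cong[OF rel, of "\<lambda>f. mcoeff f M"] by simp
  ultimately show False using M(1) \<nu>(1) by simp
qed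

section \<open>Plethysm as a functional relation\<close>

definition plethysm_prod :: "mseries \<Rightarrow> nat multiset \<Rightarrow> mseries" where
  "plethysm_prod g \<mu> = (\<Prod>k\<in>#\<mu>. psym_plethysm k g)"

text \<open>The graph of the map \<open>f\<close> to \<open>f[g]\<close>, taken from the definite
  description of \<open>plethysm\<close>. As a relation it can be shown to be closed under the
  algebra operations before existence and uniqueness of values are available.\<close>

definition plethysm_rel :: "mseries \<Rightarrow> mseries \<Rightarrow> mseries \<Rightarrow> bool" where
  "plethysm_rel g f r \<longleftrightarrow> (\<exists>P a. finite P \<and> (\<forall>\<mu>\<in>P. 0 \<notin># \<mu>) \<and>
     f = (\<Sum>\<mu>\<in>P. mscale (a \<mu>) (psym_prod \<mu>)) \<and> r = (\<Sum>\<mu>\<in>P. mscale (a \<mu>) (plethysm_prod g \<mu>)))"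

lemma extend_lincomb:
  assumes "finite Q" "P \<subseteq> Q"
  shows "(\<Sum>\<mu>\<in>P. mscale (a \<mu>) (F \<mu>)) = (\<Sum>\<mu>\<in>Q. mscale (if \<mu> \<in> P then a \<mu> else 0) (F \<mu>))"
  using assms by (intro sum.mono_neutral_cong_left) auto

lemma plethysm_rel_0: "plethysm_rel g 0 0"
  unfolding plethysm_rel_def by (rule exI[of _ "{}"]) simp

lemma plethysm_rel_1: "plethysm_rel g 1 1"
  unfolding plethysm_rel_def
  by (rule exI[of _ "{{#}}"], rule exI[of _ "\<lambda>_. 1"]) (simp add: psym_prod_def plethysm_prod_def)

lemma plethysm_rel_add:
  assumes "plethysm_rel g f r" "plethysm_rel g f' r'"
  shows "plethysm_rel g (f + f') (r + r')"
proof -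
  obtain P a where 1: "finite P" "\<forall>\<mu>\<in>P. 0 \<notin># \<mu>" "f = (\<Sum>\<mu>\<in>P. mscale (a \<mu>) (psym_prod \<mu>))"
    "r = (\<Sum>\<mu>\<in>P. mscale (a \<mu>) (plethysm_prod g \<mu>))"
    using assms(1) unfolding plethysm_rel_def by blast
  obtain P' a' where 2: "finite P'" "\<forall>\<mu>\<in>P'. 0 \<notin># \<mu>" "f' = (\<Sum>\<mu>\<in>P'. mscale (a' \<mu>) (psym_prod \<mu>))"
    "r' = (\<Sum>\<mu>\<in>P'. mscale (a' \<mu>) (plethysm_prod g \<mu>))"
    using assms(2) unfolding plethysm_rel_def by blast
  have ext: "(\<Sum>\<mu>\<in>P. mscale (a \<mu>) (F \<mu>)) + (\<Sum>\<mu>\<in>P'. mscale (a' \<mu>) (F \<mu>)) =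
     (\<Sum>\<mu>\<in>P \<union> P'. mscale ((if \<mu> \<in> P then a \<mu> else 0) + (if \<mu> \<in> P' then a' \<mu> else 0)) (F \<mu>))" for F
    using extend_lincomb[of "P \<union> P'" P a F] extend_lincomb[of "P \<union> P'" P' a' F] 1(1) 2(1)
    by (simp only: finite_Un Un_upper1 Un_upper2 mscale_add_left sum.distrib simp_thms)
  show ?thesis
    unfolding plethysm_rel_def
    by (rule exI[of _ "P \<union> P'"],
        rule exI[of _ "\<lambda>\<mu>. (if \<mu> \<in> P then a \<mu> else 0) + (if \<mu> \<in> P' then a' \<mu> else 0)"])
       (use 1 2 ext in auto)
qed

lemma plethysm_rel_mscale:
  assumes "plethysm_rel g f r"
  shows "plethysm_rel g (mscale c f) (mscale c r)"
proof -
  obtain P a where 1: "finite P" "\<forall>\<mu>\<in>P. 0 \<notin># \<mu>" "f = (\<Sum>\<mu>\<in>P. mscale (a \<mu>) (psym_prod \<mu>))"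
    "r = (\<Sum>\<mu>\<in>P. mscale (a \<mu>) (plethysm_prod g \<mu>))"
    using assms(1) unfolding plethysm_rel_def by blast
  show ?thesis
    unfolding plethysm_rel_def
    by (rule exI[of _ P], rule exI[of _ "\<lambda>\<mu>. c * a \<mu>"]) (use 1 in \<open>auto simp: mscale_sum_right\<close>)
qed

lemma plethysm_rel_sum:
  "(\<And>i. i \<in> I \<Longrightarrow> plethysm_rel g (F i) (R i)) \<Longrightarrow> plethysm_rel g (\<Sum>i\<in>I. F i) (\<Sum>i\<in>I. R i)"
  by (induction I rule: infinite_finite_induct) (auto intro: plethysm_rel_0 plethysm_rel_add)

lemma plethysm_rel_psym_mult:
  assumes "plethysm_rel g f r" "k > 0"
  shows "plethysm_rel g (psym k * f) (psym_plethysm k g * r)"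
proof -
  obtain P a where 1: "finite P" "\<forall>\<mu>\<in>P. 0 \<notin># \<mu>" "f = (\<Sum>\<mu>\<in>P. mscale (a \<mu>) (psym_prod \<mu>))"
    "r = (\<Sum>\<mu>\<in>P. mscale (a \<mu>) (plethysm_prod g \<mu>))"
    using assms(1) unfolding plethysm_rel_def by blast
  show ?thesis
    unfolding plethysm_rel_def
    by (rule exI[of _ "add_mset k ` P"], rule exI[of _ "\<lambda>\<mu>. a (\<mu> - {#k#})"])
       (use 1 assms(2) in \<open>auto simp: sum.reindex inj_on_def sum_distrib_left psym_prod_def plethysm_prod_def\<close>)
qed

text \<open>Subtracting the two representations represents 0, so all coefficients vanish by linear
  independence, and with them the difference of the values.\<close>

lemma plethysm_rel_unique:
  assumes "plethysm_rel g f r" "plethysm_rel g f r'"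
  shows "r = r'"
proof -
  have "plethysm_rel g (f + mscale (-1) f) (r + mscale (-1) r')"
    by (intro plethysm_rel_add plethysm_rel_mscale assms)
  then obtain P a where P: "finite P" "\<forall>\<mu>\<in>P. 0 \<notin># \<mu>" "0 = (\<Sum>\<mu>\<in>P. mscale (a \<mu>) (psym_prod \<mu>))"
    "r - r' = (\<Sum>\<mu>\<in>P. mscale (a \<mu>) (plethysm_prod g \<mu>))"
    unfolding plethysm_rel_def by (auto simp: mscale_minus_left)
  then have "a \<mu> = 0" if "\<mu> \<in> P" for \<mu>
    using psym_prod_independent[of P a \<mu>] that by auto
  then show ?thesis using P(4) by simp
qed

lemma plethysm_eqI:
  assumes "plethysm_rel g f r"
  shows "plethysm f g = r"
  unfolding plethysm_def psym_prod_def[symmetric] plethysm_prod_def[symmetric]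
    plethysm_rel_def[symmetric]
  using assms plethysm_rel_unique by blast

text \<open>The image of \<open>newton_esym\<close> under the homomorphism \<open>f\<close> to
  \<open>f[g]\<close>. The same identity, divided by \<open>k\<close>, shows by induction that
  \<open>e_k\<close> is a polynomial in power sums, so that \<open>e_k[g]\<close> exists.\<close>

lemma newton_plethysm_esym: "of_nat k * plethysm (esym k) g =
    (\<Sum>i=1..k. mscale ((-1) ^ (i - 1)) (psym_plethysm i g * plethysm (esym (k - i)) g))"
proof -
  \<comment> \<open>Conditional on smaller indices, because it is used twice: inside the induction
    that proves \<open>rel\<close>, and afterwards for the identity itself.\<close>
  have main: "k > 0 \<Longrightarrow> plethysm_rel g (mscale (of_nat k) (esym k))
      (\<Sum>i=1..k. mscale ((-1) ^ (i - 1)) (psym_plethysm i g * plethysm (esym (k - i)) g))"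
    if "\<And>l. l < k \<Longrightarrow> plethysm_rel g (esym l) (plethysm (esym l) g)" for k
    unfolding of_nat_mult_mseries[symmetric] newton_esym
    by (intro plethysm_rel_sum plethysm_rel_mscale plethysm_rel_psym_mult that) auto
  have rel: "plethysm_rel g (esym k) (plethysm (esym k) g)" for k
  proof (induction k rule: less_induct)
    case (less k)
    have "\<exists>r. plethysm_rel g (esym k) r"
    proof (cases "k = 0")
      case False
      then have "k > 0" by simp
      from plethysm_rel_mscale[OF main[of k, OF less this], of "1 / of_nat k"]
      show ?thesis using False by auto
    qed (auto intro: plethysm_rel_1)
    then show ?case
      using plethysm_eqI by blast
  qed
  show "of_nat k * plethysm (esym k) g =
    (\<Sum>i=1..k. mscale ((-1) ^ (i - 1)) (psym_plethysm i g * plethysm (esym (k - i)) g))"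
  proof (cases "k = 0")
    case False
    then show ?thesis
      unfolding of_nat_mult_mseries
      using plethysm_rel_unique[OF plethysm_rel_mscale[OF rel] main[OF rel]] by simp
  qed simp
qed

lemma plethysm_esym_0: "plethysm (esym 0) g = 1"
  using plethysm_eqI[OF plethysm_rel_1] by simp

lemma vanishes_below_plethysm_esym:
  assumes "vanishes_below 1 g"
  shows "vanishes_below k (plethysm (esym k) g)"
proof (induction k rule: less_induct)
  case (less k)
  have summand: "mcoeff (psym_plethysm i g * plethysm (esym (k - i)) g) M = 0"
    if "i \<in> {1..k}" "size M < k" for i M
    using vanishes_below_mult[OF vanishes_below_psym_plethysm[OF _ assms] less, of i "k - i"] that
    by (auto simp: vanishes_below_def)
  show ?case
    unfolding vanishes_below_def
  proof (intro allI impI)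
    fix M :: "nat multiset" assume M: "size M < k"
    have "of_nat k * mcoeff (plethysm (esym k) g) M = mcoeff (of_nat k * plethysm (esym k) g) M"
      by (simp add: of_nat_mult_mseries)
    also have "\<dots> = 0"
      unfolding newton_plethysm_esym using summand M by simp
    finally show "mcoeff (plethysm (esym k) g) M = 0"
      using M by simp
  qed
qed

text \<open>The differential form of \<open>\<Sum>\<^sub>k e\<^sub>k[g] = exp (\<Sum>\<^sub>i (-1)\<^sup>i\<^sup>-\<^sup>1 p\<^sub>i[g] / i)\<close>.\<close>

lemma euler_plethysm_esym:
  "euler (plethysm (esym k) g) = (\<Sum>i=1..k. mscale ((-1) ^ (i - 1) / of_nat i)
     (euler (psym_plethysm i g) * plethysm (esym (k - i)) g))"
proof (induction k rule: less_induct)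
  case (less k)
  let ?E = "\<lambda>k. plethysm (esym k) g" and ?Q = "\<lambda>i. psym_plethysm i g"
  let ?s = "\<lambda>i. (-1) ^ (i - 1) :: complex"
  have newton: "mscale (of_nat m) (?E m) = (\<Sum>i=1..m. mscale (?s i) (?Q i * ?E (m - i)))" for m
    using newton_plethysm_esym[of m g] by (simp add: of_nat_mult_mseries)
  show ?case
  proof (cases "k = 0")
    case True
    then show ?thesis
      using plethysm_esym_0[of g] by (auto intro!: mseries_eqI simp: mcoeff_euler mcoeff_1)
  next
    case False
    have "mscale (of_nat k) (euler (?E k)) = euler (mscale (of_nat k) (?E k))"
      by (simp add: euler_mscale)
    also have "\<dots> = (\<Sum>i=1..k. mscale (?s i) (euler (?Q i) * ?E (k - i)))
        + (\<Sum>i=1..k. mscale (?s i) (?Q i * euler (?E (k - i))))"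
      unfolding newton by (simp add: euler_sum euler_mscale euler_mult mscale_add_right sum.distrib)
    also have "(\<Sum>i=1..k. mscale (?s i) (?Q i * euler (?E (k - i)))) =
        (\<Sum>i=1..k. \<Sum>j=1..k - i. mscale (?s i * (?s j / of_nat j)) (?Q i * (euler (?Q j) * ?E (k - i - j))))"
      using less by (intro sum.cong) (auto simp: sum_distrib_left mscale_sum_right)
    also have "\<dots> = (\<Sum>j=1..k. \<Sum>i=1..k - j. mscale (?s i * (?s j / of_nat j)) (?Q i * (euler (?Q j) * ?E (k - i - j))))"
      unfolding sum.Sigma[OF finite_atLeastAtMost ballI[OF finite_atLeastAtMost]]
      by (rule sum.reindex_bij_witness[of _ "\<lambda>(i, j). (j, i)" "\<lambda>(i, j). (j, i)"]) auto
    also have "\<dots> = (\<Sum>j=1..k. mscale (?s j / of_nat j)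
        (euler (?Q j) * (\<Sum>i=1..k - j. mscale (?s i) (?Q i * ?E (k - j - i)))))"
      by (simp add: sum_distrib_left mscale_sum_right mult_ac add.commute)
    also have "\<dots> = (\<Sum>j=1..k. mscale (of_nat (k - j) * ?s j / of_nat j) (euler (?Q j) * ?E (k - j)))"
      by (simp only: newton[symmetric]) (simp add: mult_ac)
    \<comment> \<open>The coefficients combine as \<open>1 + (k - i) / i = k / i\<close>.\<close>
    also have "(\<Sum>i=1..k. mscale (?s i) (euler (?Q i) * ?E (k - i))) +
        (\<Sum>j=1..k. mscale (of_nat (k - j) * ?s j / of_nat j) (euler (?Q j) * ?E (k - j))) =
        (\<Sum>i=1..k. mscale (of_nat k * (?s i / of_nat i)) (euler (?Q i) * ?E (k - i)))"
      unfolding sum.distrib[symmetric] mscale_add_left[symmetric]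
      by (intro sum.cong refl) (auto simp: field_simps of_nat_diff)
    also have "\<dots> = mscale (of_nat k) (\<Sum>i=1..k. mscale (?s i / of_nat i) (euler (?Q i) * ?E (k - i)))"
      by (simp add: mscale_sum_right)
    finally show ?thesis
      by (rule mscale_cancel[rotated]) (use False in simp)
  qed
qed

section \<open>Recurrences in the degree for both sides of the identity\<close>

lemma sum_triangle_swap:
  "(\<Sum>k=0..n. \<Sum>i=1..k. F k i) = (\<Sum>i=1..n. \<Sum>k=0..n - i. F (k + i) i)"
  for F :: "nat \<Rightarrow> nat \<Rightarrow> 'a::comm_monoid_add"
  unfolding sum.Sigma[OF finite_atLeastAtMost ballI[OF finite_atLeastAtMost]]
  by (rule sum.reindex_bij_witness[of _ "\<lambda>(i, k). (k + i, i)" "\<lambda>(k, i). (i, k - i)"]) auto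

text \<open>The degree \<open>n\<close> part of \<open>sum_k e_k[g]\<close>. If \<open>g\<close> has
  no constant term, then \<open>e_k[g]\<close> starts in degree \<open>k\<close>, so stopping at
  \<open>k = n\<close> loses nothing (\<open>Esum_extend\<close>).\<close>

definition Esum :: "mseries \<Rightarrow> nat \<Rightarrow> mseries" where
  "Esum g n = (\<Sum>k=0..n. degree_part n (plethysm (esym k) g))"

lemma Esum_extend:
  assumes "vanishes_below 1 g" "n \<le> m"
  shows "(\<Sum>k=0..m. degree_part n (plethysm (esym k) g)) = Esum g n"
  unfolding Esum_def using assms
  by (intro sum.mono_neutral_right)
     (auto intro: degree_part_vanishes[OF vanishes_below_plethysm_esym])

text \<open>The degree \<open>n\<close> part of \<open>euler E = L * E\<close>, where
  \<open>E = sum_k e_k[g]\<close> and \<open>L\<close> is the sum of the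
  \<open>(-1)^(i-1) / i * euler (p_i[g])\<close>.\<close>

lemma Esum_recurrence:
  assumes g: "vanishes_below 1 g"
  shows "of_nat n * Esum g n = (\<Sum>j=1..n.
    (\<Sum>i=1..j. mscale ((-1) ^ (i - 1) * of_nat j / of_nat i) (degree_part j (psym_plethysm i g)))
      * Esum g (n - j))"
proof -
  let ?E = "\<lambda>k. plethysm (esym k) g" and ?Q = "\<lambda>i. psym_plethysm i g"
  let ?c = "\<lambda>i. (-1) ^ (i - 1) / of_nat i :: complex"
  have Q0: "degree_part j (?Q i) = 0" if "j < i" for i j
    using degree_part_vanishes[OF vanishes_below_psym_plethysm[OF _ g]] that by auto
  have "of_nat n * Esum g n = (\<Sum>k=0..n. degree_part n (euler (?E k)))"
    by (simp add: Esum_def of_nat_mult_mseries mscale_sum_right degree_part_euler)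
  also have "\<dots> = (\<Sum>k=0..n. \<Sum>i=1..k. \<Sum>j=0..n.
      mscale (?c i * of_nat j) (degree_part j (?Q i) * degree_part (n - j) (?E (k - i))))"
    by (simp add: euler_plethysm_esym degree_part_sum degree_part_mscale degree_part_mult
        degree_part_euler mscale_sum_right)
  also have "\<dots> = (\<Sum>i=1..n. \<Sum>k=0..n - i. \<Sum>j=0..n.
      mscale (?c i * of_nat j) (degree_part j (?Q i) * degree_part (n - j) (?E k)))"
    by (subst sum_triangle_swap) simp
  also have "\<dots> = (\<Sum>i=1..n. \<Sum>j=0..n. \<Sum>k=0..n - i.
      mscale (?c i * of_nat j) (degree_part j (?Q i) * degree_part (n - j) (?E k)))"
    by (rule sum.cong[OF refl]) (rule sum.swap)
  also have "\<dots> = (\<Sum>i=1..n. \<Sum>j=0..n.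
      mscale (?c i * of_nat j) (degree_part j (?Q i) * Esum g (n - j)))"
  proof (intro sum.cong refl)
    fix i j
    show "(\<Sum>k=0..n - i. mscale (?c i * of_nat j) (degree_part j (?Q i) * degree_part (n - j) (?E k)))
        = mscale (?c i * of_nat j) (degree_part j (?Q i) * Esum g (n - j))"
    proof (cases "j < i")
      case False
      \<comment> \<open>From \<open>i \<le> j\<close> follows \<open>n - j \<le> n - i\<close>, so
        the truncated sum over \<open>k\<close> already contains all terms of degree
        \<open>n - j\<close>. For \<open>j < i\<close> the factor from \<open>p_i[g]\<close>
        vanishes instead.\<close>
      then have "Esum g (n - j) = (\<Sum>k=0..n - i. degree_part (n - j) (?E k))"
        using Esum_extend[OF g, of "n - j" "n - i"] by simp
      then show ?thesis
        by (simp add: sum_distrib_left mscale_sum_right)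
    qed (simp add: Q0)
  qed
  also have "\<dots> = (\<Sum>j=0..n. \<Sum>i=1..n. mscale (?c i * of_nat j) (degree_part j (?Q i) * Esum g (n - j)))"
    by (rule sum.swap)
  also have "\<dots> = (\<Sum>j=1..n. \<Sum>i=1..n. mscale (?c i * of_nat j) (degree_part j (?Q i) * Esum g (n - j)))"
    by (intro sum.mono_neutral_right) (auto intro!: sum.neutral simp: Suc_le_eq)
  also have "\<dots> = (\<Sum>j=1..n. \<Sum>i=1..j. mscale (?c i * of_nat j) (degree_part j (?Q i) * Esum g (n - j)))"
    by (intro sum.cong refl sum.mono_neutral_right) (auto simp: Q0)
  also have "\<dots> = (\<Sum>j=1..n.
    (\<Sum>i=1..j. mscale ((-1) ^ (i - 1) * of_nat j / of_nat i) (degree_part j (?Q i))) * Esum g (n - j))"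
    by (simp add: sum_distrib_right)
  finally show ?thesis .
qed

text \<open>Its coefficient at a squarefree monomial of degree \<open>n\<close> is the number of
  derangements of \<open>n\<close> points, whence the name.\<close>

definition deranged :: "nat \<Rightarrow> mseries" where
  "deranged n = (\<Sum>k=0..n. (-1) ^ k * psym 1 ^ (n - k) * hsym k)"

lemma deranged_Suc: "deranged (Suc n) = psym 1 * deranged n + (-1) ^ Suc n * hsym (Suc n)"
proof -
  have "(\<Sum>k=0..n. (-1) ^ k * psym 1 ^ (Suc n - k) * hsym k) = psym 1 * deranged n"
    unfolding deranged_def sum_distrib_left by (intro sum.cong) (auto simp: Suc_diff_le mult_ac)
  then show ?thesis
    by (simp add: deranged_def)
qed

text \<open>Additivity of logarithmic derivatives, free of division because the coefficients form
  only a commutative ring.\<close>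

lemma fps_logderiv_mult:
  fixes A B :: "'a::comm_ring_1 fps"
  assumes "fps_X * fps_deriv A = L * A" "fps_X * fps_deriv B = K * B"
  shows "fps_X * fps_deriv (A * B) = (L + K) * (A * B)"
proof -
  have "fps_X * fps_deriv (A * B) = A * (fps_X * fps_deriv B) + (fps_X * fps_deriv A) * B"
    by (simp add: algebra_simps)
  then show ?thesis
    by (simp add: assms algebra_simps)
qed

lemma fps_nth_X_mult_deriv: "fps_nth (fps_X * fps_deriv F) n = of_nat n * fps_nth F n"
  for F :: "'a::comm_ring_1 fps"
  by (cases n) simp_all

text \<open>An auxiliary variable \<open>fps_X\<close> records the degree, and
  \<open>deranged n\<close> is the coefficient of \<open>A * B\<close>. The logarithmic derivative
  of the geometric series \<open>A\<close> is \<open>L\<close>, and that of \<open>B\<close> is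
  \<open>K\<close> by \<open>newton_hsym\<close>.\<close>

lemma deranged_recurrence:
  "of_nat n * deranged n = (\<Sum>j=1..n. (psym 1 ^ j + (-1) ^ j * psym j) * deranged (n - j))"
proof -
  define A where "A = Abs_fps (\<lambda>n. psym 1 ^ n)"
  define B where "B = Abs_fps (\<lambda>n. (-1) ^ n * hsym n)"
  define L where "L = Abs_fps (\<lambda>n. if n = 0 then 0 else psym 1 ^ n)"
  define K where "K = Abs_fps (\<lambda>n. if n = 0 then 0 else (-1) ^ n * psym n)"
  have drop0: "(\<Sum>j=0..n. (if j = 0 then 0 else F j) * G j) = (\<Sum>j=1..n. F j * G j)"
    for F G :: "nat \<Rightarrow> mseries" and n
    by (rule sum.mono_neutral_cong_right) auto
  have "fps_X * fps_deriv A = L * A"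
  proof (rule fps_ext)
    fix n
    have "(\<Sum>j=1..n. psym 1 ^ j * psym 1 ^ (n - j)) = (\<Sum>j=1..n. psym 1 ^ n)"
      by (intro sum.cong refl) (simp flip: power_add)
    then show "fps_nth (fps_X * fps_deriv A) n = fps_nth (L * A) n"
      unfolding fps_nth_X_mult_deriv fps_mult_nth[of L] by (simp add: A_def L_def drop0)
  qed
  moreover have "fps_X * fps_deriv B = K * B"
  proof (rule fps_ext)
    fix n
    have "(\<Sum>j=1..n. ((-1) ^ j * psym j) * ((-1) ^ (n - j) * hsym (n - j)))
        = (-1) ^ n * (\<Sum>j=1..n. psym j * hsym (n - j))"
      unfolding sum_distrib_left
    proof (intro sum.cong refl)
      fix j assume "j \<in> {1..n}"
      then have "(-1 :: mseries) ^ n = (-1) ^ j * (-1) ^ (n - j)"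
        by (simp flip: power_add)
      then show "((-1) ^ j * psym j) * ((-1) ^ (n - j) * hsym (n - j)) = (-1) ^ n * (psym j * hsym (n - j))"
        by (simp add: mult_ac)
    qed
    then have "(\<Sum>j=1..n. ((-1) ^ j * psym j) * ((-1) ^ (n - j) * hsym (n - j)))
        = of_nat n * ((-1) ^ n * hsym n)"
      using newton_hsym[of n] by (metis mult.left_commute)
    then show "fps_nth (fps_X * fps_deriv B) n = fps_nth (K * B) n"
      unfolding fps_nth_X_mult_deriv fps_mult_nth[of K] by (simp add: B_def K_def drop0)
  qed
  ultimately have eq: "fps_X * fps_deriv (A * B) = (L + K) * (A * B)"
    by (rule fps_logderiv_mult)
  have AB: "fps_nth (A * B) n = deranged n" for n
    unfolding deranged_def mult.commute[of A B] fps_mult_nth by (simp add: A_def B_def mult_ac)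
  have "of_nat n * deranged n = fps_nth (fps_X * fps_deriv (A * B)) n"
    by (simp only: AB fps_nth_X_mult_deriv)
  also have "\<dots> = fps_nth ((L + K) * (A * B)) n"
    by (simp only: eq)
  also have "\<dots> = (\<Sum>j=0..n. (if j = 0 then 0 else psym 1 ^ j + (-1) ^ j * psym j) * deranged (n - j))"
    unfolding fps_mult_nth[of "L + K"] AB by (intro sum.cong) (auto simp: L_def K_def)
  finally show ?thesis
    by (simp only: drop0)
qed

lemma deranged_0: "deranged 0 = 1"
  by (simp add: deranged_def)

text \<open>Both sequences start with 1 and satisfy the same recurrence, which determines the term
  at \<open>n \<ge> 1\<close> because the factor \<open>n\<close> can be cancelled.\<close>

lemma Esum_eq_deranged:
  assumes g: "vanishes_below 1 g"
    and L: "\<And>j. j \<ge> 1 \<Longrightarrow>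
      (\<Sum>i=1..j. mscale ((-1) ^ (i - 1) * of_nat j / of_nat i) (degree_part j (psym_plethysm i g)))
        = psym 1 ^ j + (-1) ^ j * psym j"
  shows "Esum g n = deranged n"
proof (induction n rule: less_induct)
  case (less n)
  show ?case
  proof (cases "n = 0")
    case True
    have "degree_part 0 1 = 1"
      by (auto intro!: mseries_eqI simp: mcoeff_degree_part mcoeff_1)
    then show ?thesis
      using True plethysm_esym_0[of g] by (simp add: Esum_def deranged_0)
  next
    case False
    have "of_nat n * Esum g n = of_nat n * deranged n"
      unfolding Esum_recurrence[OF g] deranged_recurrence
      by (intro sum.cong refl) (subst L, use less in auto)
    then show ?thesis
      using False by (simp add: of_nat_mult_mseries mseries_eq_iff)
  qed
qed

lemma formal_sum_eq:
  assumes "finite J" "J \<subseteq> I" "\<And>i. i \<in> I - J \<Longrightarrow> mcoeff (F i) M = 0"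
  shows "mcoeff (formal_sum I F) M = (\<Sum>i\<in>J. mcoeff (F i) M)"
  unfolding formal_sum_def mcoeff_Mseries
  by (rule sum.mono_neutral_left) (use assms in auto)

lemma Delta_eq_Esum:
  assumes g: "vanishes_below 1 Lie2_ge2" and n: "n \<ge> 2"
  shows "Delta n = Esum Lie2_ge2 n"
proof (rule mseries_eqI)
  fix M
  have "mcoeff (Delta n) M = (\<Sum>k=1..n. mcoeff (Delta_part n k) M)"
    using n by (simp add: Delta_def, intro formal_sum_eq)
      (auto simp: Delta_part_def degree_part_vanishes[OF vanishes_below_plethysm_esym[OF g]])
  \<comment> \<open>The added term \<open>k = 0\<close> is the degree \<open>n\<close> part of the
    constant 1, which is 0.\<close>
  also have "\<dots> = (\<Sum>k=0..n. mcoeff (Delta_part n k) M)"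
    using n plethysm_esym_0[of Lie2_ge2]
    by (intro sum.mono_neutral_left) (auto simp: Delta_part_def mcoeff_degree_part mcoeff_1 not_less_eq_eq)
  also have "\<dots> = mcoeff (Esum Lie2_ge2 n) M"
    by (simp add: Esum_def Delta_part_def)
  finally show "mcoeff (Delta n) M = mcoeff (Esum Lie2_ge2 n) M" .
qed


section \<open>The symmetric functions \<open>Lie\<^sub>n\<^sup>(\<^sup>2\<^sup>)\<close>\<close>

definition cycle_prod :: "nat \<Rightarrow> (nat \<Rightarrow> nat) \<Rightarrow> mseries" where
  "cycle_prod n \<sigma> = (\<Prod>C\<in>orbit \<sigma> ` {1..n}. psym (card C))"

lemma orbit_conj:
  assumes "bij \<tau>"
  shows "orbit (\<tau> \<circ> \<sigma> \<circ> inv \<tau>) (\<tau> x) = \<tau> ` orbit \<sigma> x"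
proof -
  have "((\<tau> \<circ> \<sigma> \<circ> inv \<tau>) ^^ k) (\<tau> x) = \<tau> ((\<sigma> ^^ k) x)" for k
    by (induction k) (use assms in \<open>auto simp: bij_is_inj inv_f_f\<close>)
  then show ?thesis
    unfolding orbit_altdef by auto
qed

lemma cycle_prod_conj:
  assumes "\<tau> permutes {1..n}"
  shows "cycle_prod n (\<tau> \<circ> \<sigma> \<circ> inv \<tau>) = cycle_prod n \<sigma>"
proof -
  have bij: "bij \<tau>"
    by (rule permutes_bij[OF assms])
  have "orbit (\<tau> \<circ> \<sigma> \<circ> inv \<tau>) ` \<tau> ` {1..n} = image \<tau> ` (orbit \<sigma> ` {1..n})"
    by (simp add: image_image orbit_conj[OF bij])
  then have "orbit (\<tau> \<circ> \<sigma> \<circ> inv \<tau>) ` {1..n} = image \<tau> ` (orbit \<sigma> ` {1..n})"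
    by (simp only: permutes_image[OF assms])
  moreover have "inj_on (image \<tau>) S" for S
    using bij by (auto intro!: inj_onI simp: inj_image_eq_iff bij_is_inj)
  ultimately show ?thesis
    using bij by (simp add: cycle_prod_def sum.reindex prod.reindex card_image[OF inj_on_subset[OF bij_is_inj]])
qed

lemma long_cycle_permutes: "long_cycle n permutes {1..n}"
proof -
  have "set [1..<Suc n] = {1..n}"
    by auto
  then show ?thesis
    unfolding long_cycle_def using cycle_permutes[of "[1..<Suc n]"] by metis
qed

lemma long_cycle_funpow:
  assumes "i < n"
  shows "(long_cycle n ^^ k) (Suc i) = Suc ((i + k) mod n)"
proof -
  have "map (long_cycle n ^^ k) [1..<Suc n] = rotate k [1..<Suc n]"
    unfolding long_cycle_def by (rule cyclic_rotation) simp
  then have "map (long_cycle n ^^ k) [1..<Suc n] ! i = rotate k [1..<Suc n] ! i"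
    by simp
  then show ?thesis
    using assms by (simp add: nth_rotate nth_append add.commute del: upt_Suc)
qed

lemma long_cycle_funpow_n: "long_cycle n ^^ n = id"
proof
  fix x
  have "(long_cycle n ^^ n) permutes {1..n}"
    by (rule permutes_funpow[OF long_cycle_permutes])
  moreover have "(long_cycle n ^^ n) x = x" if "x \<in> {1..n}"
    using long_cycle_funpow[of "x - 1" n n] that by (cases x) auto
  ultimately show "(long_cycle n ^^ n) x = id x"
    by (cases "x \<in> {1..n}") (auto simp: permutes_not_in)
qed

text \<open>The power moves positions by \<open>j\<close> modulo \<open>n\<close>, so its cycles are
  the residue classes modulo \<open>gcd n j\<close>, each of size
  \<open>n div gcd n j\<close>.\<close>

lemma cycle_prod_long_cycle_power:
  assumes n: "n \<ge> 1"
  shows "cycle_prod n (long_cycle n ^^ j) = psym (n div gcd n j) ^ gcd n j"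
proof -
  define g where "g = gcd n j"
  define d where "d = n div g"
  have gd: "n = g * d"
    by (simp add: g_def d_def)
  have "g dvd j"
    by (simp add: g_def)
  with gd n have g: "g > 0" "n = g * d" "g dvd j" "d > 0"
    by (simp_all add: Suc_le_eq)
  \<comment> \<open>The residue class of \<open>r\<close> modulo \<open>g\<close> in
    \<open>{0..<n}\<close>, shifted by one into \<open>{1..n}\<close>.\<close>
  define cls where "cls r = (\<lambda>k. Suc (r + g * k)) ` {..<d}" for r
  have card_cls: "card (cls r) = d" for r
    unfolding cls_def using g by (subst card_image) (auto simp: inj_on_def)
  have cls_iff: "Suc y \<in> cls r \<longleftrightarrow> y < n \<and> y mod g = r" if "r < g" for r y
  proof
    assume "Suc y \<in> cls r"
    then obtain k where k: "k < d" "y = r + g * k"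
      by (auto simp: cls_def)
    have "g * Suc k \<le> g * d"
      using k(1) by (intro mult_le_mono) auto
    then show "y < n \<and> y mod g = r"
      using that k g by auto
  next
    assume y: "y < n \<and> y mod g = r"
    then have "y div g < d"
      using g by (simp add: less_mult_imp_div_less mult.commute)
    moreover have "y = r + g * (y div g)"
      using y by auto
    ultimately show "Suc y \<in> cls r"
      unfolding cls_def by blast
  qed
  have orb: "orbit (long_cycle n ^^ j) (Suc i) = cls (i mod g)" if i: "i < n" for i
  proof -
    have fp: "((long_cycle n ^^ j) ^^ k) (Suc i) = Suc ((i + j * k) mod n)" for k
      using long_cycle_funpow[OF i, of "j * k"] by (simp add: funpow_mult mult.commute)
    have ig: "i mod g < g"
      using g by simp
    show ?thesis
    proof (intro set_eqI iffI)
      fix x assume "x \<in> orbit (long_cycle n ^^ j) (Suc i)"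
      then obtain k where x: "x = Suc ((i + j * k) mod n)"
        by (auto simp: orbit_altdef fp)
      have "(i + j * k) mod n mod g = (i + j * k) mod g"
        using g by (simp add: mod_mod_cancel)
      also have "\<dots> = i mod g"
        using g(3) by (metis dvd_mult2 mod_add_right_eq dvd_imp_mod_0 add.right_neutral)
      finally show "x \<in> cls (i mod g)"
        using x n by (simp add: cls_iff[OF ig])
    next
      fix x assume x: "x \<in> cls (i mod g)"
      then obtain y where y: "x = Suc y"
        by (auto simp: cls_def)
      then have y': "y < n" "y mod g = i mod g"
        using x cls_iff[OF ig] by auto
      \<comment> \<open>Adding the multiple \<open>n * i\<close> of the modulus keeps the natural
        number difference with \<open>i\<close> from being truncated.\<close>
      have "i \<le> n * i"
        using n by simp
      then have "i \<le> y + n * i"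
        by (rule trans_le_add2)
      moreover have "(y + n * i) mod g = i mod g"
        using g y'(2) by (metis dvd_triv_left dvd_mult2 mod_add_right_eq dvd_imp_mod_0 add.right_neutral)
      ultimately have "g dvd (y + n * i) - i"
        using mod_eq_dvd_iff_nat by blast
      then obtain k where "[j * k = (y + n * i) - i] (mod n)"
        using cong_solve_dvd_nat[of j n] by (auto simp: g_def gcd.commute)
      then have "[i + j * k = y + n * i] (mod n)"
        using \<open>i \<le> y + n * i\<close> by (metis cong_add_lcancel_nat le_add_diff_inverse)
      then have "(i + j * k) mod n = y"
        using y'(1) by (simp add: cong_def)
      \<comment> \<open>Orbits consist of positive iterates, so \<open>k\<close>, which may be 0, is
        enlarged by \<open>n\<close>.\<close>
      then have "(i + j * (k + n)) mod n = y"
        by (simp add: distrib_left flip: add.assoc)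
      then have "((long_cycle n ^^ j) ^^ (k + n)) (Suc i) = x"
        using y by (simp only: fp)
      then show "x \<in> orbit (long_cycle n ^^ j) (Suc i)"
        unfolding orbit_altdef using n by (metis (mono_tags, lifting) add_gr_0 less_le_trans mem_Collect_eq zero_less_one)
    qed
  qed
  have "orbit (long_cycle n ^^ j) ` {1..n} = cls ` {..<g}"
  proof (intro set_eqI iffI)
    fix C assume "C \<in> orbit (long_cycle n ^^ j) ` {1..n}"
    then obtain x where x: "x \<in> {1..n}" "C = orbit (long_cycle n ^^ j) x"
      by auto
    then have "C = cls ((x - 1) mod g)"
      using orb[of "x - 1"] by auto
    then show "C \<in> cls ` {..<g}"
      using g by auto
  next
    fix C assume "C \<in> cls ` {..<g}"
    then obtain r where r: "r < g" "C = cls r"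
      by auto
    then have "r < n"
      using g by (metis less_le_trans mult.right_neutral mult_le_mono2 Suc_leI One_nat_def)
    then have "C = orbit (long_cycle n ^^ j) (Suc r)"
      using r orb[of r] by simp
    then show "C \<in> orbit (long_cycle n ^^ j) ` {1..n}"
      using \<open>r < n\<close> by auto
  qed
  moreover have "inj_on cls {..<g}"
  proof (rule inj_onI)
    fix r s assume rs: "r \<in> {..<g}" "s \<in> {..<g}" "cls r = cls s"
    have "Suc (r + g * 0) \<in> cls r"
      unfolding cls_def using g(4) by blast
    then have "Suc r \<in> cls s"
      using rs(3) by simp
    then show "r = s"
      using rs(1,2) cls_iff[of s r] by simp
  qed
  ultimately show ?thesis
    by (simp add: cycle_prod_def prod.reindex card_cls g_def[symmetric] d_def[symmetric])
qed

section \<open>The character and the Frobenius characteristic of the induced module\<close>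

lemma sum_periodic_shift:
  fixes F :: "nat \<Rightarrow> 'a::ab_group_add"
  assumes "\<And>j. F (j + n) = F j"
  shows "(\<Sum>j<n. F (i + j)) = (\<Sum>j<n. F j)"
proof (induction i)
  case (Suc i)
  have "(\<Sum>j<n. F (Suc i + j)) + F i = (\<Sum>j<Suc n. F (i + j))"
    unfolding sum.lessThan_Suc_shift by simp
  also have "\<dots> = (\<Sum>j<n. F (i + j)) + F i"
    using assms by simp
  finally show ?case
    using Suc by simp
qed simp

text \<open>Averaging over the powers of \<open>c\<close> with weights \<open>z ^ j\<close> is a
  projection \<open>P\<close> of all functions on \<open>S_n\<close> onto the induced module. By
  \<open>space_trace_projection\<close> the trace can then be read off in the basis of unit
  functions. This is the classical formula for an induced character.\<close>

lemma induced_char_formula: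
  assumes \<sigma>: "\<sigma> permutes {1..n}" and c: "c permutes {1..n}" "c ^^ n = id"
    and z: "z ^ n = 1" and n: "n \<ge> 1"
  shows "induced_char n c z \<sigma> = (\<Sum>\<tau> | \<tau> permutes {1..n}. \<Sum>j<n.
    if \<sigma> = \<tau> \<circ> (c ^^ j) \<circ> inv \<tau> then z ^ j / of_nat n else 0)"
proof -
  define X where "X = {\<tau>. \<tau> permutes {1..n}}"
  have X: "finite X"
    unfolding X_def by (rule finite_permutations) simp
  define V where "V = induced_module n c z"
  define P :: "((nat \<Rightarrow> nat) \<Rightarrow> complex) \<Rightarrow> (nat \<Rightarrow> nat) \<Rightarrow> complex"
    where "P f = (\<lambda>\<tau>. \<Sum>j<n. z ^ j / of_nat n * f (\<tau> \<circ> (c ^^ j)))" for f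
  have z0: "z \<noteq> 0"
    using z n by (auto simp: power_0_left)
  have cj: "(\<tau> \<circ> (c ^^ j)) \<in> X \<longleftrightarrow> \<tau> \<in> X" for \<tau> j
  proof
    have cjp: "(c ^^ j) permutes {1..n}"
      by (rule permutes_funpow[OF c(1)])
    show "\<tau> \<in> X \<Longrightarrow> (\<tau> \<circ> (c ^^ j)) \<in> X"
      using permutes_compose[OF cjp] by (simp add: X_def)
    assume "(\<tau> \<circ> (c ^^ j)) \<in> X"
    then have "(\<tau> \<circ> (c ^^ j) \<circ> inv (c ^^ j)) permutes {1..n}"
      using permutes_compose[OF permutes_inv[OF cjp]] by (simp add: X_def)
    then show "\<tau> \<in> X"
      using permutes_inv_o(1)[OF cjp] by (simp add: X_def comp_assoc)
  qed
  have sub_V: "fun_vs.subspace V"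
    by (auto simp: fun_vs.subspace_def V_def induced_module_def fscale_def algebra_simps)
  have V_sup: "V \<subseteq> supported_on X"
    by (auto simp: V_def induced_module_def supported_on_iff X_def)
  have V_span: "V \<subseteq> fun_vs.span (unit_fun ` X)"
    using V_sup span_unit_fun[OF X, where 'k = complex] by simp
  have T: "module_hom fscale fscale (translate \<sigma>)"
    by unfold_locales (auto simp: translate_def fscale_def fun_eq_iff algebra_simps)
  have Phom: "module_hom fscale fscale P"
    by unfold_locales (auto simp: P_def fscale_def fun_eq_iff sum.distrib sum_distrib_left algebra_simps)
  have inv\<sigma>: "inv \<sigma> \<circ> \<tau> \<in> X \<longleftrightarrow> \<tau> \<in> X" for \<tau>
  proof
    show "\<tau> \<in> X \<Longrightarrow> inv \<sigma> \<circ> \<tau> \<in> X"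
      using permutes_compose[OF _ permutes_inv[OF \<sigma>]] by (simp add: X_def)
    assume "inv \<sigma> \<circ> \<tau> \<in> X"
    then have "\<sigma> \<circ> (inv \<sigma> \<circ> \<tau>) permutes {1..n}"
      using permutes_compose[OF _ \<sigma>] by (simp add: X_def)
    then show "\<tau> \<in> X"
      using permutes_inv_o(1)[OF \<sigma>] by (simp add: X_def flip: comp_assoc)
  qed
  have TV: "translate \<sigma> f \<in> V" if "f \<in> V" for f
    using that inv\<sigma> by (auto simp: V_def induced_module_def translate_def X_def simp flip: comp_assoc)
  have TU: "translate \<sigma> f \<in> supported_on X" if "f \<in> supported_on X" for f :: "_ \<Rightarrow> complex"
    using that inv\<sigma> by (auto simp: supported_on_iff translate_def)
  have PU: "P f \<in> V" if f: "f \<in> supported_on X" for f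
    unfolding V_def induced_module_def
  proof (intro CollectI conjI allI impI)
    fix \<tau> assume "\<not> \<tau> permutes {1..n}"
    then have "\<tau> \<circ> (c ^^ j) \<notin> X" for j
      using cj by (simp add: X_def)
    then show "P f \<tau> = 0"
      using f by (auto simp: P_def supported_on_iff)
  next
    fix \<tau> i
    let ?F = "\<lambda>j. z ^ j / of_nat n * f (\<tau> \<circ> (c ^^ j))"
    \<comment> \<open>Passing from \<open>j\<close> to \<open>i + j\<close> extracts the factor
      \<open>inverse (z ^ i)\<close>. Since \<open>z ^ n = 1\<close> and \<open>c ^^ n = id\<close>,
      the terms have period \<open>n\<close>, and the shifted sum over a full period is
      unchanged.\<close>
    have "P f (\<tau> \<circ> (c ^^ i)) = (\<Sum>j<n. inverse (z ^ i) * ?F (i + j))"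
    proof -
      have "inverse (z ^ i) * ?F (i + j) = z ^ j / of_nat n * f (\<tau> \<circ> (c ^^ i) \<circ> (c ^^ j))" for j
        using z0 by (simp add: funpow_add o_assoc power_add)
      then show ?thesis
        by (simp only: P_def)
    qed
    also have "\<dots> = inverse (z ^ i) * (\<Sum>j<n. ?F (i + j))"
      by (simp add: sum_distrib_left)
    also have "(\<Sum>j<n. ?F (i + j)) = (\<Sum>j<n. ?F j)"
      by (rule sum_periodic_shift) (simp add: power_add z funpow_add c(2))
    finally show "P f (\<tau> \<circ> (c ^^ i)) = inverse (z ^ i) * P f \<tau>"
      by (simp only: P_def)
  qed
  have PV: "P f = f" if f: "f \<in> V" for f
  proof
    fix \<tau>
    show "P f \<tau> = f \<tau>"
    proof (cases "\<tau> \<in> X")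
      case True
      have "z ^ j * f (\<tau> \<circ> (c ^^ j)) = f \<tau>" for j
        using f True z0 by (simp add: V_def induced_module_def X_def)
      then have "P f \<tau> = (\<Sum>j<n. f \<tau> / of_nat n)"
        by (simp add: P_def)
      then show ?thesis
        using n by simp
    next
      case False
      then show ?thesis
        using f PU[of f] V_sup by (metis (no_types, lifting) subsetD supported_on_iff)
    qed
  qed
  have "induced_char n c z \<sigma> = fun_tr.space_trace V (translate \<sigma>) - fun_tr.space_trace {0} (translate \<sigma>)"
    unfolding induced_char_def subspace_trace_def V_def[symmetric]
    by (rule quotient_trace_eq[OF sub_V fun_vs.subspace_single_0 _ V_span])
       (use X T TV fun_vs.subspace_0[OF sub_V] in \<open>auto simp: module_hom.zero\<close>)
  also have "\<dots> = fun_tr.space_trace (supported_on X) (\<lambda>f. translate \<sigma> (P f))"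
    unfolding space_trace_zero[OF T]
    using fun_tr.space_trace_projection[OF sub_V subspace_supported_on V_sup _ _ T Phom TV PU PV,
        of "unit_fun ` X"] X span_unit_fun[OF X, where 'k = complex] by simp
  also have "\<dots> = (\<Sum>\<tau>\<in>X. translate \<sigma> (P (unit_fun \<tau>)) \<tau>)"
    by (rule space_trace_supported_on[OF X])
       (use module_hom_compose[OF Phom T] PU TU V_sup in \<open>auto simp: o_def\<close>)
  also have "\<dots> = (\<Sum>\<tau>\<in>X. \<Sum>j<n. if \<sigma> = \<tau> \<circ> (c ^^ j) \<circ> inv \<tau> then z ^ j / of_nat n else 0)"
  proof (intro sum.cong refl)
    fix \<tau> assume "\<tau> \<in> X"
    then have \<tau>: "\<tau> permutes {1..n}"
      by (simp add: X_def)
    have "inv \<sigma> \<circ> \<tau> \<circ> (c ^^ j) = \<tau> \<longleftrightarrow> \<sigma> = \<tau> \<circ> (c ^^ j) \<circ> inv \<tau>" for j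
    proof
      assume "inv \<sigma> \<circ> \<tau> \<circ> (c ^^ j) = \<tau>"
      then have "\<sigma> \<circ> (inv \<sigma> \<circ> \<tau> \<circ> (c ^^ j)) \<circ> inv \<tau> = \<sigma> \<circ> \<tau> \<circ> inv \<tau>"
        by simp
      then show "\<sigma> = \<tau> \<circ> (c ^^ j) \<circ> inv \<tau>"
        using permutes_inv_o(1)[OF \<sigma>] permutes_inv_o(1)[OF \<tau>]
        by (metis comp_assoc comp_id id_comp)
    next
      assume "\<sigma> = \<tau> \<circ> (c ^^ j) \<circ> inv \<tau>"
      then have "\<sigma> \<circ> \<tau> = \<tau> \<circ> (c ^^ j)"
        using permutes_inv_o(2)[OF \<tau>] by (metis comp_assoc comp_id)
      then show "inv \<sigma> \<circ> \<tau> \<circ> (c ^^ j) = \<tau>"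
        using permutes_inv_o(2)[OF \<sigma>] by (metis comp_assoc id_comp)
    qed
    then show "translate \<sigma> (P (unit_fun \<tau>)) \<tau> =
        (\<Sum>j<n. if \<sigma> = \<tau> \<circ> (c ^^ j) \<circ> inv \<tau> then z ^ j / of_nat n else 0)"
      by (auto simp: translate_def P_def unit_fun_def intro!: sum.cong)
  qed
  finally show ?thesis
    by (simp add: X_def)
qed

text \<open>Conjugates have the same cycle type, so after the exchange of sums every
  \<open>tau\<close> contributes the same amount, and these \<open>n!\<close> contributions cancel
  the normalisation.\<close>

lemma frobenius_char_induced:
  assumes n: "n \<ge> 1" and z: "z ^ n = 1"
  shows "frobenius_char n (induced_char n (long_cycle n) z) =
    (\<Sum>j<n. mscale (z ^ j / of_nat n) (psym (n div gcd n j) ^ gcd n j))"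
proof -
  let ?X = "{\<tau>. \<tau> permutes {1..n}}" and ?c = "long_cycle n"
  have X: "finite ?X" "card ?X = fact n"
    using finite_permutations[of "{1..n}"] card_permutations[of "{1..n}" n] by auto
  have "(\<Sum>\<sigma>\<in>?X. mscale (induced_char n ?c z \<sigma>) (cycle_prod n \<sigma>)) =
      (\<Sum>\<sigma>\<in>?X. \<Sum>\<tau>\<in>?X. \<Sum>j<n. if \<sigma> = \<tau> \<circ> (?c ^^ j) \<circ> inv \<tau>
        then mscale (z ^ j / of_nat n) (cycle_prod n \<sigma>) else 0)"
  proof (intro sum.cong refl)
    fix \<sigma> assume "\<sigma> \<in> ?X"
    then show "mscale (induced_char n ?c z \<sigma>) (cycle_prod n \<sigma>) =
      (\<Sum>\<tau>\<in>?X. \<Sum>j<n. if \<sigma> = \<tau> \<circ> (?c ^^ j) \<circ> inv \<tau>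
        then mscale (z ^ j / of_nat n) (cycle_prod n \<sigma>) else 0)"
      using induced_char_formula[OF _ long_cycle_permutes long_cycle_funpow_n z n, of \<sigma>]
      by (auto simp: mscale_sum_left intro!: sum.cong)
  qed
  also have "\<dots> = (\<Sum>\<tau>\<in>?X. \<Sum>\<sigma>\<in>?X. \<Sum>j<n. if \<sigma> = \<tau> \<circ> (?c ^^ j) \<circ> inv \<tau>
        then mscale (z ^ j / of_nat n) (cycle_prod n \<sigma>) else 0)"
    by (rule sum.swap)
  also have "\<dots> = (\<Sum>\<tau>\<in>?X. \<Sum>j<n. \<Sum>\<sigma>\<in>?X. if \<sigma> = \<tau> \<circ> (?c ^^ j) \<circ> inv \<tau>
        then mscale (z ^ j / of_nat n) (cycle_prod n \<sigma>) else 0)"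
    by (rule sum.cong[OF refl]) (rule sum.swap)
  also have "\<dots> = (\<Sum>\<tau>\<in>?X. \<Sum>j<n. mscale (z ^ j / of_nat n) (psym (n div gcd n j) ^ gcd n j))"
  proof (intro sum.cong refl)
    fix \<tau> j assume "\<tau> \<in> ?X"
    then have \<tau>: "\<tau> permutes {1..n}" by simp
    have "(\<tau> \<circ> (?c ^^ j) \<circ> inv \<tau>) \<in> ?X"
      using permutes_compose[OF permutes_compose[OF permutes_inv[OF \<tau>] permutes_funpow[OF long_cycle_permutes]] \<tau>]
      by (simp add: comp_assoc)
    then show "(\<Sum>\<sigma>\<in>?X. if \<sigma> = \<tau> \<circ> (?c ^^ j) \<circ> inv \<tau>
        then mscale (z ^ j / of_nat n) (cycle_prod n \<sigma>) else 0)
        = mscale (z ^ j / of_nat n) (psym (n div gcd n j) ^ gcd n j)"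
      using X(1) by (simp only: sum.delta' sum.delta if_True
          cycle_prod_conj[OF \<tau>] cycle_prod_long_cycle_power[OF n])
  qed
  also have "\<dots> = mscale (fact n) (\<Sum>j<n. mscale (z ^ j / of_nat n) (psym (n div gcd n j) ^ gcd n j))"
    using X(2) by (simp add: of_nat_mult_mseries)
  finally show ?thesis
    unfolding frobenius_char_def cycle_prod_def[symmetric] by simp
qed

section \<open>Divisor sums of the inducing characters\<close>

definition Lie2_root :: "nat \<Rightarrow> complex" where
  "Lie2_root n = exp (2 * complex_of_real pi * \<i> / of_nat n * 2 ^ multiplicity 2 n)"

lemma Lie2_root_cis: "Lie2_root n = cis (2 * pi * real (2 ^ multiplicity 2 n) / real n)"
  unfolding Lie2_root_def cis_conv_exp by (rule arg_cong[of _ _ exp]) simp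

lemma Lie2_root_power: "Lie2_root n ^ k = cis (2 * pi * real (k * 2 ^ multiplicity 2 n) / real n)"
  unfolding Lie2_root_cis DeMoivre by (rule arg_cong[of _ _ cis]) simp

lemma cis_root_of_unity_eq_1:
  assumes "N > 0"
  shows "cis (2 * pi * real q / real N) = 1 \<longleftrightarrow> N dvd q"
proof -
  have "real q = real N * real (q div N) + real (q mod N)"
    by (metis mult_div_mod_eq of_nat_add of_nat_mult)
  then have "real q / real N = real (q div N) + real (q mod N) / real N"
    using assms by (simp add: field_simps)
  then have "2 * pi * real q / real N = 2 * pi * real (q div N) + 2 * pi * real (q mod N) / real N"
    by (metis distrib_left times_divide_eq_right)
  then have red: "cis (2 * pi * real q / real N) = cis (2 * pi * real (q mod N) / real N)"
    by (simp add: cis_mult[symmetric])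
  have "cis (2 * pi * real (q mod N) / real N) = cis (2 * pi * real 0 / real N) \<longleftrightarrow> q mod N = 0"
    using inj_on_eq_iff[OF bij_betw_imp_inj_on[OF bij_betw_roots_unity[OF assms]], of "q mod N" 0] assms
    by simp
  then show ?thesis
    unfolding red by (simp add: dvd_eq_mod_eq_0)
qed

text \<open>The sum of the inducing character over the elements of order \<open>d\<close> of the
  cyclic group of order \<open>m\<close>. For a faithful character and \<open>d\<close> dividing
  \<open>m\<close> it would be the Moebius function of \<open>d\<close>.\<close>

definition psi :: "nat \<Rightarrow> nat \<Rightarrow> complex" where
  "psi m d = (\<Sum>j | j < m \<and> m div gcd m j = d. Lie2_root m ^ j)"

lemma div_gcd_dvd: "n div gcd n j dvd n" for n j :: nat
  by (metis dvd_div_mult_self dvd_triv_left gcd_dvd1)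

text \<open>Groups the powers of the long cycle by their order \<open>n div gcd n j\<close>, which
  also determines their cycle type.\<close>

lemma Lie2_eq:
  assumes n: "n \<ge> 1"
  shows "Lie2 n = (\<Sum>d | d dvd n. mscale (psi n d / of_nat n) (psym d ^ (n div d)))"
proof -
  have "Lie2_root n ^ n = 1"
    unfolding Lie2_root_power using n cis_root_of_unity_eq_1[of n "n * 2 ^ multiplicity 2 n"] by simp
  then have "Lie2 n = (\<Sum>j<n. mscale (Lie2_root n ^ j / of_nat n) (psym (n div gcd n j) ^ gcd n j))"
    unfolding Lie2_def Lie2_root_def[symmetric] by (rule frobenius_char_induced[OF n])
  also have "\<dots> = (\<Sum>d | d dvd n. \<Sum>j | j \<in> {..<n} \<and> n div gcd n j = d.
      mscale (Lie2_root n ^ j / of_nat n) (psym (n div gcd n j) ^ gcd n j))"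
    using n by (intro sum.group[symmetric]) (auto simp: div_gcd_dvd)
  also have "\<dots> = (\<Sum>d | d dvd n. mscale (psi n d / of_nat n) (psym d ^ (n div d)))"
    unfolding psi_def sum_divide_distrib mscale_sum_left
  proof (intro sum.cong refl)
    fix d j assume "j \<in> {j. j < n \<and> n div gcd n j = d}"
    then have "n = d * gcd n j"
      by auto
    then have "gcd n j = n div d"
      using n by (metis mult_0 nonzero_mult_div_cancel_left not_one_le_zero)
    then show "mscale (Lie2_root n ^ j / of_nat n) (psym (n div gcd n j) ^ gcd n j) =
        mscale (Lie2_root n ^ j / of_nat n) (psym d ^ (n div d))"
      using \<open>j \<in> _\<close> by simp
  qed auto
  finally show ?thesis .
qed

text \<open>The divisor sum of \<open>psi\<close> (\<open>sum_psi\<close>), a function of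
  \<open>N\<close> alone. It doubles from \<open>M\<close> to \<open>2 * M\<close> for
  \<open>M \<ge> 1\<close> and vanishes at odd numbers other than 1.\<close>

definition pow2_weight :: "nat \<Rightarrow> complex" where
  "pow2_weight N = (if \<exists>a. N = 2 ^ a then of_nat N else 0)"

text \<open>The elements of order dividing \<open>N\<close> form the subgroup of order
  \<open>N\<close>, on whose generator the character takes the value \<open>w\<close>. Here
  \<open>w = 1\<close> exactly if \<open>N\<close> divides \<open>2 ^ multiplicity 2 m\<close>,
  which for \<open>N dvd m\<close> means that \<open>N\<close> is a power of 2; otherwise the
  geometric sum over the subgroup vanishes.\<close>

lemma sum_psi:
  assumes m: "m \<ge> 1" and N: "N dvd m"
  shows "(\<Sum>d | d dvd N. psi m d) = pow2_weight N"
proof -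
  obtain q where q: "m = N * q"
    using N by auto
  have pos: "N > 0" "q > 0"
    using q m by (auto intro: Nat.gr0I)
  have dvd_iff: "m div gcd m j dvd N \<longleftrightarrow> q dvd j" for j
  proof -
    have "m div gcd m j dvd N \<longleftrightarrow> N * q dvd N * gcd m j"
      using m q by (metis dvd_div_iff_mult dvd_div_mult_self gcd_dvd1 gcd_eq_0_iff
          div_dvd_iff_mult mult.commute not_one_le_zero)
    also have "\<dots> \<longleftrightarrow> q dvd j"
      using pos q by auto
    finally show ?thesis .
  qed
  define w where "w = Lie2_root m ^ q"
  have w: "w = cis (2 * pi * real (2 ^ multiplicity 2 m) / real N)"
    unfolding w_def Lie2_root_power using pos by (simp add: q field_simps)
  have "(\<Sum>d | d dvd N. psi m d) = (\<Sum>d | d dvd N. \<Sum>j | j \<in> {j. j < m \<and> q dvd j} \<and> m div gcd m j = d. Lie2_root m ^ j)"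
    unfolding psi_def by (intro sum.cong refl) (auto simp flip: dvd_iff)
  also have "\<dots> = (\<Sum>j | j < m \<and> q dvd j. Lie2_root m ^ j)"
    using pos dvd_iff by (intro sum.group) auto
  also have "\<dots> = (\<Sum>v<N. Lie2_root m ^ (q * v))"
    using pos by (intro sum.reindex_bij_witness[of _ "\<lambda>v. q * v" "\<lambda>j. j div q"]) (auto simp: q mult.commute less_mult_imp_div_less)
  also have "\<dots> = (\<Sum>v<N. w ^ v)"
    by (simp add: w_def power_mult)
  also have "\<dots> = pow2_weight N"
  proof (cases "N dvd 2 ^ multiplicity 2 m")
    case True
    then have "\<exists>a. N = 2 ^ a"
      using divides_primepow_nat[of 2 N] by auto
    moreover have "w = 1"
      unfolding w using True cis_root_of_unity_eq_1[OF pos(1)] by blast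
    ultimately show ?thesis
      by (simp add: pow2_weight_def)
  next
    case False
    have "\<nexists>a. N = 2 ^ a"
    proof
      assume "\<exists>a. N = 2 ^ a"
      then obtain a where a: "N = 2 ^ a" ..
      then have "a \<le> multiplicity 2 m"
        using N m by (intro multiplicity_geI) auto
      then show False
        using False a by (simp add: le_imp_power_dvd)
    qed
    moreover have "w \<noteq> 1"
      unfolding w using False cis_root_of_unity_eq_1[OF pos(1)] by blast
    moreover have "w ^ N = 1"
      unfolding w DeMoivre using pos cis_root_of_unity_eq_1[of N "N * 2 ^ multiplicity 2 m"]
      by (simp add: mult_ac)
    ultimately show ?thesis
      by (simp add: pow2_weight_def geometric_sum)
  qed
  finally show ?thesis .
qed

text \<open>Inversion over divisors: by \<open>sum_psi\<close> the divisor sums up to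
  \<open>d\<close> agree, and by induction so do the terms at proper divisors.\<close>

lemma psi_independent:
  assumes "m \<ge> 1" "d dvd m"
  shows "psi m d = psi d d"
  using assms
proof (induction d arbitrary: m rule: less_induct)
  case (less d)
  have d: "d \<ge> 1"
    using less.prems by (metis One_nat_def Suc_leI dvd_0_left_iff not_gr0 not_one_le_zero)
  then have D: "finite {e. e dvd d}" "d \<in> {e. e dvd d}"
    by auto
  have "(\<Sum>e | e dvd d. psi m e) = (\<Sum>e | e dvd d. psi d e)"
    using sum_psi[OF less.prems] sum_psi[OF d dvd_refl] by simp
  moreover have "(\<Sum>e\<in>{e. e dvd d} - {d}. psi m e) = (\<Sum>e\<in>{e. e dvd d} - {d}. psi d e)"
  proof (intro sum.cong refl)
    fix e assume e: "e \<in> {e. e dvd d} - {d}"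
    then have "e < d" "e dvd d"
      using d by (auto dest: dvd_imp_le)
    then show "psi m e = psi d e"
      using less.IH[of e m] less.IH[of e d] less.prems d by (metis dvd_trans)
  qed
  ultimately show ?case
    using sum.remove[OF D, of "psi m"] sum.remove[OF D, of "psi d"] by simp
qed

text \<open>The sign is 1 minus twice the indicator of an even cofactor, and the divisors of
  \<open>N\<close> with even cofactor are the divisors of \<open>N / 2\<close>. The sum thus becomes
  \<open>w(N) - 2 w(N / 2)\<close> for even \<open>N\<close> and \<open>w(N)\<close> for odd
  \<open>N\<close>, where \<open>w\<close> is \<open>pow2_weight\<close>.\<close>

lemma alternating_sum_psi:
  assumes N: "N \<ge> 1"
  shows "(\<Sum>d | d dvd N. (-1) ^ (N div d - 1) * psi d d) = (if N = 1 then 1 else 0)"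
proof -
  have sum: "(\<Sum>d | d dvd M. psi d d) = pow2_weight M" if "M \<ge> 1" for M
    using sum_psi[OF that dvd_refl] psi_independent[OF that] by simp
  have fin: "finite {d. d dvd N}"
    using N by simp
  have sign: "(-1) ^ (N div d - 1) = (1 :: complex) - (if even (N div d) then 2 else 0)"
    if "d dvd N" for d
  proof -
    have "N div d \<ge> 1"
      using that N by (auto elim!: dvdE simp: Suc_le_eq)
    then show ?thesis by (cases "N div d") auto
  qed
  have "(\<Sum>d | d dvd N. (-1) ^ (N div d - 1) * psi d d) =
      (\<Sum>d | d dvd N. psi d d - (if even (N div d) then 2 * psi d d else 0))"
    by (intro sum.cong refl, subst sign) (auto simp: algebra_simps)
  also have "\<dots> = pow2_weight N - (\<Sum>d\<in>{d \<in> {d. d dvd N}. even (N div d)}. 2 * psi d d)"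
    unfolding sum_subtractf sum[OF N] sum.inter_filter[OF fin] ..
  also have "\<dots> = (if N = 1 then 1 else 0)"
  proof (cases "even N")
    case True
    then obtain M where M: "N = 2 * M" by auto
    have "{d \<in> {d. d dvd N}. even (N div d)} = {d. d dvd M}"
    proof (intro set_eqI iffI)
      fix d assume "d \<in> {d \<in> {d. d dvd N}. even (N div d)}"
      then obtain q where "N = d * (2 * q)"
        by (metis (no_types, lifting) dvdE dvd_mult_div_cancel mem_Collect_eq)
      then show "d \<in> {d. d dvd M}"
        using M by auto
    next
      fix d assume "d \<in> {d. d dvd M}"
      then obtain q where "M = d * q" by auto
      then show "d \<in> {d \<in> {d. d dvd N}. even (N div d)}"
        using M N by auto
    qed
    then have "(\<Sum>d\<in>{d \<in> {d. d dvd N}. even (N div d)}. 2 * psi d d) = 2 * pow2_weight M"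
      using sum[of M] M N by (simp flip: sum_distrib_left)
    moreover have "(\<exists>a. N = 2 ^ a) \<longleftrightarrow> (\<exists>a. M = 2 ^ a)"
    proof
      assume "\<exists>a. N = 2 ^ a"
      then obtain a where a: "N = 2 ^ a" ..
      with True have "a > 0" by (cases a) auto
      then have "M = 2 ^ (a - 1)"
        using a M by (cases a) auto
      then show "\<exists>a. M = 2 ^ a" ..
    next
      assume "\<exists>a. M = 2 ^ a"
      then obtain a where "M = 2 ^ a" ..
      then have "N = 2 ^ Suc a"
        using M by simp
      then show "\<exists>a. N = 2 ^ a" ..
    qed
    ultimately show ?thesis
      using M by (simp add: pow2_weight_def)
  next
    case False
    then have "{d \<in> {d. d dvd N}. even (N div d)} = {}"
      by (auto dest: div_dvd_iff_mult) (metis dvd_div_mult_self dvd_mult2)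
    then have "(\<Sum>d\<in>{d \<in> {d. d dvd N}. even (N div d)}. 2 * psi d d) = 0"
      by (simp only: sum.empty)
    moreover have "(\<exists>a. N = 2 ^ a) \<longleftrightarrow> N = 1"
      using False by (metis even_power dvd_refl neq0_conv power_0)
    ultimately show ?thesis
      by (simp only: pow2_weight_def) simp
  qed
  finally show ?thesis .
qed

section \<open>The logarithmic derivative for \<open>Lie2_ge2\<close>\<close>

lemma degree_part_psym_power:
  "degree_part m (psym d ^ k) = (if m = d * k then psym d ^ k else 0)"
proof -
  have hom: "size M = d * k" if "mcoeff (psym d ^ k) M \<noteq> 0" for M
    using that
  proof (induction k arbitrary: M)
    case 0
    then show ?case by (auto simp: mcoeff_1 split: if_splits)
  next
    case (Suc k)
    then have "(\<Sum>p\<in>msplits M. mcoeff (psym d) (fst p) * mcoeff (psym d ^ k) (snd p)) \<noteq> 0"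
      by (simp add: mcoeff_times case_prod_unfold)
    then obtain p where "p \<in> msplits M" "mcoeff (psym d) (fst p) * mcoeff (psym d ^ k) (snd p) \<noteq> 0"
      by (rule sum.not_neutral_contains_not_neutral)
    then show ?case
      using Suc.IH[of "snd p"] by (auto simp: msplits_def mcoeff_psym split: if_splits)
  qed
  show ?thesis
    by (rule mseries_eqI) (use hom in \<open>auto simp: mcoeff_degree_part\<close>)
qed

lemma degree_part_Lie2:
  assumes "n \<ge> 1"
  shows "degree_part m (Lie2 n) = (if m = n then Lie2 n else 0)"
  unfolding Lie2_eq[OF assms] degree_part_sum degree_part_mscale degree_part_psym_power
  by (auto intro!: sum.cong)

lemma degree_part_Lie2_ge2: "degree_part m Lie2_ge2 = (if m \<ge> 2 then Lie2 m else 0)"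
proof (rule mseries_eqI)
  fix M
  have hom: "mcoeff (Lie2 n) M = 0" if "n \<ge> 1" "size M \<noteq> n" for n
    using arg_cong[OF degree_part_Lie2[of n "size M"], of "\<lambda>f. mcoeff f M"] that
    by (simp add: mcoeff_degree_part)
  have "mcoeff Lie2_ge2 M = (\<Sum>i\<in>{size M} \<inter> {2..}. mcoeff (Lie2 i) M)"
    unfolding Lie2_ge2_def by (rule formal_sum_eq) (auto intro!: hom)
  then show "mcoeff (degree_part m Lie2_ge2) M = mcoeff (if m \<ge> 2 then Lie2 m else 0) M"
    using hom[of m] by (auto simp: mcoeff_degree_part)
qed

lemma vanishes_below_Lie2_ge2: "vanishes_below 1 Lie2_ge2"
  unfolding vanishes_below_def
  using arg_cong[OF degree_part_Lie2_ge2[of 0], of "\<lambda>f. mcoeff f {#}"]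
  by (auto simp: mcoeff_degree_part)

lemma Lie2_1: "Lie2 1 = psym 1"
  by (simp add: Lie2_eq psi_def)

lemma psym_plethysm_Lie2:
  assumes "i \<ge> 1" "n \<ge> 1"
  shows "mscale (of_nat n) (psym_plethysm i (Lie2 n)) =
    (\<Sum>d | d dvd n. mscale (psi d d) (psym (i * d) ^ (n div d)))"
  using assms by (simp add: Lie2_eq psym_plethysm_sum psym_plethysm_mscale psym_plethysm_power
      psym_plethysm_psym mscale_sum_right psi_independent)

text \<open>With \<open>Lie2 1 = p_1\<close> restored, the terms collect by \<open>K = i * d\<close>
  and \<open>alternating_sum_psi\<close> leaves only \<open>p_1^j\<close>. The restored part affects
  only \<open>i = j\<close>, where it is subtracted again as a signed \<open>p_j\<close>.\<close>

lemma Lie2_ge2_logderiv: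
  assumes j: "j \<ge> 1"
  shows "(\<Sum>i=1..j. mscale ((-1) ^ (i - 1) * of_nat j / of_nat i) (degree_part j (psym_plethysm i Lie2_ge2)))
    = psym 1 ^ j + (-1) ^ j * psym j"
proof -
  let ?s = "\<lambda>i. (-1) ^ (i - 1) :: complex"
  have fin: "finite {i. i dvd j}"
    using j by simp
  have summand: "mscale (?s i * of_nat j / of_nat i) (degree_part j (psym_plethysm i Lie2_ge2)) =
     (\<Sum>d | d dvd j div i. mscale (?s i * psi d d) (psym (i * d) ^ (j div (i * d))))
       - (if i = j then mscale (?s j) (psym j) else 0)" if i: "i dvd j" for i
  proof -
    obtain n where n: "j = i * n"
      using i by auto
    with j have pos: "i \<ge> 1" "n \<ge> 1"
      by (auto simp: Suc_le_eq)
    have dp: "degree_part n Lie2_ge2 = Lie2 n - (if n = 1 then psym 1 else 0)"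
      using pos(2) Lie2_1 by (cases "n = 1") (auto simp: degree_part_Lie2_ge2)
    have "mscale (?s i * of_nat j / of_nat i) (degree_part j (psym_plethysm i Lie2_ge2)) =
      mscale (?s i) (mscale (of_nat n) (psym_plethysm i (Lie2 n - (if n = 1 then psym 1 else 0))))"
      using pos n by (simp add: degree_part_psym_plethysm dp)
    also have "\<dots> = mscale (?s i) (mscale (of_nat n) (psym_plethysm i (Lie2 n)))
        - (if i = j then mscale (?s j) (psym j) else 0)"
      using pos n psym_plethysm_sum[of i "\<lambda>_. 0" "{}"]
      by (auto simp: psym_plethysm_diff mscale_diff_right psym_plethysm_psym)
    also have "mscale (?s i) (mscale (of_nat n) (psym_plethysm i (Lie2 n))) =
        (\<Sum>d | d dvd j div i. mscale (?s i * psi d d) (psym (i * d) ^ (j div (i * d))))"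
      unfolding psym_plethysm_Lie2[OF pos] using pos n by (simp add: mscale_sum_right div_mult2_eq)
    finally show ?thesis .
  qed
  have "(\<Sum>i=1..j. mscale (?s i * of_nat j / of_nat i) (degree_part j (psym_plethysm i Lie2_ge2))) =
      (\<Sum>i | i dvd j. mscale (?s i * of_nat j / of_nat i) (degree_part j (psym_plethysm i Lie2_ge2)))"
    using j by (intro sum.mono_neutral_right)
      (auto simp: degree_part_psym_plethysm dest: dvd_imp_le intro: Nat.gr0I simp: Suc_le_eq)
  also have "\<dots> = (\<Sum>i | i dvd j. \<Sum>d | d dvd j div i. mscale (?s i * psi d d) (psym (i * d) ^ (j div (i * d))))
      - (\<Sum>i | i dvd j. if i = j then mscale (?s j) (psym j) else 0)"
    unfolding sum_subtractf[symmetric] by (rule sum.cong[OF refl]) (rule summand, simp)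
  also have "(\<Sum>i | i dvd j. if i = j then mscale (?s j) (psym j) else 0) = mscale (?s j) (psym j)"
    using fin by (simp add: sum.delta')
  \<comment> \<open>Reindexing by \<open>K = i * d\<close>: the power of \<open>p_K\<close> depends
    on \<open>K\<close> only, so for fixed \<open>K\<close> just the scalars are summed.\<close>
  also have "(\<Sum>i | i dvd j. \<Sum>d | d dvd j div i. mscale (?s i * psi d d) (psym (i * d) ^ (j div (i * d)))) =
      (\<Sum>K | K dvd j. \<Sum>d | d dvd K. mscale (?s (K div d) * psi d d) (psym K ^ (j div K)))"
  proof -
    have "finite {d. d dvd j div i}" if "i dvd j" for i
      using j that by (intro finite_divisors_nat) (auto elim!: dvdE)
    moreover have "finite {d. d dvd K}" if "K dvd j" for K
      using j that by (intro finite_divisors_nat) (auto dest: dvd_pos_nat[rotated])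
    ultimately show ?thesis
      using fin
    proof (subst (1 2) sum.Sigma, simp_all, intro sum.reindex_bij_witness
        [of _ "\<lambda>(K, d). (K div d, d)" "\<lambda>(i, d). (i * d, d)"], goal_cases)
      case (1 a)
      then show ?case using j by (auto elim!: dvdE)
    next
      case (2 a)
      then show ?case using j by (auto elim!: dvdE)
    next
      case (3 b)
      then show ?case by (auto)
    next
      case (4 b)
      then show ?case using j by (auto elim!: dvdE)
    next
      case (5 a)
      then show ?case using j by (auto elim!: dvdE)
    qed
  qed
  also have "\<dots> = (\<Sum>K | K dvd j. mscale (if K = 1 then 1 else 0) (psym K ^ (j div K)))"
  proof (intro sum.cong refl)
    fix K assume "K \<in> {K. K dvd j}"
    then have "K \<ge> 1"
      using j by (auto simp: Suc_le_eq intro: Nat.gr0I)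
    from alternating_sum_psi[OF this]
    show "(\<Sum>d | d dvd K. mscale (?s (K div d) * psi d d) (psym K ^ (j div K))) =
        mscale (if K = 1 then 1 else 0) (psym K ^ (j div K))"
      by (simp only: mscale_sum_left[symmetric])
  qed
  also have "\<dots> = (\<Sum>K | K dvd j. if K = 1 then psym 1 ^ j else 0)"
    by (intro sum.cong) auto
  also have "\<dots> = psym 1 ^ j"
    using fin by (simp add: sum.delta)
  also have "psym 1 ^ j - mscale (?s j) (psym j) = psym 1 ^ j + (-1) ^ j * psym j"
    using j by (cases j) (simp_all add: minus_one_power_mult_mseries mscale_minus_left)
  finally show ?thesis .
qed

lemma Delta_eq_deranged:
  assumes "n \<ge> 2"
  shows "Delta n = deranged n"
  using Delta_eq_Esum[OF vanishes_below_Lie2_ge2 assms]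
    Esum_eq_deranged[OF vanishes_below_Lie2_ge2 Lie2_ge2_logderiv] by simp


section \<open>Exactness of the complex of injective words\<close>

text \<open>
  The coefficient of \<open>v\<close> in the boundary of \<open>f\<close>, as the signed sum of \<open>f\<close> over all insertions of a
  letter of \<open>A\<close> into \<open>v\<close>.
\<close>

primrec bd :: "nat set \<Rightarrow> nat list \<Rightarrow> (nat list \<Rightarrow> rat) \<Rightarrow> rat" where
  "bd A [] = (\<lambda>f. \<Sum>x\<in>A. f [x])"
| "bd A (y # v) = (\<lambda>f. (\<Sum>x\<in>A. f (x # y # v)) - bd A v (\<lambda>w. f (y # w)))"

text \<open>The spaces \<open>word_chains\<close> over an arbitrary alphabet, since the exactness
  proof shrinks the alphabet.\<close>

definition chains :: "nat set \<Rightarrow> nat \<Rightarrow> (nat list \<Rightarrow> rat) set" where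
  "chains A m = {f. \<forall>w. f w \<noteq> 0 \<longrightarrow> distinct w \<and> set w \<subseteq> A \<and> length w = m}"

lemma bd_add: "bd A v (\<lambda>w. f w + g w) = bd A v f + bd A v g"
  by (induction v arbitrary: f g) (simp_all add: sum.distrib)

lemma bd_scale: "bd A v (\<lambda>w. c * f w) = c * bd A v f"
  by (induction v arbitrary: f) (simp_all add: sum_distrib_left right_diff_distrib)

lemma bd_zero [simp]: "bd A v (\<lambda>w. 0) = 0"
  by (induction v) simp_all

lemma bd_diff: "bd A v (\<lambda>w. f w - g w) = bd A v f - bd A v g"
  by (induction v arbitrary: f g) (simp_all add: sum_subtractf)

lemma bd_sum: "bd A v (\<lambda>w. \<Sum>x\<in>X. F x w) = (\<Sum>x\<in>X. bd A v (F x))"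
  by (induction X rule: infinite_finite_induct) (simp_all add: bd_add)

lemma bd_eq_sum: "bd A v f = (\<Sum>i\<le>length v. (-1) ^ i * (\<Sum>x\<in>A. f (take i v @ x # drop i v)))"
proof (induction v arbitrary: f)
  case (Cons y v)
  show ?case
    by (simp add: Cons sum.atMost_Suc_shift sum_negf del: sum.atMost_Suc)
qed simp

lemma bd_nonzero:
  assumes "bd A v f \<noteq> 0"
  obtains i x where "i \<le> length v" "x \<in> A" "f (take i v @ x # drop i v) \<noteq> 0"
proof -
  obtain i where i: "i \<le> length v" "(-1) ^ i * (\<Sum>x\<in>A. f (take i v @ x # drop i v)) \<noteq> 0"
    using assms unfolding bd_eq_sum by (meson atMost_iff sum.not_neutral_contains_not_neutral)
  then have "(\<Sum>x\<in>A. f (take i v @ x # drop i v)) \<noteq> 0"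
    by auto
  then obtain x where "x \<in> A" "f (take i v @ x # drop i v) \<noteq> 0"
    by (rule sum.not_neutral_contains_not_neutral)
  then show ?thesis using i(1) that by blast
qed

text \<open>Two insertions in front of the first letter cancel in pairs after their letters are
  exchanged, one in front and one behind cancel by the sign of the recursion, and two behind are
  covered by induction.\<close>

lemma bd_bd: "bd A v (\<lambda>w. bd A w f) = 0"
proof (induction v arbitrary: f)
  case Nil
  show ?case by (simp add: sum_subtractf) (rule sum.swap)
next
  case (Cons y v)
  have "(\<Sum>x\<in>A. bd A (x # y # v) f) =
      (\<Sum>x\<in>A. \<Sum>x'\<in>A. f (x' # x # y # v)) - (\<Sum>x\<in>A. \<Sum>x'\<in>A. f (x # x' # y # v))
        + (\<Sum>x\<in>A. bd A v (\<lambda>w. f (x # y # w)))"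
    by (simp add: sum_subtractf)
  also have "\<dots> = (\<Sum>x\<in>A. bd A v (\<lambda>w. f (x # y # w)))"
    using sum.swap[of "\<lambda>x x'. f (x' # x # y # v)" A A] by simp
  finally show ?case
    using Cons[of "\<lambda>w. f (y # w)"] by (simp add: bd_diff bd_sum)
qed

text \<open>Only insertions behind \<open>u\<close> survive, and passing \<open>u\<close> costs one
  sign per letter. An insertion directly after \<open>u\<close> counts as one at the front of
  \<open>v\<close>, hence the strict bound on \<open>i\<close>.\<close>

lemma bd_append:
  assumes "\<And>i x. i < length u \<Longrightarrow> x \<in> A \<Longrightarrow> f (take i u @ x # drop i u @ v) = 0"
  shows "bd A (u @ v) f = (-1) ^ length u * bd A v (\<lambda>w. f (u @ w))"
  using assms
proof (induction u arbitrary: f)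
  case (Cons y u)
  have "(\<Sum>x\<in>A. f (x # y # u @ v)) = 0"
    using Cons.prems[of 0] by (intro sum.neutral) auto
  moreover have "bd A (u @ v) (\<lambda>w. f (y # w)) = (-1) ^ length u * bd A v (\<lambda>w. f (y # u @ w))"
    using Cons.prems[of "Suc _"] by (intro Cons.IH) auto
  ultimately show ?case by simp
qed simp

lemma bd_restrict:
  assumes "finite A" "A' \<subseteq> A" "\<And>w. f w \<noteq> 0 \<Longrightarrow> set w \<subseteq> A'"
  shows "bd A v f = bd A' v f"
  using assms(3)
proof (induction v arbitrary: f)
  case Nil
  have "f [x] = 0" if "x \<in> A - A'" for x
    using Nil[of "[x]"] that by auto
  then show ?case
    using assms(1,2) by (auto intro!: sum.mono_neutral_right)
next
  case (Cons y v)
  have "f (x # y # v) = 0" if "x \<in> A - A'" for x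
    using Cons.prems[of "x # y # v"] that by auto
  then have "(\<Sum>x\<in>A. f (x # y # v)) = (\<Sum>x\<in>A'. f (x # y # v))"
    using assms(1,2) by (intro sum.mono_neutral_right) auto
  moreover have "bd A v (\<lambda>w. f (y # w)) = bd A' v (\<lambda>w. f (y # w))"
    using Cons.prems[of "y # _"] by (intro Cons.IH) auto
  ultimately show ?case by simp
qed

lemma chainsD:
  assumes "f \<in> chains A m" "f w \<noteq> 0"
  shows "distinct w" "set w \<subseteq> A" "length w = m"
  using assms by (auto simp: chains_def)

lemma chains_lincomb:
  assumes "f \<in> chains A m" "g \<in> chains A m"
  shows "(\<lambda>w. f w + c * g w) \<in> chains A m"
  unfolding chains_def
proof (intro CollectI allI impI)
  fix w assume "f w + c * g w \<noteq> 0"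
  then have "f w \<noteq> 0 \<or> g w \<noteq> 0" by auto
  then show "distinct w \<and> set w \<subseteq> A \<and> length w = m"
    using assms by (auto simp: chains_def)
qed

lemma bd_in_chains:
  assumes "f \<in> chains A (Suc m)"
  shows "(\<lambda>v. bd A v f) \<in> chains A m"
  unfolding chains_def
proof (intro CollectI allI impI)
  fix v assume "bd A v f \<noteq> 0"
  then obtain i x where i: "i \<le> length v" "f (take i v @ x # drop i v) \<noteq> 0"
    by (rule bd_nonzero)
  note D = chainsD[OF assms i(2)]
  have v: "v = take i v @ drop i v" by simp
  have "distinct (take i v @ drop i v)" "set (take i v @ drop i v) \<subseteq> A"
    using D(1,2) by (simp_all del: append_take_drop_id)
  then show "distinct v \<and> set v \<subseteq> A \<and> length v = m"
    using D(3) i(1) by (auto simp: min_def split: if_splits)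
qed

lemma nth_insert_Suc:
  assumes "i \<le> j" "j < length v"
  shows "(take i v @ x # drop i v) ! Suc j = v ! j"
  using assms by (simp add: nth_append min_def)

text \<open>
  Induction on the alphabet.  Fix a letter \<open>a\<close>; a cycle supported on words without \<open>a\<close> bounds the
  cone with apex \<open>a\<close>.  Otherwise let \<open>p\<close> be the last position at which \<open>a\<close> occurs: for every prefix
  \<open>u\<close> of length \<open>p\<close> the part of the cycle on words \<open>u a w\<close> is a cycle in \<open>w\<close> over the alphabet
  without \<open>u\<close> and \<open>a\<close>, and subtracting the boundary of its filling lowers \<open>p\<close>.
\<close>

lemma injective_words_exact:
  assumes "finite A" "m < card A" "z \<in> chains A m" "\<And>v. bd A v z = 0"
  shows "\<exists>g \<in> chains A (Suc m). \<forall>v. bd A v g = z v"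
  using assms
proof (induction "card A" arbitrary: A m z rule: less_induct)
  case (less A m z)
  then have "A \<noteq> {}" by auto
  then obtain a where a: "a \<in> A" by auto
  \<comment> \<open>Inner induction on a bound \<open>p\<close>: on words where \<open>z\<close> is
    nonzero, \<open>a\<close> occurs only at positions below \<open>p\<close>.\<close>
  have "\<exists>g \<in> chains A (Suc m). \<forall>v. bd A v g = z v"
    if "z \<in> chains A m" "\<And>v. bd A v z = 0" "\<And>w j. p \<le> j \<Longrightarrow> j < length w \<Longrightarrow> w ! j = a \<Longrightarrow> z w = 0" for p z
    using that
  proof (induction p arbitrary: z)
    case 0
    have no_a: "z w = 0" if "a \<in> set w" for w
      using that 0(3) by (auto simp: in_set_conv_nth)
    \<comment> \<open>The cone with apex \<open>a\<close>: inserting \<open>a\<close> in front gives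
      back \<open>z v\<close>, and if \<open>v\<close> itself starts with \<open>a\<close>, the
      remaining terms are a boundary value of \<open>z\<close>, hence 0.\<close>
    define g where "g w = (case w of [] \<Rightarrow> 0 | x # w' \<Rightarrow> if x = a then z w' else 0)" for w
    have "g \<in> chains A (Suc m)"
      using 0(1) no_a a by (auto simp: chains_def g_def split: list.splits if_splits)
    moreover have "bd A v g = z v" for v
    proof -
      have sum: "(\<Sum>x\<in>A. g (x # v)) = z v" for v
        using a \<open>finite A\<close> by (simp add: g_def sum.delta)
      show ?thesis
      proof (cases v)
        case (Cons y v')
        have "(\<lambda>w. g (y # w)) = (if y = a then z else (\<lambda>w. 0))"
          by (auto simp: g_def fun_eq_iff)
        then show ?thesis
          using Cons sum[of v] 0(2) no_a[of v] by auto
      qed (use sum[of "[]"] in simp)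
    qed
    ultimately show ?case by blast
  next
    case (Suc p)
    show ?case
    proof (cases "m \<le> p")
      case True
      have "z w = 0" if "p \<le> j" "j < length w" for w j
        using chainsD(3)[OF Suc.prems(1), of w] that True by auto
      then show ?thesis
        using Suc.IH[OF Suc.prems(1,2)] by blast
    next
      case False
      then have pm: "p < m" by simp
      define good where "good u \<longleftrightarrow> length u = p \<and> distinct u \<and> set u \<subseteq> A - {a}" for u
      define B where "B u = A - set u - {a}" for u
      have fill: "\<exists>y \<in> chains (B u) (m - p). \<forall>v. bd (B u) v y = z (u @ a # v)" if u: "good u" for u
      proof -
        let ?z = "\<lambda>w. z (u @ a # w)"
        have "a \<notin> set u"
          using u by (auto simp: good_def)
        then have "card (insert a (set u)) = Suc p" "insert a (set u) \<subseteq> A"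
          using u a by (auto simp: good_def distinct_card)
        moreover have "B u = A - insert a (set u)"
          by (auto simp: B_def)
        ultimately have cB: "card (B u) = card A - Suc p"
          using card_Diff_subset[of "insert a (set u)" A] by auto
        have zc: "?z \<in> chains (B u) (m - p - 1)"
          unfolding chains_def
        proof (intro CollectI allI impI)
          fix w assume "?z w \<noteq> 0"
          from chainsD[OF Suc.prems(1) this]
          show "distinct w \<and> set w \<subseteq> B u \<and> length w = m - p - 1"
            using u by (auto simp: good_def B_def)
        qed
        have "bd A v ?z = 0" for v
        proof -
          \<comment> \<open>An insertion before the letter \<open>a\<close> pushes it to position
            \<open>Suc p\<close>, where \<open>z\<close> admits no \<open>a\<close>.\<close>
          have "z (take i (u @ [a]) @ x # drop i (u @ [a]) @ v) = 0" if i: "i < length (u @ [a])" for i x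
          proof (rule Suc.prems(3)[of "Suc p"])
            have "(take i ((u @ [a]) @ v) @ x # drop i ((u @ [a]) @ v)) ! Suc p = ((u @ [a]) @ v) ! p"
              using i u by (intro nth_insert_Suc) (auto simp: good_def)
            then show "(take i (u @ [a]) @ x # drop i (u @ [a]) @ v) ! Suc p = a"
              using i u by (simp add: good_def nth_append)
          qed (use i u in \<open>auto simp: good_def\<close>)
          then have "bd A ((u @ [a]) @ v) z = (-1) ^ length (u @ [a]) * bd A v (\<lambda>w. z ((u @ [a]) @ w))"
            by (intro bd_append) auto
          then show ?thesis
            using Suc.prems(2) by simp
        qed
        moreover have "bd A v ?z = bd (B u) v ?z" for v
          by (rule bd_restrict) (use less.prems(1) chainsD(2)[OF zc] in \<open>auto simp: B_def\<close>)
        ultimately have zcyc: "bd (B u) v ?z = 0" for v by simp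
        \<comment> \<open>Alphabet and word length both lose \<open>Suc p\<close>, so the words stay
          shorter than the alphabet is large and the outer induction applies.\<close>
        have "card (B u) < card A" "m - p - 1 < card (B u)" "finite (B u)"
          using cB pm less.prems(1,2) by (auto simp: B_def)
        from less.hyps[OF this(1) this(3) this(2) zc zcyc]
        show ?thesis
          using pm by (simp add: Suc_diff_Suc)
      qed
      define Y where "Y u = (SOME y. y \<in> chains (B u) (m - p) \<and> (\<forall>v. bd (B u) v y = z (u @ a # v)))" for u
      have Y: "Y u \<in> chains (B u) (m - p)" "bd (B u) v (Y u) = z (u @ a # v)" if "good u" for u v
        using someI_ex[OF fill[OF that, unfolded Bex_def]] by (auto simp: Y_def)
      define y where "y w = (if p < length w \<and> w ! p = a \<and> good (take p w)
        then Y (take p w) (drop (Suc p) w) else 0)" for w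
      have yc: "y \<in> chains A (Suc m)"
        unfolding chains_def
      proof (intro CollectI allI impI)
        fix w assume "y w \<noteq> 0"
        then have w: "p < length w" "w ! p = a" "good (take p w)" "Y (take p w) (drop (Suc p) w) \<noteq> 0"
          by (auto simp: y_def split: if_splits)
        note D = chainsD[OF Y(1)[OF w(3)] w(4)]
        have "w = take p w @ a # drop (Suc p) w"
          using w by (metis id_take_nth_drop)
        moreover have "distinct (take p w @ a # drop (Suc p) w)" "set (take p w @ a # drop (Suc p) w) \<subseteq> A"
          using w(3) D a by (auto simp: good_def B_def)
        ultimately show "distinct w \<and> set w \<subseteq> A \<and> length w = Suc m"
          using D(3) pm by (metis (no_types, lifting) length_drop Suc_diff_Suc diff_Suc_Suc
              le_add_diff_inverse less_imp_le_nat w(1) add_Suc_right Suc_leI)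
      qed
      \<comment> \<open>Words in the support of \<open>y\<close> are injective and carry
        \<open>a\<close> at position \<open>p\<close>, hence nowhere else.\<close>
      have y0: "y w = 0" if "p < k" "k < length w" "w ! k = a" for w k
      proof (rule ccontr)
        assume "y w \<noteq> 0"
        then have "distinct w" "w ! p = a" "p < length w"
          using chainsD(1)[OF yc] by (auto simp: y_def split: if_splits)
        then show False
          using that nth_eq_iff_index_eq[of w p k] by auto
      qed
      \<comment> \<open>The sign that \<open>bd_append\<close> produces for the prefix
        \<open>u @ [a]\<close> of length \<open>Suc p\<close>.\<close>
      define s where "s = (-1 :: rat) ^ Suc p"
      have ss: "s * s = 1"
        by (simp add: s_def flip: power_add)
      define z1 where "z1 w = z w - s * bd A w y" for w
      have "z1 \<in> chains A m"
        using chains_lincomb[OF Suc.prems(1) bd_in_chains[OF yc], of "- s"] by (simp add: z1_def[abs_def])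
      moreover have "bd A v z1 = 0" for v
        unfolding z1_def bd_diff bd_scale bd_bd Suc.prems(2) by simp
      moreover have "z1 w = 0" if j: "p \<le> j" "j < length w" "w ! j = a" for w j
      proof (cases "j = p")
        case False
        then have "z w = 0"
          using Suc.prems(3)[OF _ j(2,3)] j(1) by simp
        \<comment> \<open>An insertion leaves this \<open>a\<close> at position \<open>j\<close> or
          moves it to \<open>Suc j\<close>, in either case beyond \<open>p\<close>, where
          \<open>y\<close> vanishes.\<close>
        moreover have "bd A w y = 0"
        proof (rule ccontr)
          assume "bd A w y \<noteq> 0"
          then obtain i x where i: "i \<le> length w" "y (take i w @ x # drop i w) \<noteq> 0"
            by (rule bd_nonzero)
          show False
          proof (cases "i \<le> j")
            case True
            then have "(take i w @ x # drop i w) ! Suc j = a"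
              using nth_insert_Suc[OF True j(2)] j(3) by simp
            then show False
              using y0[of "Suc j" "take i w @ x # drop i w"] j i by auto
          next
            case False
            then have "(take i w @ x # drop i w) ! j = a"
              using j by (simp add: nth_append)
            then show False
              using y0[of j "take i w @ x # drop i w"] j i \<open>j \<noteq> p\<close> by auto
          qed
        qed
        ultimately show ?thesis by (simp add: z1_def)
      next
        case True
        define u v where "u = take p w" and "v = drop (Suc p) w"
        have w: "w = (u @ [a]) @ v" and u: "length u = p"
          using j True id_take_nth_drop[of p w] by (auto simp: u_def v_def)
        have "y (take i (u @ [a]) @ x # drop i (u @ [a]) @ v) = 0" if i: "i < length (u @ [a])" for i x
        proof (rule y0[of "Suc p"])
          have "(take i ((u @ [a]) @ v) @ x # drop i ((u @ [a]) @ v)) ! Suc p = ((u @ [a]) @ v) ! p"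
            using i u by (intro nth_insert_Suc) auto
          then show "(take i (u @ [a]) @ x # drop i (u @ [a]) @ v) ! Suc p = a"
            using i u by (simp add: nth_append)
        qed (use i u in auto)
        then have "bd A w y = (-1) ^ length (u @ [a]) * bd A v (\<lambda>x. y ((u @ [a]) @ x))"
          unfolding w by (intro bd_append) auto
        then have bdy: "bd A w y = s * bd A v (\<lambda>x. y (u @ a # x))"
          using u by (simp add: s_def)
        show ?thesis
        proof (cases "good u")
          case True
          then have "(\<lambda>x. y (u @ a # x)) = Y u"
            using u by (auto simp: y_def nth_append)
          moreover have "bd A v (Y u) = bd (B u) v (Y u)"
            by (rule bd_restrict) (use less.prems(1) chainsD(2)[OF Y(1)[OF True]] in \<open>auto simp: B_def\<close>)
          ultimately have "bd A w y = s * z w"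
            using bdy Y(2)[OF True, of v] w by simp
          then show ?thesis
            using ss by (simp add: z1_def flip: mult.assoc)
        next
          case False
          then have "(\<lambda>x. y (u @ a # x)) = (\<lambda>x. 0)"
            using u by (auto simp: y_def nth_append)
          moreover have "z w = 0"
          proof (rule ccontr)
            assume "z w \<noteq> 0"
            from chainsD[OF Suc.prems(1) this] have "good u"
              using u w by (auto simp: good_def)
            then show False using False by simp
          qed
          ultimately show ?thesis
            using bdy by (simp add: z1_def)
        qed
      qed
      ultimately obtain g where g: "g \<in> chains A (Suc m)" "\<And>v. bd A v g = z1 v"
        using Suc.IH[of z1] by blast
      have "(\<lambda>w. g w + s * y w) \<in> chains A (Suc m)"
        by (rule chains_lincomb[OF g(1) yc])
      moreover have "bd A v (\<lambda>w. g w + s * y w) = z v" for v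
        unfolding bd_add bd_scale g(2) z1_def by simp
      ultimately show ?thesis by blast
    qed
  qed
  \<comment> \<open>The bound \<open>p = m\<close> holds at the start because words of length
    \<open>m\<close> have no position beyond \<open>m - 1\<close>.\<close>
  from this[OF less.prems(3,4), of m]
  show ?case
    using chainsD(3)[OF less.prems(3)] by (metis leD)
qed


section \<open>The homology character\<close>

definition words_of_length :: "nat \<Rightarrow> nat \<Rightarrow> nat list set" where
  "words_of_length n m = {w \<in> injective_words n. length w = m}"

lemma injective_words_length: "w \<in> injective_words n \<Longrightarrow> length w \<le> n"
  unfolding injective_words_def using card_mono[of "{1..n}" "set w"] by (auto simp: distinct_card)

lemma finite_injective_words: "finite (injective_words n)"
proof (rule finite_subset)
  show "injective_words n \<subseteq> {w. set w \<subseteq> {1..n} \<and> length w \<le> n}"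
    using injective_words_length by (auto simp: injective_words_def)
qed (simp add: finite_lists_length_le)

lemma finite_words_of_length: "finite (words_of_length n m)"
  using finite_injective_words by (simp add: words_of_length_def)

lemma word_chains_eq_chains: "word_chains n m = chains {1..n} m"
  by (auto simp: word_chains_def chains_def injective_words_def)

lemma word_chains_eq_supported_on: "word_chains n m = supported_on (words_of_length n m)"
  by (auto simp: word_chains_def supported_on_def words_of_length_def)

section \<open>Comparison of the boundary maps and equivariance\<close>

text \<open>Makes the range of summation depend on \<open>v\<close> only, so that the sums over
  words and over positions can be exchanged.\<close>

lemma word_boundary_eq:
  "word_boundary w v = (\<Sum>i\<le>length v. if length w = Suc (length v) \<and> v = take i w @ drop (Suc i) w then (-1) ^ i else 0)"
proof (cases "length w = Suc (length v)")
  case True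
  then have "{..<length w} = {..length v}"
    by auto
  then show ?thesis
    using True by (simp add: word_boundary_def)
next
  case False
  have "length w = Suc (length v)" if "i < length w" "v = take i w @ drop (Suc i) w" for i
    using that by simp
  then show ?thesis
    using False by (auto simp: word_boundary_def intro!: sum.neutral)
qed

text \<open>Deleting position \<open>i\<close> of \<open>w\<close> gives \<open>v\<close> exactly if
  \<open>w\<close> arises from \<open>v\<close> by inserting the letter \<open>w ! i\<close> at
  \<open>i\<close>.\<close>

lemma chain_boundary_eq_bd:
  assumes f: "f \<in> word_chains n m"
  shows "chain_boundary n f v = bd {1..n} v f"
proof -
  let ?S = "injective_words n"
  have "(\<Sum>w\<in>?S. f w * (if length w = Suc (length v) \<and> v = take i w @ drop (Suc i) w then (-1) ^ i else 0))
      = (-1) ^ i * (\<Sum>x\<in>{1..n}. f (take i v @ x # drop i v))" if i: "i \<le> length v" for i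
  proof -
    let ?ins = "\<lambda>x. take i v @ x # drop i v"
    have inj: "inj_on ?ins {1..n}"
      by (auto simp: inj_on_def)
    have "(\<Sum>w\<in>?S. f w * (if length w = Suc (length v) \<and> v = take i w @ drop (Suc i) w then (-1) ^ i else 0))
      = (\<Sum>w\<in>?ins ` {1..n}. f w * (-1) ^ i)"
    \<comment> \<open>The two index sets differ both ways: \<open>f\<close> vanishes on insertions
      that are not injective words, and the indicator vanishes on injective words that are not
      insertions.\<close>
    proof (rule sum.mono_neutral_cong)
      show "finite (?ins ` {1..n})" by simp
      show "finite ?S" by (rule finite_injective_words)
      show "f w * (-1) ^ i = 0" if "w \<in> ?ins ` {1..n} - ?S" for w
        using that f by (auto simp: word_chains_def)
      show "f w * (if length w = Suc (length v) \<and> v = take i w @ drop (Suc i) w then (-1) ^ i else 0) = 0"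
        if w: "w \<in> ?S - ?ins ` {1..n}" for w
      proof -
        have "w \<in> ?ins ` {1..n}" if w': "length w = Suc (length v)" "v = take i w @ drop (Suc i) w"
        proof
          have "i < length w"
            using i w'(1) by simp
          then show "w = ?ins (w ! i)"
            using w'(2) by (simp add: id_take_nth_drop[symmetric] min_def)
          show "w ! i \<in> {1..n}"
            using w \<open>i < length w\<close> nth_mem by (fastforce simp: injective_words_def)
        qed
        then have "\<not> (length w = Suc (length v) \<and> v = take i w @ drop (Suc i) w)"
          using w by blast
        then show ?thesis
          by (simp only: if_False mult_zero_right)
      qed
      show "f w * (if length w = Suc (length v) \<and> v = take i w @ drop (Suc i) w then (-1) ^ i else 0) = f w * (-1) ^ i"
        if "w \<in> ?S \<inter> ?ins ` {1..n}" for w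
        using that i by (auto simp: min_absorb2 Suc_diff_le)
    qed
    also have "\<dots> = (-1) ^ i * (\<Sum>x\<in>{1..n}. f (?ins x))"
      unfolding sum.reindex[OF inj] o_def sum_distrib_left by (simp only: mult.commute)
    finally show ?thesis .
  qed
  note inner = this
  have "chain_boundary n f v = (\<Sum>w\<in>?S. f w * word_boundary w v)"
    by (simp add: chain_boundary_def sum_fun_apply fscale_def)
  also have "\<dots> = (\<Sum>w\<in>?S. \<Sum>i\<le>length v.
      f w * (if length w = Suc (length v) \<and> v = take i w @ drop (Suc i) w then (-1) ^ i else 0))"
    by (simp only: word_boundary_eq sum_distrib_left)
  also have "\<dots> = (\<Sum>i\<le>length v. \<Sum>w\<in>?S.
      f w * (if length w = Suc (length v) \<and> v = take i w @ drop (Suc i) w then (-1) ^ i else 0))"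
    by (rule sum.swap)
  also have "\<dots> = bd {1..n} v f"
    unfolding bd_eq_sum by (rule sum.cong[OF refl]) (rule inner, simp)
  finally show ?thesis .
qed

lemma module_hom_chain_boundary: "module_hom fscale fscale (chain_boundary n)"
  by unfold_locales
    (simp_all add: chain_boundary_def fscale_def fun_eq_iff sum_fun_apply sum.distrib
      sum_distrib_left algebra_simps)

lemma module_hom_permute_chain: "module_hom fscale fscale (permute_chain \<sigma>)"
  by unfold_locales (simp_all add: permute_chain_def fscale_def fun_eq_iff)

lemma map_permutes_words:
  assumes "\<tau> permutes {1..n}"
  shows "map \<tau> w \<in> words_of_length n m \<longleftrightarrow> w \<in> words_of_length n m"
proof -
  have "\<tau> ` set w \<subseteq> {1..n} \<longleftrightarrow> set w \<subseteq> {1..n}"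
    using permutes_in_image[OF assms] by auto
  then show ?thesis
    using permutes_inj[OF assms] by (auto simp: words_of_length_def injective_words_def distinct_map inj_on_subset)
qed

lemma permute_chain_word_chains:
  assumes "\<sigma> permutes {1..n}" "f \<in> word_chains n m"
  shows "permute_chain \<sigma> f \<in> word_chains n m"
  using assms map_permutes_words[OF permutes_inv[OF assms(1)]]
  by (simp add: word_chains_eq_supported_on supported_on_iff permute_chain_def)

lemma bd_permute:
  assumes "\<tau> permutes A"
  shows "bd A v (\<lambda>w. f (map \<tau> w)) = bd A (map \<tau> v) f"
proof (induction v arbitrary: f)
  case Nil
  show ?case
    using sum.permute[OF assms, of "\<lambda>x. f [x]"] by (simp add: o_def)
next
  case (Cons y v)
  have "(\<Sum>x\<in>A. f (\<tau> x # \<tau> y # map \<tau> v)) = (\<Sum>x\<in>A. f (x # \<tau> y # map \<tau> v))"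
    using sum.permute[OF assms, of "\<lambda>x. f (x # \<tau> y # map \<tau> v)"] by (simp add: o_def)
  then show ?case
    using Cons[of "\<lambda>w. f (\<tau> y # w)"] by simp
qed

lemma chain_boundary_permute:
  assumes "\<sigma> permutes {1..n}" "f \<in> word_chains n m"
  shows "chain_boundary n (permute_chain \<sigma> f) = permute_chain \<sigma> (chain_boundary n f)"
proof
  fix v
  have "chain_boundary n (permute_chain \<sigma> f) v = bd {1..n} v (\<lambda>w. f (map (inv \<sigma>) w))"
    using chain_boundary_eq_bd[OF permute_chain_word_chains[OF assms]] by (simp add: permute_chain_def)
  also have "\<dots> = bd {1..n} (map (inv \<sigma>) v) f"
    by (rule bd_permute[OF permutes_inv[OF assms(1)]])
  also have "\<dots> = permute_chain \<sigma> (chain_boundary n f) v"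
    using chain_boundary_eq_bd[OF assms(2)] by (simp add: permute_chain_def)
  finally show "chain_boundary n (permute_chain \<sigma> f) v = permute_chain \<sigma> (chain_boundary n f) v" .
qed

lemma word_boundaries_eq_cycles:
  assumes "m < n"
  shows "word_boundaries n m = word_cycles n m"
proof (intro set_eqI iffI)
  fix f assume "f \<in> word_boundaries n m"
  then obtain g where g: "g \<in> word_chains n (Suc m)" "f = chain_boundary n g"
    by (auto simp: word_boundaries_def)
  then have f: "f = (\<lambda>v. bd {1..n} v g)"
    using chain_boundary_eq_bd[OF g(1)] by auto
  then have "f \<in> word_chains n m"
    using bd_in_chains g(1) by (simp add: word_chains_eq_chains)
  moreover have "chain_boundary n f = 0"
    using chain_boundary_eq_bd[OF calculation] bd_bd by (auto simp: f)
  ultimately show "f \<in> word_cycles n m"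
    by (simp add: word_cycles_def)
next
  fix f assume "f \<in> word_cycles n m"
  then have f: "f \<in> word_chains n m" "chain_boundary n f = 0"
    by (auto simp: word_cycles_def)
  have "bd {1..n} v f = 0" for v
    using chain_boundary_eq_bd[OF f(1), of v] f(2) by simp
  then obtain g where g: "g \<in> chains {1..n} (Suc m)" "\<And>v. bd {1..n} v g = f v"
    using injective_words_exact[of "{1..n}" m f] f(1) assms by (auto simp: word_chains_eq_chains)
  then have "chain_boundary n g = f"
    using chain_boundary_eq_bd[of g n "Suc m"] by (auto simp: word_chains_eq_chains)
  then show "f \<in> word_boundaries n m"
    using g(1) by (auto simp: word_boundaries_def word_chains_eq_chains)
qed

section \<open>The Hopf trace formula\<close>

definition fixed_words :: "nat \<Rightarrow> nat \<Rightarrow> (nat \<Rightarrow> nat) \<Rightarrow> nat list set" where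
  "fixed_words n m \<sigma> = {w \<in> words_of_length n m. map \<sigma> w = w}"

lemma trace_word_chains:
  assumes "\<sigma> permutes {1..n}"
  shows "fun_tr.space_trace (word_chains n m) (permute_chain \<sigma>) = of_nat (card (fixed_words n m \<sigma>))"
proof -
  have fixed: "map (inv \<sigma>) w = w \<longleftrightarrow> map \<sigma> w = w" for w
    using permutes_inv_o[OF assms] by (metis list.map_comp list.map_id)
  have "fun_tr.space_trace (word_chains n m) (permute_chain \<sigma>) =
      (\<Sum>w\<in>words_of_length n m. permute_chain \<sigma> (unit_fun w) w)"
    unfolding word_chains_eq_supported_on
    by (rule space_trace_supported_on[OF finite_words_of_length module_hom_permute_chain])
       (use permute_chain_word_chains[OF assms] in \<open>simp add: word_chains_eq_supported_on\<close>)
  also have "\<dots> = (\<Sum>w\<in>words_of_length n m. if map \<sigma> w = w then 1 else 0)"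
    by (intro sum.cong) (auto simp: permute_chain_def unit_fun_def fixed)
  also have "\<dots> = of_nat (card (fixed_words n m \<sigma>))"
    using finite_words_of_length by (simp add: fixed_words_def flip: sum.inter_filter)
  finally show ?thesis .
qed

lemma subspace_word_cycles: "fun_vs.subspace (word_cycles n m)"
proof -
  have "fun_vs.subspace (word_chains n m)"
    unfolding word_chains_eq_supported_on by (rule subspace_supported_on)
  then show ?thesis
    using module_hom_chain_boundary[of n]
    by (auto simp: fun_vs.subspace_def word_cycles_def module_hom.add module_hom.scale
        module_hom.zero fun_vs.scale_zero_right)
qed

lemma word_chains_span: "word_chains n m = fun_vs.span (unit_fun ` words_of_length n m)"
  by (simp add: word_chains_eq_supported_on span_unit_fun finite_words_of_length)

lemma word_chains_trace_split:
  assumes "\<sigma> permutes {1..n}"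
  shows "fun_tr.space_trace (word_chains n m) (permute_chain \<sigma>) =
    fun_tr.space_trace (word_cycles n m) (permute_chain \<sigma>) +
    fun_tr.space_trace (chain_boundary n ` word_chains n m) (permute_chain \<sigma>)"
  unfolding word_cycles_def
  by (rule fun_tr.space_trace_rank_nullity[of _ "unit_fun ` words_of_length n m"])
     (use assms permute_chain_word_chains chain_boundary_permute finite_words_of_length
       module_hom_permute_chain module_hom_chain_boundary in
       \<open>auto simp: word_chains_span fun_vs.subspace_span\<close>)

text \<open>By exactness the boundaries of chains of length \<open>Suc m\<close> are the cycles of
  length \<open>m\<close>, so rank-nullity expresses the trace on cycles of length
  \<open>Suc m\<close> as the number of fixed words minus the trace on cycles of length
  \<open>m\<close>.\<close>

lemma word_cycles_trace:
  assumes "\<sigma> permutes {1..n}" "m \<le> n"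
  shows "fun_tr.space_trace (word_cycles n m) (permute_chain \<sigma>) =
    (\<Sum>k\<le>m. (-1) ^ (m - k) * of_nat (card (fixed_words n k \<sigma>)))"
  using assms(2)
proof (induction m)
  case 0
  \<comment> \<open>The empty word has no faces, so in the augmented complex every chain of length 0
    is a cycle.\<close>
  have "chain_boundary n f = 0" if "f \<in> word_chains n 0" for f
  proof
    fix v
    show "chain_boundary n f v = 0 v"
    proof (rule ccontr)
      assume "chain_boundary n f v \<noteq> 0 v"
      then have "bd {1..n} v f \<noteq> 0"
        using chain_boundary_eq_bd[OF that] by simp
      then obtain i x where "f (take i v @ x # drop i v) \<noteq> 0"
        by (rule bd_nonzero)
      then show False
        using that by (auto simp: word_chains_def)
    qed
  qed
  moreover have "0 \<in> word_chains n 0"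
    by (simp add: word_chains_def)
  ultimately have "chain_boundary n ` word_chains n 0 = {0}"
    by auto
  then show ?case
    using word_chains_trace_split[OF assms(1), of 0] trace_word_chains[OF assms(1), of 0]
      space_trace_zero[OF module_hom_permute_chain] by simp
next
  case (Suc m)
  have "chain_boundary n ` word_chains n (Suc m) = word_cycles n m"
    using word_boundaries_eq_cycles[of m n] Suc.prems by (simp add: word_boundaries_def)
  then have "fun_tr.space_trace (word_cycles n (Suc m)) (permute_chain \<sigma>) =
      of_nat (card (fixed_words n (Suc m) \<sigma>)) - (\<Sum>k\<le>m. (-1) ^ (m - k) * of_nat (card (fixed_words n k \<sigma>)))"
    using word_chains_trace_split[OF assms(1), of "Suc m"] trace_word_chains[OF assms(1), of "Suc m"] Suc
    by simp
  then show ?case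
    by (simp add: Suc_diff_le sum_negf)
qed

text \<open>No injective word has length \<open>n + 1\<close>, so in the top degree nothing is
  divided out and the homology is the space of cycles.\<close>

lemma word_homology_char_eq:
  assumes "\<sigma> permutes {1..n}"
  shows "word_homology_char n n \<sigma> = (\<Sum>k\<le>n. (-1) ^ (n - k) * of_nat (card (fixed_words n k \<sigma>)))"
proof -
  have "words_of_length n (Suc n) = {}"
    using injective_words_length by (fastforce simp: words_of_length_def)
  then have "word_chains n (Suc n) = {0}"
    by (auto simp: word_chains_eq_supported_on supported_on_def)
  then have bnd: "word_boundaries n n = {0}"
    by (simp add: word_boundaries_def module_hom.zero[OF module_hom_chain_boundary])
  have sub: "word_cycles n n \<subseteq> fun_vs.span (unit_fun ` words_of_length n n)"
    by (auto simp: word_cycles_def word_chains_span)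
  have zero: "0 \<in> word_cycles n n"
    using fun_vs.subspace_0[OF subspace_word_cycles] .
  have inv: "permute_chain \<sigma> f \<in> word_cycles n n" if "f \<in> word_cycles n n" for f
    using that permute_chain_word_chains[OF assms] chain_boundary_permute[OF assms]
      module_hom.zero[OF module_hom_permute_chain] by (auto simp: word_cycles_def)
  have "quotient_trace (word_cycles n n) (word_boundaries n n) (permute_chain \<sigma>) =
      fun_tr.space_trace (word_cycles n n) (permute_chain \<sigma>) - fun_tr.space_trace {0} (permute_chain \<sigma>)"
    unfolding bnd
    by (rule quotient_trace_eq[OF subspace_word_cycles fun_vs.subspace_single_0 _ sub])
       (use zero inv finite_words_of_length module_hom_permute_chain
         module_hom.zero[OF module_hom_permute_chain] in auto)
  then show ?thesis
    unfolding word_homology_char_def space_trace_zero[OF module_hom_permute_chain]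
    by (simp add: word_cycles_trace[OF assms] of_rat_sum of_rat_mult of_rat_power)
qed


section \<open>Frobenius characteristics by counting colourings\<close>

text \<open>Expanding the product means choosing a variable \<open>g i\<close> in each factor.
  Finiteness is part of the induction because \<open>card\<close> is 0 on infinite sets.\<close>

lemma mcoeff_prod_psym:
  fixes k :: "'i \<Rightarrow> nat"
  assumes "finite I" "\<And>i. i \<in> I \<Longrightarrow> k i > 0"
  shows "finite {g \<in> I \<rightarrow>\<^sub>E UNIV. (\<Sum>i\<in>I. replicate_mset (k i) (g i)) = M} \<and>
    mcoeff (\<Prod>i\<in>I. psym (k i)) M =
      of_nat (card {g \<in> I \<rightarrow>\<^sub>E UNIV. (\<Sum>i\<in>I. replicate_mset (k i) (g i)) = M})"
  using assms
proof (induction I arbitrary: M rule: finite_induct)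
  case empty
  have "{g \<in> {} \<rightarrow>\<^sub>E UNIV. (\<Sum>i\<in>{}. replicate_mset (k i) (g i)) = M} =
      (if M = {#} then {\<lambda>_. undefined} else {} :: ('i \<Rightarrow> nat) set)"
    by auto
  then show ?case by (simp add: mcoeff_1)
next
  case (insert i I)
  let ?S = "\<lambda>I M. {g \<in> I \<rightarrow>\<^sub>E (UNIV :: nat set). (\<Sum>i\<in>I. replicate_mset (k i) (g i)) = M}"
  let ?A = "{a \<in> set_mset M. k i \<le> count M a}"
  have ki: "k i > 0"
    using insert.prems by simp
  have IH: "finite (?S I N)" "mcoeff (\<Prod>i\<in>I. psym (k i)) N = of_nat (card (?S I N))" for N
    using insert.IH[of N] insert.prems by auto
  have split: "?S (insert i I) M = (\<Union>a\<in>?A. (\<lambda>g. g(i := a)) ` ?S I (M - replicate_mset (k i) a))"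
  proof (intro set_eqI iffI)
    fix g assume g: "g \<in> ?S (insert i I) M"
    define h where "h = g(i := undefined)"
    have "(\<Sum>j\<in>I. replicate_mset (k j) (h j)) = (\<Sum>j\<in>I. replicate_mset (k j) (g j))"
      using insert.hyps(2) by (intro sum.cong) (auto simp: h_def)
    then have M: "M = replicate_mset (k i) (g i) + (\<Sum>j\<in>I. replicate_mset (k j) (h j))"
      using g insert.hyps by auto
    then have "h \<in> ?S I (M - replicate_mset (k i) (g i))"
      using g insert.hyps(2) by (auto simp: h_def PiE_def extensional_def)
    moreover have "g = h(i := g i)"
      by (simp add: h_def)
    moreover have "g i \<in> ?A"
      using ki by (auto simp: M)
    ultimately show "g \<in> (\<Union>a\<in>?A. (\<lambda>g. g(i := a)) ` ?S I (M - replicate_mset (k i) a))"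
      by blast
  next
    fix g assume "g \<in> (\<Union>a\<in>?A. (\<lambda>g. g(i := a)) ` ?S I (M - replicate_mset (k i) a))"
    then obtain a h where a: "a \<in> ?A" "h \<in> ?S I (M - replicate_mset (k i) a)" "g = h(i := a)"
      by blast
    have "(\<Sum>j\<in>I. replicate_mset (k j) (g j)) = (\<Sum>j\<in>I. replicate_mset (k j) (h j))"
      using insert.hyps(2) a(3) by (intro sum.cong) auto
    moreover have "replicate_mset (k i) a \<subseteq># M"
      using a(1) by (simp add: count_le_replicate_mset_subset_eq)
    ultimately show "g \<in> ?S (insert i I) M"
      using a insert.hyps by (auto simp: PiE_def extensional_def)
  qed
  have inj: "inj_on (\<lambda>g. g(i := a)) (?S I N)" for a N
  proof (rule inj_onI)
    fix g h assume "g \<in> ?S I N" "h \<in> ?S I N" "g(i := a) = h(i := a)"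
    then show "g = h"
      using insert.hyps(2) by (metis (no_types, lifting) PiE_arb fun_upd_triv fun_upd_upd mem_Collect_eq)
  qed
  have "card (?S (insert i I) M) = (\<Sum>a\<in>?A. card ((\<lambda>g. g(i := a)) ` ?S I (M - replicate_mset (k i) a)))"
    unfolding split
  proof (rule card_UN_disjoint)
    show "\<forall>a\<in>?A. \<forall>b\<in>?A. a \<noteq> b \<longrightarrow> (\<lambda>g. g(i := a)) ` ?S I (M - replicate_mset (k i) a) \<inter>
      (\<lambda>g. g(i := b)) ` ?S I (M - replicate_mset (k i) b) = {}"
      by (auto dest: fun_upd_eqD)
  qed (use IH(1) in auto)
  also have "\<dots> = (\<Sum>a\<in>?A. card (?S I (M - replicate_mset (k i) a)))"
    by (intro sum.cong refl card_image inj)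
  also have "\<dots> = (\<Sum>a\<in>set_mset M. if k i \<le> count M a then card (?S I (M - replicate_mset (k i) a)) else 0)"
    by (rule sum.inter_filter) simp
  finally have "of_nat (card (?S (insert i I) M)) = mcoeff (psym (k i) * (\<Prod>i\<in>I. psym (k i))) M"
    unfolding mcoeff_psym_mult[OF ki] IH(2) by (simp add: if_distrib cong: if_cong)
  moreover have "finite (?S (insert i I) M)"
    unfolding split using IH(1) by auto
  ultimately show ?case
    using insert.hyps by simp
qed

text \<open>The ways to write the monomial \<open>M\<close> as \<open>x_c(1) ... x_c(n)\<close>;
  extensionality leaves only finitely many functions.\<close>

definition colourings :: "nat \<Rightarrow> nat multiset \<Rightarrow> (nat \<Rightarrow> nat) set" where
  "colourings n M = {c \<in> {1..n} \<rightarrow>\<^sub>E UNIV. image_mset c (mset_set {1..n}) = M}"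

lemma finite_colourings: "finite (colourings n M)"
proof (rule finite_subset)
  show "colourings n M \<subseteq> {1..n} \<rightarrow>\<^sub>E set_mset M"
    by (auto simp: colourings_def PiE_def extensional_def)
qed (simp add: finite_PiE)

lemma sum_singleton_mset: "(\<Sum>x\<in>C. {#a#}) = replicate_mset (card C) a"
  by (induction C rule: infinite_finite_induct) auto

lemma orbit_eq_iff:
  assumes "permutation \<sigma>"
  shows "y \<in> orbit \<sigma> x \<longleftrightarrow> orbit \<sigma> y = orbit \<sigma> x"
  using assms orbit_swap orbit_trans permutation_self_in_orbit by (metis subsetI subset_antisym)

lemma orbit_subset_permutes:
  assumes "\<sigma> permutes A" "x \<in> A"
  shows "orbit \<sigma> x \<subseteq> A"
proof
  fix y assume "y \<in> orbit \<sigma> x"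
  then show "y \<in> A"
    by induction (use assms permutes_in_image in \<open>auto simp: permutes_in_image\<close>)
qed

text \<open>A colouring invariant under \<open>sigma\<close> is constant on cycles, hence the same
  as a choice of a variable for each cycle, which \<open>mcoeff_prod_psym\<close> counts.\<close>

lemma mcoeff_cycle_prod:
  assumes \<sigma>: "\<sigma> permutes {1..n}"
  shows "mcoeff (cycle_prod n \<sigma>) M = of_nat (card {c \<in> colourings n M. \<forall>x\<in>{1..n}. c (\<sigma> x) = c x})"
proof -
  have perm: "permutation \<sigma>"
    using \<sigma> permutation_permutes by blast
  define \<O> where "\<O> = orbit \<sigma> ` {1..n}"
  have self: "x \<in> orbit \<sigma> x" for x
    by (rule permutation_self_in_orbit[OF perm])
  have sub: "C \<subseteq> {1..n}" if "C \<in> \<O>" for C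
    using that orbit_subset_permutes[OF \<sigma>] unfolding \<O>_def by blast
  have fin: "finite \<O>" "finite C" if "C \<in> \<O>" for C
    using sub[OF that] finite_subset by (auto simp: \<O>_def)
  have union: "\<Union>\<O> = {1..n}"
    using sub self by (auto simp: \<O>_def)
  have orb: "orbit \<sigma> x = C" if "C \<in> \<O>" "x \<in> C" for C x
    using that orbit_eq_iff[OF perm] by (auto simp: \<O>_def)
  have orb_in: "orbit \<sigma> x \<in> \<O>" if "x \<in> {1..n}" for x
    using that by (simp add: \<O>_def)
  have content: "image_mset (\<lambda>x. g (orbit \<sigma> x)) (mset_set {1..n}) = (\<Sum>C\<in>\<O>. replicate_mset (card C) (g C))"
    for g :: "nat set \<Rightarrow> nat"
  proof -
    have "image_mset (\<lambda>x. g (orbit \<sigma> x)) (mset_set {1..n}) = (\<Sum>x\<in>{1..n}. {#g (orbit \<sigma> x)#})"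
      by (simp add: sum_unfold_sum_mset)
    also have "\<dots> = (\<Sum>C\<in>\<O>. \<Sum>x | x \<in> {1..n} \<and> orbit \<sigma> x = C. {#g (orbit \<sigma> x)#})"
      by (rule sum.group[symmetric]) (auto simp: \<O>_def)
    also have "\<dots> = (\<Sum>C\<in>\<O>. replicate_mset (card C) (g C))"
    proof (intro sum.cong refl)
      fix C assume C: "C \<in> \<O>"
      have "{x \<in> {1..n}. orbit \<sigma> x = C} = C"
        using sub[OF C] orb[OF C] self by auto
      then have "(\<Sum>x | x \<in> {1..n} \<and> orbit \<sigma> x = C. {#g (orbit \<sigma> x)#}) = (\<Sum>x\<in>C. {#g C#})"
        using orb[OF C] by (intro sum.cong) auto
      also have "\<dots> = replicate_mset (card C) (g C)"
        by (rule sum_singleton_mset)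
      finally show "(\<Sum>x | x \<in> {1..n} \<and> orbit \<sigma> x = C. {#g (orbit \<sigma> x)#}) = replicate_mset (card C) (g C)" .
    qed
    finally show ?thesis .
  qed
  let ?G = "{g \<in> \<O> \<rightarrow>\<^sub>E UNIV. (\<Sum>C\<in>\<O>. replicate_mset (card C) (g C)) = M}"
  let ?K = "{c \<in> colourings n M. \<forall>x\<in>{1..n}. c (\<sigma> x) = c x}"
  have "bij_betw (\<lambda>g. restrict (\<lambda>x. g (orbit \<sigma> x)) {1..n}) ?G ?K"
  proof (rule bij_betw_byWitness[where f' = "\<lambda>c. restrict (\<lambda>C. c (SOME x. x \<in> C)) \<O>"])
    have const: "c y = c x" if c: "c \<in> ?K" and x: "x \<in> {1..n}" and y: "y \<in> orbit \<sigma> x" for c x y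
      using y
    proof induction
      case base
      then show ?case using c x by auto
    next
      case (step y)
      then have "y \<in> {1..n}"
        using orbit_subset_permutes[OF \<sigma> x] by auto
      then show ?case using step c by auto
    qed
    have some: "(SOME x. x \<in> C) \<in> C" if "C \<in> \<O>" for C
      using that self unfolding \<O>_def by (metis imageE someI)
    show "\<forall>g\<in>?G. restrict (\<lambda>C. restrict (\<lambda>x. g (orbit \<sigma> x)) {1..n} (SOME x. x \<in> C)) \<O> = g"
    proof
      fix g assume g: "g \<in> ?G"
      show "restrict (\<lambda>C. restrict (\<lambda>x. g (orbit \<sigma> x)) {1..n} (SOME x. x \<in> C)) \<O> = g"
      proof
        fix C
        show "restrict (\<lambda>C. restrict (\<lambda>x. g (orbit \<sigma> x)) {1..n} (SOME x. x \<in> C)) \<O> C = g C"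
        proof (cases "C \<in> \<O>")
          case True
          then have "(SOME x. x \<in> C) \<in> {1..n}" "orbit \<sigma> (SOME x. x \<in> C) = C"
            using some[OF True] sub[OF True] orb[OF True] by auto
          then show ?thesis using True by simp
        next
          case False
          then show ?thesis using g by (auto simp: PiE_def extensional_def)
        qed
      qed
    qed
    show "\<forall>c\<in>?K. restrict (\<lambda>x. restrict (\<lambda>C. c (SOME x. x \<in> C)) \<O> (orbit \<sigma> x)) {1..n} = c"
    proof
      fix c assume c: "c \<in> ?K"
      show "restrict (\<lambda>x. restrict (\<lambda>C. c (SOME x. x \<in> C)) \<O> (orbit \<sigma> x)) {1..n} = c"
      proof
        fix x
        show "restrict (\<lambda>x. restrict (\<lambda>C. c (SOME x. x \<in> C)) \<O> (orbit \<sigma> x)) {1..n} x = c x"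
        proof (cases "x \<in> {1..n}")
          case True
          then show ?thesis
            using const[OF c True some[OF orb_in[OF True]]] orb_in[OF True] by simp
        next
          case False
          then show ?thesis using c by (auto simp: colourings_def PiE_def extensional_def)
        qed
      qed
    qed
    show "(\<lambda>g. restrict (\<lambda>x. g (orbit \<sigma> x)) {1..n}) ` ?G \<subseteq> ?K"
    proof
      fix c assume "c \<in> (\<lambda>g. restrict (\<lambda>x. g (orbit \<sigma> x)) {1..n}) ` ?G"
      then obtain g where g: "g \<in> ?G" "c = restrict (\<lambda>x. g (orbit \<sigma> x)) {1..n}"
        by blast
      have "image_mset c (mset_set {1..n}) = image_mset (\<lambda>x. g (orbit \<sigma> x)) (mset_set {1..n})"
        unfolding g(2) by (rule image_mset_cong) simp
      then have "c \<in> colourings n M"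
        using g content[of g] by (simp add: colourings_def)
      moreover have "\<sigma> x \<in> {1..n} \<and> orbit \<sigma> (\<sigma> x) = orbit \<sigma> x" if "x \<in> {1..n}" for x
        using permutes_in_image[OF \<sigma>] that permutation_orbit_step[OF perm] by auto
      ultimately show "c \<in> ?K"
        unfolding g(2) by simp
    qed
    show "(\<lambda>c. restrict (\<lambda>C. c (SOME x. x \<in> C)) \<O>) ` ?K \<subseteq> ?G"
    proof
      fix g assume "g \<in> (\<lambda>c. restrict (\<lambda>C. c (SOME x. x \<in> C)) \<O>) ` ?K"
      then obtain c where c: "c \<in> ?K" "g = restrict (\<lambda>C. c (SOME x. x \<in> C)) \<O>"
        by blast
      have "image_mset c (mset_set {1..n}) = image_mset (\<lambda>x. g (orbit \<sigma> x)) (mset_set {1..n})"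
      proof (rule image_mset_cong)
        fix x assume "x \<in># mset_set {1..n}"
        then have x: "x \<in> {1..n}" by simp
        then show "c x = g (orbit \<sigma> x)"
          using const[OF c(1) x some[OF orb_in[OF x]]] orb_in[OF x] c(2) by simp
      qed
      then show "g \<in> ?G"
        using c content[of g] by (simp add: colourings_def)
    qed
  qed
  then have "card ?G = card ?K"
    by (rule bij_betw_same_card)
  moreover have "mcoeff (\<Prod>C\<in>\<O>. psym (card C)) M = of_nat (card ?G)"
  proof -
    have "finite \<O>" by (simp add: \<O>_def)
    moreover have "card C > 0" if "C \<in> \<O>" for C
      using fin(2)[OF that] that self by (auto simp: \<O>_def card_gt_0_iff)
    ultimately show ?thesis
      using mcoeff_prod_psym[of \<O> card M] by blast
  qed
  ultimately show ?thesis
    by (simp add: cycle_prod_def \<O>_def)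
qed

text \<open>The factors \<open>p_1\<close> pick an ordered sequence of \<open>k\<close> variables
  out of \<open>M\<close>, and \<open>h_m\<close> accepts the remaining monomial with coefficient
  1.\<close>

lemma mcoeff_psym_power_hsym:
  "mcoeff (psym 1 ^ k * hsym m) M = of_nat (if size M = k + m then card {s. length s = k \<and> mset s \<subseteq># M} else 0)"
proof (induction k arbitrary: M)
  case 0
  have "{s. length s = 0 \<and> mset s \<subseteq># M} = {[]}" by auto
  then show ?case by (simp add: mcoeff_hsym)
next
  case (Suc k)
  have finite_seqs: "finite {s. length s = k \<and> mset s \<subseteq># N}" for N :: "nat multiset"
    by (rule finite_subset[OF _ finite_lists_length_eq[of "set_mset N" k]])
       (use set_mset_mono in fastforce)+
  have rep: "replicate_mset 1 i = {#i#}" for i :: nat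
    by simp
  have "mcoeff (psym 1 ^ Suc k * hsym m) M = (\<Sum>i\<in>set_mset M. mcoeff (psym 1 ^ k * hsym m) (M - {#i#}))"
    unfolding power_Suc mult.assoc by (subst mcoeff_psym_mult) (auto intro!: sum.cong)
  also have "\<dots> = (\<Sum>i\<in>set_mset M. of_nat (if size M = Suc k + m then card {s. length s = k \<and> mset s \<subseteq># M - {#i#}} else 0))"
  proof (intro sum.cong refl)
    fix i assume "i \<in># M"
    then have "size (M - {#i#}) = k + m \<longleftrightarrow> size M = Suc k + m"
      using size_Suc_Diff1[of i M] by auto
    then show "mcoeff (psym 1 ^ k * hsym m) (M - {#i#}) =
        of_nat (if size M = Suc k + m then card {s. length s = k \<and> mset s \<subseteq># M - {#i#}} else 0)"
      by (simp only: Suc.IH)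
  qed
  also have "\<dots> = of_nat (if size M = Suc k + m then card {s. length s = Suc k \<and> mset s \<subseteq># M} else 0)"
  proof -
    have "{s. length s = Suc k \<and> mset s \<subseteq># M} =
        (\<Union>i\<in>set_mset M. Cons i ` {s. length s = k \<and> mset s \<subseteq># M - {#i#}})"
    proof (intro set_eqI iffI)
      fix s assume s: "s \<in> {s. length s = Suc k \<and> mset s \<subseteq># M}"
      then obtain i t where t: "s = i # t" "length t = k"
        by (auto simp: length_Suc_conv)
      then have "i \<in># M" "mset t \<subseteq># M - {#i#}"
        using s by (auto simp: insert_subset_eq_iff)
      then show "s \<in> (\<Union>i\<in>set_mset M. Cons i ` {s. length s = k \<and> mset s \<subseteq># M - {#i#}})"
        using t by blast
    next
      fix s assume "s \<in> (\<Union>i\<in>set_mset M. Cons i ` {s. length s = k \<and> mset s \<subseteq># M - {#i#}})"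
      then show "s \<in> {s. length s = Suc k \<and> mset s \<subseteq># M}"
        by (auto simp: insert_subset_eq_iff)
    qed
    then have "card {s. length s = Suc k \<and> mset s \<subseteq># M} =
        (\<Sum>i\<in>set_mset M. card (Cons i ` {s. length s = k \<and> mset s \<subseteq># M - {#i#}}))"
      using finite_seqs by (simp only:) (subst card_UN_disjoint; auto)
    also have "\<dots> = (\<Sum>i\<in>set_mset M. card {s. length s = k \<and> mset s \<subseteq># M - {#i#}})"
      by (intro sum.cong refl card_image) simp
    finally show ?thesis by simp
  qed
  finally show ?case .
qed

text \<open>\<open>F\<close> refines the colour of a point by its position in the word, or
  \<open>None\<close> outside it. Equal colour sequences and equal contents force equal contents of
  the refined colourings, and two colourings of equal content differ by a permutation.\<close>

lemma coloured_words_transitive: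
  assumes w: "w \<in> words_of_length n k" "c \<in> colourings n M"
    and w': "w' \<in> words_of_length n k" "c' \<in> colourings n M"
    and eq: "map c w = map c' w'"
  obtains \<tau> where "\<tau> permutes {1..n}" "map \<tau> w = w'" "\<And>x. x \<in> {1..n} \<Longrightarrow> c' (\<tau> x) = c x"
proof -
  define F where "F w c = (\<lambda>x. (c x, map_of (zip w [0..<k]) x))" for w and c :: "nat \<Rightarrow> nat"
  have F: "image_mset (F w c) (mset_set {1..n}) =
      mset (zip (map c w) (map Some [0..<k])) + image_mset (\<lambda>a. (a, None)) (M - mset (map c w))"
    if w: "w \<in> words_of_length n k" "c \<in> colourings n M" for w c
  proof -
    let ?R = "{1..n} - set w"
    have D: "distinct w" "set w \<subseteq> {1..n}" "length w = k"
      using w by (auto simp: words_of_length_def injective_words_def)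
    have "mset_set {1..n} = mset_set (set w) + mset_set ?R"
      using D(2) by (subst mset_set_Union[symmetric]) (auto simp: Un_absorb1)
    then have split: "mset_set {1..n} = mset w + mset_set ?R"
      using D(1) by (simp add: mset_set_set)
    then have M: "M = mset (map c w) + image_mset c (mset_set ?R)"
      using w(2) by (simp add: colourings_def)
    have "map (F w c) w = zip (map c w) (map Some [0..<k])"
      by (rule nth_equalityI) (use D in \<open>auto simp: F_def map_of_zip_nth\<close>)
    then have "image_mset (F w c) (mset w) = mset (zip (map c w) (map Some [0..<k]))"
      by (simp flip: mset_map)
    moreover have "image_mset (F w c) (mset_set ?R) = image_mset (\<lambda>a. (a, None)) (image_mset c (mset_set ?R))"
      unfolding image_mset.compositionality by (rule image_mset_cong) (use D in \<open>auto simp: F_def\<close>)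
    moreover have "M - mset (map c w) = image_mset c (mset_set ?R)"
      using M by simp
    ultimately show ?thesis
      by (simp only: split image_mset_union)
  qed
  have "image_mset (F w c) (mset_set {1..n}) = image_mset (F w' c') (mset_set {1..n})"
    unfolding F[OF w] F[OF w'] eq ..
  then obtain \<tau> where \<tau>: "\<tau> permutes {1..n}" "\<forall>x\<in>{1..n}. F w c x = F w' c' (\<tau> x)"
    by (rule image_mset_eq_implies_permutes[rotated]) simp_all
  have D: "distinct w" "set w \<subseteq> {1..n}" "length w = k" "distinct w'" "length w' = k"
    using w w' by (auto simp: words_of_length_def injective_words_def)
  have "map \<tau> w = w'"
  proof (rule nth_equalityI)
    fix i assume "i < length (map \<tau> w)"
    then have i: "i < k" using D by simp
    then have "w ! i \<in> {1..n}"
      using D by (metis nth_mem subsetD)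
    then have "map_of (zip w' [0..<k]) (\<tau> (w ! i)) = map_of (zip w [0..<k]) (w ! i)"
      using \<tau>(2) by (auto simp: F_def)
    also have "\<dots> = Some i"
      using i D map_of_zip_nth[of w "[0..<k]" i] by simp
    finally have "(\<tau> (w ! i), i) \<in> set (zip w' [0..<k])"
      by (rule map_of_SomeD)
    then have "w' ! i = \<tau> (w ! i)"
      by (auto simp: in_set_zip)
    then show "map \<tau> w ! i = w' ! i"
      using i D by simp
  qed (use D in simp)
  moreover have "c' (\<tau> x) = c x" if "x \<in> {1..n}" for x
    using \<tau>(2) that by (auto simp: F_def)
  ultimately show ?thesis
    using that \<tau>(1) by blast
qed

text \<open>Colour \<open>1..n\<close> by the entries of \<open>s @ t\<close>, where
  \<open>t\<close> lists the rest of \<open>M\<close>, and take the word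
  \<open>1..k\<close>.\<close>

lemma coloured_word_exists:
  assumes "size M = n" "length s = k" "mset s \<subseteq># M"
  obtains w c where "w \<in> words_of_length n k" "c \<in> colourings n M" "map c w = s"
proof -
  obtain t where t: "mset t = M - mset s"
    using ex_mset by blast
  define L where "L = s @ t"
  have L: "mset L = M"
    using t assms(3) by (simp add: L_def)
  then have len: "length L = n"
    using assms(1) by (metis size_mset)
  have "length s \<le> length L"
    by (simp add: L_def)
  then have kn: "k \<le> n"
    using assms(2) len by simp
  define c where "c = restrict (\<lambda>x. L ! (x - 1)) {1..n}"
  have "map c [1..<Suc n] = L"
    by (rule nth_equalityI) (use len in \<open>auto simp: c_def simp del: upt_Suc\<close>)
  moreover have "mset_set {1..n} = mset [1..<Suc n]"
    by (metis atLeastLessThanSuc_atLeastAtMost mset_upt)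
  ultimately have "image_mset c (mset_set {1..n}) = M"
    using L by (metis mset_map)
  then have "c \<in> colourings n M"
    by (auto simp: colourings_def c_def)
  moreover have "[1..<Suc k] \<in> words_of_length n k"
    using kn by (auto simp: words_of_length_def injective_words_def)
  moreover have "map c [1..<Suc k] = s"
    by (rule nth_equalityI)
       (use kn assms(2) in \<open>auto simp: c_def L_def nth_append simp del: upt_Suc\<close>)
  ultimately show ?thesis
    using that by blast
qed

text \<open>
  Burnside's lemma for the action on pairs of an injective word \<open>w\<close> and a colouring \<open>c\<close> of
  \<open>{1..n}\<close> with prescribed content: an orbit is determined by the colours of the letters of \<open>w\<close>.
\<close>

lemma burnside_coloured_words:
  assumes M: "size M = n"
  shows "(\<Sum>\<sigma> | \<sigma> permutes {1..n}. card (fixed_words n k \<sigma>) *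
      card {c \<in> colourings n M. \<forall>x\<in>{1..n}. c (\<sigma> x) = c x})
    = fact n * card {s. length s = k \<and> mset s \<subseteq># M}"
proof -
  define X where "X = {\<sigma>. \<sigma> permutes {1..n}}"
  define P where "P = words_of_length n k \<times> colourings n M"
  define S where "S = {s. length s = k \<and> mset s \<subseteq># M}"
  define R where "R \<rho> p q \<longleftrightarrow> map \<rho> (fst p) = fst q \<and> (\<forall>x\<in>{1..n}. snd q (\<rho> x) = snd p x)"
    for \<rho> :: "nat \<Rightarrow> nat" and p q :: "nat list \<times> (nat \<Rightarrow> nat)"
  define seq where "seq p = map (snd p) (fst p)" for p :: "nat list \<times> (nat \<Rightarrow> nat)"
  have fin: "finite X" "finite P"
    using finite_permutations[of "{1..n}"] finite_words_of_length finite_colourings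
    by (auto simp: X_def P_def)
  have cardX: "card X = fact n"
    using card_permutations[of "{1..n}" n] by (simp add: X_def)
  have finS: "finite S"
    by (rule finite_subset[OF _ finite_lists_length_eq[of "set_mset M" k]])
       (use set_mset_mono in \<open>fastforce simp: S_def\<close>)+
  have seqS: "seq p \<in> S" if "p \<in> P" for p
  proof -
    have D: "distinct (fst p)" "set (fst p) \<subseteq> {1..n}" "length (fst p) = k" "snd p \<in> colourings n M"
      using that by (auto simp: P_def words_of_length_def injective_words_def)
    then have "mset (fst p) \<subseteq># mset_set {1..n}"
      by (metis mset_set_set finite_atLeastAtMost subset_imp_msubset_mset_set)
    then have "mset (seq p) \<subseteq># M"
      using D(4) image_mset_subseteq_mono by (fastforce simp: seq_def colourings_def)
    then show ?thesis using D(3) by (simp add: S_def seq_def)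
  qed
  have fibre: "(\<Sum>p\<in>{p \<in> P. seq p = s}. card {\<sigma> \<in> X. R \<sigma> p p}) = fact n" if s: "s \<in> S" for s
  proof -
    let ?F = "{p \<in> P. seq p = s}"
    obtain w0 c0 where p0: "w0 \<in> words_of_length n k" "c0 \<in> colourings n M" "map c0 w0 = s"
      by (rule coloured_word_exists[OF M, of s k]) (use s in \<open>auto simp: S_def\<close>)
    let ?p0 = "(w0, c0)"
    \<comment> \<open>Composing with a permutation that carries \<open>p\<close> to
      \<open>?p0\<close> identifies the stabiliser of \<open>p\<close> with the set of permutations
      carrying \<open>p\<close> to \<open>?p0\<close>. Summed over the fibre these sets exhaust
      \<open>S_n\<close>, since every \<open>rho\<close> carries exactly one pair to
      \<open>?p0\<close>.\<close>
    have "card {\<sigma> \<in> X. R \<sigma> p p} = card {\<rho> \<in> X. R \<rho> p ?p0}" if p: "p \<in> ?F" for p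
    proof -
      have p': "fst p \<in> words_of_length n k" "snd p \<in> colourings n M" "map (snd p) (fst p) = map c0 w0"
        using p p0(3) by (auto simp: P_def seq_def)
      obtain \<tau> where \<tau>: "\<tau> permutes {1..n}" "map \<tau> (fst p) = w0" "\<And>x. x \<in> {1..n} \<Longrightarrow> c0 (\<tau> x) = snd p x"
        using coloured_words_transitive[OF p'(1,2) p0(1,2) p'(3)] by blast
      have tau_inv: "\<tau> (inv \<tau> x) = x" "inv \<tau> (\<tau> x) = x" for x
        using permutes_inverses[OF \<tau>(1)] by auto
      have "bij_betw (\<lambda>\<sigma>. \<tau> \<circ> \<sigma>) {\<sigma> \<in> X. R \<sigma> p p} {\<rho> \<in> X. R \<rho> p ?p0}"
      proof (rule bij_betw_byWitness[where f' = "\<lambda>\<rho>. inv \<tau> \<circ> \<rho>"])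
        show "(\<lambda>\<sigma>. \<tau> \<circ> \<sigma>) ` {\<sigma> \<in> X. R \<sigma> p p} \<subseteq> {\<rho> \<in> X. R \<rho> p ?p0}"
        proof clarify
          fix \<sigma> assume \<sigma>: "\<sigma> \<in> X" "R \<sigma> p p"
          have "map (\<tau> \<circ> \<sigma>) (fst p) = w0"
            using \<sigma>(2) \<tau>(2) by (metis R_def list.map_comp)
          moreover have "c0 (\<tau> (\<sigma> x)) = snd p x" if "x \<in> {1..n}" for x
            using \<sigma> \<tau>(3) that permutes_in_image[of \<sigma> "{1..n}" x] by (auto simp: R_def X_def)
          ultimately show "\<tau> \<circ> \<sigma> \<in> X \<and> R (\<tau> \<circ> \<sigma>) p ?p0"
            using \<sigma>(1) \<tau>(1) permutes_compose by (auto simp: R_def X_def)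
        qed
        show "(\<lambda>\<rho>. inv \<tau> \<circ> \<rho>) ` {\<rho> \<in> X. R \<rho> p ?p0} \<subseteq> {\<sigma> \<in> X. R \<sigma> p p}"
        proof clarify
          fix \<rho> assume \<rho>: "\<rho> \<in> X" "R \<rho> p ?p0"
          have "map (inv \<tau> \<circ> \<rho>) (fst p) = map (inv \<tau>) (map \<tau> (fst p))"
            using \<rho>(2) \<tau>(2) by (simp add: R_def flip: list.map_comp)
          also have "\<dots> = fst p"
            by (simp add: o_def tau_inv)
          finally have "map (inv \<tau> \<circ> \<rho>) (fst p) = fst p" .
          moreover have "snd p (inv \<tau> (\<rho> x)) = snd p x" if "x \<in> {1..n}" for x
          proof -
            have "inv \<tau> (\<rho> x) \<in> {1..n}"
              using \<rho>(1) that permutes_in_image[of \<rho> "{1..n}"] permutes_in_image[OF permutes_inv[OF \<tau>(1)]]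
              by (auto simp: X_def)
            then have "snd p (inv \<tau> (\<rho> x)) = c0 (\<tau> (inv \<tau> (\<rho> x)))"
              using \<tau>(3) by simp
            then show ?thesis
              using \<rho>(2) that by (simp add: tau_inv R_def)
          qed
          ultimately show "inv \<tau> \<circ> \<rho> \<in> X \<and> R (inv \<tau> \<circ> \<rho>) p p"
            using \<rho>(1) permutes_compose[OF _ permutes_inv[OF \<tau>(1)]] by (auto simp: R_def X_def)
        qed
      qed (auto simp: fun_eq_iff tau_inv)
      then show ?thesis
        by (rule bij_betw_same_card)
    qed
    then have "(\<Sum>p\<in>?F. card {\<sigma> \<in> X. R \<sigma> p p}) = (\<Sum>p\<in>?F. card {\<rho> \<in> X. R \<rho> p ?p0})"
      by (intro sum.cong) auto
    also have "\<dots> = (\<Sum>p\<in>?F. \<Sum>\<rho>\<in>X. if R \<rho> p ?p0 then 1 else 0)"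
      using fin by (simp flip: sum.inter_filter)
    also have "\<dots> = (\<Sum>\<rho>\<in>X. \<Sum>p\<in>?F. if R \<rho> p ?p0 then 1 else 0)"
      by (rule sum.swap)
    also have "\<dots> = (\<Sum>\<rho>\<in>X. 1)"
    proof (intro sum.cong refl)
      fix \<rho> assume "\<rho> \<in> X"
      then have \<rho>: "\<rho> permutes {1..n}" by (simp add: X_def)
      \<comment> \<open>The pair that \<open>rho\<close> carries to \<open>?p0\<close>: the preimage
        of the word and the pulled back colouring, restricted to be extensional.\<close>
      define q where "q = (map (inv \<rho>) w0, restrict (c0 \<circ> \<rho>) {1..n})"
      have rho_inv: "\<rho> (inv \<rho> x) = x" "inv \<rho> (\<rho> x) = x" for x
        using permutes_inverses[OF \<rho>] by auto
      have set_w0: "set w0 \<subseteq> {1..n}"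
        using p0(1) by (auto simp: words_of_length_def injective_words_def)
      have "image_mset (restrict (c0 \<circ> \<rho>) {1..n}) (mset_set {1..n}) = image_mset (c0 \<circ> \<rho>) (mset_set {1..n})"
        by (rule image_mset_cong) simp
      also have "\<dots> = image_mset c0 (mset_set (\<rho> ` {1..n}))"
        using permutes_inj_on[OF \<rho>] by (simp add: image_mset_mset_set image_mset.compositionality[symmetric] flip: image_mset_mset_set)
      also have "\<dots> = M"
        using p0(2) permutes_image[OF \<rho>] by (simp add: colourings_def)
      finally have "restrict (c0 \<circ> \<rho>) {1..n} \<in> colourings n M"
        by (simp add: colourings_def)
      then have qP: "q \<in> P"
        using p0(1) map_permutes_words[OF permutes_inv[OF \<rho>]] by (simp add: P_def q_def)
      have "inv \<rho> x \<in> {1..n}" if "x \<in> set w0" for x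
        using set_w0 that permutes_in_image[OF permutes_inv[OF \<rho>]] by blast
      then have "seq q = map c0 w0"
        by (auto simp: seq_def q_def rho_inv)
      then have "seq q = s"
        using p0(3) by simp
      have "R \<rho> q ?p0"
        by (auto simp: R_def q_def o_def rho_inv)
      have unique: "p = q" if "p \<in> ?F" "R \<rho> p ?p0" for p
      proof -
        have "fst p = map (inv \<rho>) (map \<rho> (fst p))"
          by (simp add: o_def rho_inv)
        then have "fst p = fst q"
          using that(2) by (metis R_def q_def fst_conv)
        moreover have "snd p x = snd q x" for x
          using that by (cases "x \<in> {1..n}") (auto simp: R_def q_def P_def colourings_def PiE_def extensional_def)
        ultimately show ?thesis
          by (auto simp: prod_eq_iff)
      qed
      have "R \<rho> p ?p0 \<longleftrightarrow> p = q" if "p \<in> ?F" for p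
        using unique[OF that] \<open>R \<rho> q ?p0\<close> by blast
      then have "(\<Sum>p\<in>?F. if R \<rho> p ?p0 then 1 else 0) = (\<Sum>p\<in>?F. if p = q then 1 else (0::nat))"
        by (rule sum.cong[OF refl, OF if_cong]) simp_all
      also have "\<dots> = 1"
        using fin(2) qP \<open>seq q = s\<close> by simp
      finally show "(\<Sum>p\<in>?F. if R \<rho> p ?p0 then 1 else 0) = (1::nat)" .
    qed
    finally show ?thesis
      using cardX by simp
  qed
  have "(\<Sum>\<sigma>\<in>X. card (fixed_words n k \<sigma>) * card {c \<in> colourings n M. \<forall>x\<in>{1..n}. c (\<sigma> x) = c x})
      = (\<Sum>\<sigma>\<in>X. card {p \<in> P. R \<sigma> p p})"
  proof (intro sum.cong refl)
    fix \<sigma>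
    have "{p \<in> P. R \<sigma> p p} = fixed_words n k \<sigma> \<times> {c \<in> colourings n M. \<forall>x\<in>{1..n}. c (\<sigma> x) = c x}"
      by (auto simp: P_def R_def fixed_words_def)
    then show "card (fixed_words n k \<sigma>) * card {c \<in> colourings n M. \<forall>x\<in>{1..n}. c (\<sigma> x) = c x}
        = card {p \<in> P. R \<sigma> p p}"
      by (simp add: card_cartesian_product)
  qed
  also have "\<dots> = (\<Sum>\<sigma>\<in>X. \<Sum>p\<in>P. if R \<sigma> p p then 1 else 0)"
    using fin by (simp flip: sum.inter_filter)
  also have "\<dots> = (\<Sum>p\<in>P. \<Sum>\<sigma>\<in>X. if R \<sigma> p p then 1 else 0)"
    by (rule sum.swap)
  also have "\<dots> = (\<Sum>p\<in>P. card {\<sigma> \<in> X. R \<sigma> p p})"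
    using fin by (simp flip: sum.inter_filter)
  also have "\<dots> = (\<Sum>s\<in>S. \<Sum>p\<in>{p \<in> P. seq p = s}. card {\<sigma> \<in> X. R \<sigma> p p})"
    by (rule sum.group[symmetric]) (use fin finS seqS in auto)
  also have "\<dots> = (\<Sum>s\<in>S. fact n)"
    by (intro sum.cong refl fibre)
  finally show ?thesis
    by (simp add: X_def S_def)
qed

lemma frobenius_char_fixed_words:
  assumes "k \<le> n"
  shows "frobenius_char n (\<lambda>\<sigma>. of_nat (card (fixed_words n k \<sigma>))) = psym 1 ^ k * hsym (n - k)"
proof (rule mseries_eqI)
  fix M
  let ?K = "\<lambda>\<sigma>. {c \<in> colourings n M. \<forall>x\<in>{1..n}. c (\<sigma> x) = c x}"
  have "mcoeff (frobenius_char n (\<lambda>\<sigma>. of_nat (card (fixed_words n k \<sigma>)))) M =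
      1 / fact n * of_nat (\<Sum>\<sigma> | \<sigma> permutes {1..n}. card (fixed_words n k \<sigma>) * card (?K \<sigma>))"
    unfolding frobenius_char_def cycle_prod_def[symmetric] by (simp add: mcoeff_cycle_prod)
  also have "\<dots> = mcoeff (psym 1 ^ k * hsym (n - k)) M"
  proof (cases "size M = n")
    case True
    then show ?thesis
      unfolding burnside_coloured_words[OF True] mcoeff_psym_power_hsym using assms by simp
  next
    case False
    have "size M = n" if "c \<in> colourings n M" for c
      using that by (auto simp: colourings_def)
    then have "?K \<sigma> = {}" for \<sigma>
      using False by blast
    then show ?thesis
      using False assms by (simp only: mcoeff_psym_power_hsym) simp
  qed
  finally show "mcoeff (frobenius_char n (\<lambda>\<sigma>. of_nat (card (fixed_words n k \<sigma>)))) M =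
      mcoeff (psym 1 ^ k * hsym (n - k)) M" .
qed

lemma frobenius_char_word_homology:
  "frobenius_char n (word_homology_char n n) = deranged n"
proof -
  have "frobenius_char n (word_homology_char n n) = mscale (1 / fact n)
     (\<Sum>\<sigma> | \<sigma> permutes {1..n}. \<Sum>k\<le>n. mscale ((-1) ^ (n - k))
       (mscale (of_nat (card (fixed_words n k \<sigma>))) (cycle_prod n \<sigma>)))"
    unfolding frobenius_char_def cycle_prod_def[symmetric]
    by (intro arg_cong[of _ _ "mscale _"] sum.cong refl) (simp add: word_homology_char_eq mscale_sum_left)
  also have "\<dots> = (\<Sum>k\<le>n. mscale ((-1) ^ (n - k)) (frobenius_char n (\<lambda>\<sigma>. of_nat (card (fixed_words n k \<sigma>)))))"
    unfolding frobenius_char_def cycle_prod_def[symmetric]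
    by (subst sum.swap) (simp add: mscale_sum_right mult_ac)
  also have "\<dots> = (\<Sum>k\<le>n. mscale ((-1) ^ (n - k)) (psym 1 ^ k * hsym (n - k)))"
    by (intro sum.cong refl) (simp add: frobenius_char_fixed_words)
  also have "\<dots> = deranged n"
    unfolding deranged_def
    by (rule sum.reindex_bij_witness[of _ "\<lambda>k. n - k" "\<lambda>k. n - k"])
       (auto simp: minus_one_power_mult_mseries mult.assoc)
  finally show ?thesis .
qed

theorem theorem2p14:
  fixes n :: nat
  assumes "n \<ge> 2"
  shows "Delta n = (\<Sum>k=0..n. (-1) ^ k * psym 1 ^ (n - k) * hsym k) \<and>
         (\<Sum>k=0..n. (-1) ^ k * psym 1 ^ (n - k) * hsym k) = psym 1 * Delta (n - 1) + (-1) ^ n * hsym n \<and>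
         Delta n = frobenius_char n (word_homology_char n n)"
proof -
  obtain m where m: "n = Suc m" "m \<ge> 1"
    using assms by (cases n) auto
  \<comment> \<open>For \<open>n = 2\<close> the recursion refers to \<open>Delta 1\<close>, which
    is 0 by convention; it agrees with \<open>deranged 1\<close> because
    \<open>p_1 = h_1\<close>.\<close>
  have "deranged 1 = psym 1 - hsym 1"
    by (simp add: deranged_def)
  also have "\<dots> = 0"
    using newton_hsym[of 1] by simp
  finally have "Delta m = deranged m"
    using m(2) Delta_eq_deranged[of m] by (cases "m = 1") (auto simp: Delta_def)
  then have "deranged n = psym 1 * Delta (n - 1) + (-1) ^ n * hsym n"
    using m deranged_Suc[of m] by simp
  then show ?thesis
    using Delta_eq_deranged[OF assms] frobenius_char_word_homology[of n]
    by (simp add: deranged_def)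
qed

end
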